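(* Let $I$ be an isotopy in $\mathrm{Homeo}_0(\mathbb{A})$ from the identity to a homeomorphism $f$. Let $\gamma_0,\gamma_1,\gamma_2$ be three essential, pairwise disjoint, $f$-free Jordan curves in $\mathbb{A}$ such that $\gamma_1$ separates $\gamma_0$ from $\gamma_2$. For $i\in\{0,1\}$ let $A_i$ be the closed annulus delimited by $\gamma_i$ and $\gamma_{i+1}$, and let $A=A_0\cup A_1$. Suppose that (i) $\Theta(A_0)$ and $\Theta(A_1)$ are non-empty, and (ii) $\rho_{\Theta(A_0)}(I)$ is contained in one of the sets $(0,+\infty)$, $(-\infty,0)$ and $\rho_{\Theta(A_1)}(I)$ is contained in the other one. Then $0\in\rho_{\Theta(A)}(I)$.
   Context: $\mathbb{T}^1=\mathbb{R}/\mathbb{Z}$, $\mathbb{A}=\mathbb{T}^1\times\mathbb{R}$ is the open annulus with universal covering $\pi:\mathbb{R}^2\to\mathbb{A}$ and $p_1:\mathbb{R}^2\to\mathbb{R}$ the first coordinate projection. $\mathrm{Homeo}_0(\mathbb{A})$ is the set of homeomorphisms of $\mathbb{A}$ isotopic to the identity. For an isotopy $I=(f_t)_{t\in[0,1]}$ from the identity to $f=f_1$, let $(\tilde f_t)$ be its lift to $\mathbb{R}^2$ with $\tilde f_0=\mathrm{Id}$, and $\tilde f=\tilde f_1$. For $z\in\mathbb{A}$ and $n\ge1$, $\rho_n(z)=\frac1n(p_1(\tilde f^n(\tilde z))-p_1(\tilde z))$ with $\tilde z\in\pi^{-1}(z)$. For a compact $K\subset\mathbb{A}$, $\rho_K(I)=\bigcap_{m\ge1}\mathrm{Cl}\big(\bigcup_{n\ge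 m}\{\rho_n(z): z\in K,\ f^n(z)\in K\}\big)$, closure in $\overline{\mathbb{R}}=\mathbb{R}\cup\{\pm\infty\}$. A Jordan curve $\gamma\subset\mathbb{A}$ is essential if $\mathbb{A}\setminus\gamma$ has two unbounded connected components; it is $f$-free if $f(\gamma)\cap\gamma=\emptyset$. For $E\subset\mathbb{A}$, $\Theta(E)=\{x\in E: f^n(x)\in E\text{ for all }n\in\mathbb{Z}\}$ is the maximal invariant set of $E$. *)

theory Defs
  imports "HOL-Analysis.Analysis" "HOL-Library.Extended_Real"
begin

text \<open>The open annulus T^1 x R, realised as the cylinder {(z,r). |z| = 1} in C x R.\<close>
definition Ann :: "(complex \<times> real) set" where
  "Ann = {(z, r). cmod z = 1}"

definition ann_proj :: "real \<times> real \<Rightarrow> complex \<times> real" where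
  "ann_proj w = (cis (2 * pi * fst w), snd w)"

definition ann_isotopy :: "(real \<Rightarrow> complex \<times> real \<Rightarrow> complex \<times> real) \<Rightarrow> bool" where
  "ann_isotopy H \<longleftrightarrow>
     continuous_on ({0..1} \<times> Ann) (\<lambda>(t, z). H t z) \<and>
     (\<forall>z\<in>Ann. H 0 z = z) \<and>
     (\<forall>t\<in>{0..1}. \<exists>g. homeomorphism Ann Ann (H t) g)"

definition is_isotopy_lift ::
  "(real \<Rightarrow> real \<times> real \<Rightarrow> real \<times> real) \<Rightarrow> (real \<Rightarrow> complex \<times> real \<Rightarrow> complex \<times> real) \<Rightarrow> bool" where
  "is_isotopy_lift Ht H \<longleftrightarrow>
     continuous_on ({0..1} \<times> UNIV) (\<lambda>(t, w). Ht t w) \<and>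
     (\<forall>w. Ht 0 w = w) \<and>
     (\<forall>t\<in>{0..1}. \<forall>w. ann_proj (Ht t w) = H t (ann_proj w))"

definition rho_n :: "(real \<Rightarrow> real \<times> real \<Rightarrow> real \<times> real) \<Rightarrow> nat \<Rightarrow> complex \<times> real \<Rightarrow> real" where
  "rho_n Ht n z = (let w = (SOME w. ann_proj w = z) in
      (fst ((Ht 1 ^^ n) w) - fst w) / real n)"

definition rho_set ::
  "(complex \<times> real \<Rightarrow> complex \<times> real) \<Rightarrow> (real \<Rightarrow> real \<times> real \<Rightarrow> real \<times> real)
     \<Rightarrow> (complex \<times> real) set \<Rightarrow> ereal set" where
  "rho_set f Ht K = (\<Inter>m\<in>{1..}. closure
      (\<Union>n\<in>{m..}. {ereal (rho_n Ht n z) | z. z \<in> K \<and> (f ^^ n) z \<in> K}))"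

text \<open>Maximal invariant set of E (f a bijection of Ann, E \<subseteq> Ann):
  f^n x \<in> E for n \<ge> 0, and f^(-n) x \<in> E, i.e. x \<in> f^n(E).\<close>
definition Theta :: "(complex \<times> real \<Rightarrow> complex \<times> real) \<Rightarrow> (complex \<times> real) set \<Rightarrow> (complex \<times> real) set" where
  "Theta f E = {x \<in> E. \<forall>n. (f ^^ n) x \<in> E \<and> x \<in> (f ^^ n) ` E}"

definition jordan_curve_in_Ann :: "(complex \<times> real) set \<Rightarrow> bool" where
  "jordan_curve_in_Ann \<gamma> \<longleftrightarrow> \<gamma> \<subseteq> Ann \<and>
     (\<exists>p. simple_path p \<and> pathfinish p = pathstart p \<and> path_image p = \<gamma>)"

text \<open>Essential: Ann minus the curve has exactly two unbounded components
  (Ann is closed in C x R, so unbounded = not relatively compact in Ann).\<close>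
definition essential :: "(complex \<times> real) set \<Rightarrow> bool" where
  "essential \<gamma> \<longleftrightarrow> card {C \<in> components (Ann - \<gamma>). \<not> bounded C} = 2"

definition f_free :: "(complex \<times> real \<Rightarrow> complex \<times> real) \<Rightarrow> (complex \<times> real) set \<Rightarrow> bool" where
  "f_free f \<gamma> \<longleftrightarrow> f ` \<gamma> \<inter> \<gamma> = {}"

definition separates :: "(complex \<times> real) set \<Rightarrow> (complex \<times> real) set \<Rightarrow> (complex \<times> real) set \<Rightarrow> bool" where
  "separates \<gamma>1 \<gamma>0 \<gamma>2 \<longleftrightarrow> \<not> (\<exists>C\<in>components (Ann - \<gamma>1). \<gamma>0 \<subseteq> C \<and> \<gamma>2 \<subseteq> C)"

definition closed_annulus_between :: "(complex \<times> real) set \<Rightarrow> (complex \<times> real) set \<Rightarrow> (complex \<times> real) set" where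
  "closed_annulus_between \<gamma> \<gamma>' =
     \<gamma> \<union> \<gamma>' \<union> \<Union>{C \<in> components (Ann - (\<gamma> \<union> \<gamma>')). bounded C}"

end

theory Submission
  imports Defs
begin

text \<open>Lift everything to the plane and let \<open>F\<close> be the lift of the time-one map. Each free curve is
  mapped strictly above or strictly below itself. Suppose \<open>\<gamma>1\<close> moves up (otherwise reflect). The
  theorem follows from one orbit in \<open>A\<close> that comes from \<open>\<Theta>(A\<^sub>0)\<close> and ends at \<open>\<Theta>(A\<^sub>1)\<close>: its
  displacement grows in one direction in the past and in the other in the future, so long segments of it
  have bounded total displacement.

  If one of the outer curves moves down, such an orbit starts on \<open>\<gamma>1\<close> by compactness. Let all three
  curves move up, let \<open>X\<close> be the set of points that do not come from below \<open>\<gamma>0\<close> and \<open>Y\<close> the set of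
  points that do not end up above \<open>\<gamma>2\<close>, and suppose that there is no connecting orbit, so that
  \<open>X \<inter> Y = \<Theta>(A\<^sub>0) \<union> \<Theta>(A\<^sub>1)\<close>. Then \<open>\<gamma>1\<close> contains a point outside \<open>X \<union> Y\<close>, and its orbit crosses \<open>A\<close>
  from below to above. Hence the component of \<open>X\<close> below \<open>\<gamma>2\<close> through \<open>p \<in> \<Theta>(A\<^sub>0)\<close> has uniformly
  bounded width and reaches \<open>\<gamma>2\<close>, and the component of \<open>Y\<close> above \<open>\<gamma>0\<close> through \<open>q \<in> \<Theta>(A\<^sub>1)\<close> has
  uniformly bounded width and reaches \<open>\<gamma>0\<close>. Since \<open>p\<close> and \<open>q\<close> drift apart, no such components meet. Now
  choose \<open>p\<close> far on one side of \<open>q\<close> and iterate until \<open>p\<close> is far on the other side. Disjoint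
  rays from \<open>p\<close> up and from \<open>q\<close> down along these components determine the sign of the variation
  of the argument of \<open>q - p\<close> along the isotopy, while disjoint rays from \<open>p\<close> down and from \<open>q\<close> up on
  the two sides of \<open>\<gamma>1\<close> give the opposite sign.\<close>

section \<open>Periodic sets and paths in the plane\<close>

text \<open>The hypothesis on the rotation sets enters only as uniform drift: a decreasing family of
  closed subsets of the extended line whose intersection is positive is eventually bounded below by
  some \<open>a > 0\<close>, so every long orbit segment in the invariant set is displaced by any
  prescribed amount. The obstacle is that \<open>X\<close> and \<open>Y\<close> are merely closed
  sets, whose components may contain no paths at all. Width: a crossing orbit yields a path from
  bottom to top through the complement of \<open>X\<close> and the region above the upper curve; the
  integer translates of this path fence in every component. Height: \<open>X\<close> is a decreasing
  intersection of connected periodic sets, and such a set cannot have a compact piece isolated from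
  its translates, so no component stops before the upper curve. Rays are then drawn in open
  neighbourhoods of the components, which can be chosen disjoint because the components are compact.
  Angles are measured from the downward vertical: the lower end of one of the paths stays below the
  base point during the whole isotopy and serves as the reference direction at both times.\<close>

definition hperiodic :: "(real \<times> real) set \<Rightarrow> bool" where
  "hperiodic S \<longleftrightarrow> (\<forall>w (k::int). w \<in> S \<longrightarrow> w + (of_int k, 0) \<in> S)"

lemma hperiodicD: "hperiodic S \<Longrightarrow> w \<in> S \<Longrightarrow> w + (of_int k, 0) \<in> S"
  unfolding hperiodic_def by blast

lemma hperiodic_iff:
  assumes "hperiodic S" shows "w + (of_int k, 0) \<in> S \<longleftrightarrow> w \<in> S"
proof
  assume "w + (of_int k, 0) \<in> S"
  then have "w + (of_int k, 0) + (of_int (-k), 0) \<in> S"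
    using assms hperiodicD by blast
  then show "w \<in> S" by (simp add: prod_eq_iff plus_prod_def)
qed (use assms hperiodicD in auto)

lemma hperiodic_Compl: "hperiodic S \<Longrightarrow> hperiodic (- S)"
  using hperiodic_iff[of S] unfolding hperiodic_def[of "- S"] by blast

lemma hperiodic_Int: "hperiodic S \<Longrightarrow> hperiodic T \<Longrightarrow> hperiodic (S \<inter> T)"
  unfolding hperiodic_def by blast

lemma hperiodic_Union: "(\<And>i. i \<in> I \<Longrightarrow> hperiodic (A i)) \<Longrightarrow> hperiodic (\<Union>i\<in>I. A i)"
  unfolding hperiodic_def by blast

lemma unit_translate:
  fixes x :: real
  obtains k :: int where "0 \<le> x + of_int k" "x + of_int k \<le> 1"
proof
  show "0 \<le> x + of_int (- \<lfloor>x\<rfloor>)" "x + of_int (- \<lfloor>x\<rfloor>) \<le> 1"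
    by linarith+
qed

text \<open>The stand-in for compactness in the annulus: a constant for a closed periodic set
  between two levels is found on the slab \<open>0 \<le> fst w \<le> 1\<close> and spread by integer
  translations.\<close>

lemma compact_strip:
  fixes K :: "(real \<times> real) set"
  assumes "closed K" "K \<subseteq> {w. \<bar>snd w\<bar> \<le> M}"
  shows "compact (K \<inter> {w. a \<le> fst w \<and> fst w \<le> b})"
proof -
  have "K \<inter> {w. a \<le> fst w \<and> fst w \<le> b} = K \<inter> ({a..b} \<times> {-M..M})"
    using assms(2) by (auto simp: abs_le_iff)
  then show ?thesis
    using assms(1) by (simp add: closed_Int_compact compact_Times)
qed

text \<open>The sum of the \<open>\<bar>D k\<bar>\<close> over a finite subcover dominates each of
  them, and monotonicity lets every point pass to it; unlike a maximum it also makes sense for an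
  empty cover.\<close>

lemma compact_uniform_bound:
  fixes P :: "real \<Rightarrow> 'a::metric_space \<Rightarrow> bool"
  assumes "compact K" and mono: "\<And>D D' k. P D k \<Longrightarrow> D \<le> D' \<Longrightarrow> P D' k"
    and loc: "\<And>k. k \<in> K \<Longrightarrow> \<exists>r>0. \<exists>D. \<forall>k'\<in>ball k r. P D k'"
  shows "\<exists>D. \<forall>k\<in>K. P D k"
proof -
  obtain r D where rD: "\<And>k. k \<in> K \<Longrightarrow> r k > 0 \<and> (\<forall>k'\<in>ball k (r k). P (D k) k')"
    using loc by metis
  have "K \<subseteq> (\<Union>k\<in>K. ball k (r k))" using rD by fastforce
  then obtain C where C: "C \<subseteq> K" "finite C" "K \<subseteq> (\<Union>k\<in>C. ball k (r k))"
    using compactE_image[OF \<open>compact K\<close>, of K "\<lambda>k. ball k (r k)"] by blast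
  have "P (\<Sum>k\<in>C. \<bar>D k\<bar>) k'" if k': "k' \<in> K" for k'
  proof -
    obtain k where k: "k \<in> C" "k' \<in> ball k (r k)" using C(3) k' by blast
    have "D k \<le> \<bar>D k\<bar>" by simp
    also have "\<dots> \<le> (\<Sum>k\<in>C. \<bar>D k\<bar>)"
      by (rule member_le_sum) (use C k in auto)
    finally show ?thesis using mono rD k C by blast
  qed
  then show ?thesis by blast
qed

text \<open>The Fashoda theorem, carried from \<open>real^2\<close> to pairs by the coordinate map
  \<open>v\<close>.\<close>

lemma crossing_paths:
  fixes f g :: "real \<Rightarrow> real \<times> real"
  assumes "path f" "path g"
    and "path_image f \<subseteq> {a..b} \<times> {c..d}" "path_image g \<subseteq> {a..b} \<times> {c..d}"
    and "fst (pathstart f) = a" "fst (pathfinish f) = b"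
    and "snd (pathstart g) = c" "snd (pathfinish g) = d"
  obtains z where "z \<in> path_image f" "z \<in> path_image g"
proof -
  define v :: "real \<times> real \<Rightarrow> real^2" where "v = (\<lambda>w. \<chi> i. if i = 1 then fst w else snd w)"
  have v12: "v w $ 1 = fst w" "v w $ 2 = snd w" for w by (auto simp: v_def)
  have "continuous_on UNIV v"
    unfolding v_def
  proof (intro continuous_on_vec_lambda)
    show "continuous_on UNIV (\<lambda>w::real\<times>real. if i = 1 then fst w else snd w)" for i :: 2
      by (cases "i = 1") (auto intro!: continuous_intros)
  qed
  then have cont: "continuous_on S v" for S using continuous_on_subset by blast
  have inj: "v w = v w' \<Longrightarrow> w = w'" for w w'
    using v12 by (metis prod.expand)
  have box: "v ` ({a..b} \<times> {c..d}) \<subseteq> cbox (v (a,c)) (v (b,d))"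
    by (auto simp: mem_box_cart forall_2 v12)
  obtain z where z: "z \<in> path_image (v \<circ> f)" "z \<in> path_image (v \<circ> g)"
  proof (rule fashoda[of "v \<circ> f" "v \<circ> g" "v (a,c)" "v (b,d)"])
    show "path (v \<circ> f)" "path (v \<circ> g)" using assms(1,2) cont
      by (auto simp: path_continuous_image)
    show "path_image (v \<circ> f) \<subseteq> cbox (v (a, c)) (v (b, d))"
      "path_image (v \<circ> g) \<subseteq> cbox (v (a, c)) (v (b, d))"
      using assms(3,4) box unfolding path_image_compose by blast+
    show "pathstart (v \<circ> f) $ 1 = v (a, c) $ 1" "pathfinish (v \<circ> f) $ 1 = v (b, d) $ 1"
      "pathstart (v \<circ> g) $ 2 = v (a, c) $ 2" "pathfinish (v \<circ> g) $ 2 = v (b, d) $ 2"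
      using assms by (auto simp: v12 pathstart_compose pathfinish_compose)
  qed
  then show thesis using that inj by (force simp: path_image_compose)
qed

lemma path_bounded_coords:
  fixes f :: "real \<Rightarrow> real \<times> real"
  assumes "path f"
  obtains B where "\<And>w. w \<in> path_image f \<Longrightarrow> \<bar>fst w\<bar> \<le> B \<and> \<bar>snd w\<bar> \<le> B"
proof -
  have "bounded (path_image f)" using assms by (simp add: bounded_path_image)
  then obtain B where "\<And>w. w \<in> path_image f \<Longrightarrow> norm w \<le> B" by (auto simp: bounded_iff)
  then show thesis
    by (intro that[of B]) (metis norm_fst_le norm_snd_le order_trans prod.collapse real_norm_def)
qed

lemma closed_segment_same_fst:
  fixes x :: real assumes "w \<in> closed_segment (x, a) (x, b)"
  shows "fst w = x" "snd w \<in> closed_segment a b"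
proof -
  have "fst w \<in> closed_segment x x" "snd w \<in> closed_segment a b"
    using assms
    by (metis closed_segment_PairD fst_conv snd_conv prod.collapse)+
  then show "fst w = x" "snd w \<in> closed_segment a b" by auto
qed

lemma closed_segment_same_snd:
  fixes y :: real assumes "w \<in> closed_segment (a, y) (b, y)"
  shows "snd w = y" "fst w \<in> closed_segment a b"
proof -
  have "snd w \<in> closed_segment y y" "fst w \<in> closed_segment a b"
    using assms
    by (metis closed_segment_PairD fst_conv snd_conv prod.collapse)+
  then show "snd w = y" "fst w \<in> closed_segment a b" by auto
qed

text \<open>A wider \<open>S\<close> would leave room for an integer translate of \<open>g\<close>
  strictly between \<open>s\<close> and \<open>s'\<close>, and such a translate cuts the strip into
  a left and a right part. The term \<open>2 * B\<close> is the width of the slab holding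
  \<open>g\<close>; the extra 1 pays for rounding the shift to an integer.\<close>

lemma horizontally_confined:
  fixes g :: "real \<Rightarrow> real \<times> real"
  assumes g: "path g" "snd (pathstart g) < -M" "snd (pathfinish g) > M"
    and B: "\<And>w. w \<in> path_image g \<Longrightarrow> \<bar>fst w\<bar> \<le> B"
    and S: "connected S" "S \<subseteq> {w. \<bar>snd w\<bar> \<le> M}"
    and disj: "\<And>w k. w \<in> path_image g \<Longrightarrow> w + (of_int k, 0) \<notin> S"
    and s: "s \<in> S" "s' \<in> S"
  shows "fst s' - fst s \<le> 2 * B + 1"
proof (rule ccontr)
  assume far: "\<not> ?thesis"
  define k :: int where "k = \<lfloor>fst s + B\<rfloor> + 1"
  define c :: "real \<times> real" where "c = (of_int k, 0)"
  define g' where "g' = (\<lambda>t. g t + c)"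
  have k: "fst s + B < of_int k" "of_int k \<le> fst s + B + 1" unfolding k_def by linarith+
  have pg': "path g'" using g(1) unfolding g'_def path_def by (intro continuous_intros)
  have img': "path_image g' = (\<lambda>w. w + c) ` path_image g" by (auto simp: g'_def path_image_def)
  have ends: "pathstart g' = pathstart g + c" "pathfinish g' = pathfinish g + c"
    by (auto simp: g'_def pathstart_def pathfinish_def)
  have loc: "fst s < fst w \<and> fst w < fst s'" if w: "w \<in> path_image g'" for w
  proof -
    obtain u where u: "u \<in> path_image g" "w = u + c" using w img' by blast
    show ?thesis using B[OF u(1)] k far u(2) by (auto simp: c_def)
  qed
  have S': "S \<inter> path_image g' = {}"
    using disj by (force simp: img' c_def)
  \<comment> \<open>The level \<open>h\<close> exceeds \<open>M\<close>, yet the ends of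
    \<open>g'\<close> are not inside the open strip between \<open>-h\<close> and \<open>h\<close>.
    A path in this strip therefore misses the vertical prolongations of \<open>g'\<close>. Passing
    to the open set \<open>O1\<close> is what supplies a path, as \<open>S\<close> is only
    connected.\<close>
  define h where "h = min (- snd (pathstart g)) (snd (pathfinish g))"
  have h: "h > M" "snd (pathstart g') \<le> -h" "snd (pathfinish g') \<ge> h"
    using g by (auto simp: h_def ends c_def)
  define O1 where "O1 = {w. -h < snd w} \<inter> {w. snd w < h} - path_image g'"
  have "open {w::real\<times>real. -h < snd w}" "open {w::real\<times>real. snd w < h}"
    by (auto intro!: open_Collect_less continuous_intros)
  then have oO: "open O1" unfolding O1_def
    by (intro open_Diff open_Int) (use pg' in \<open>auto simp: closed_path_image\<close>)
  have SO: "S \<subseteq> O1" using S(2) S' h(1) by (force simp: O1_def abs_le_iff)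
  have "connected_component O1 s s'" unfolding connected_component_def using SO S(1) s by blast
  then have "path_component O1 s s'" using open_path_connected_component[OF oO] by metis
  then obtain q where q: "path q" "path_image q \<subseteq> O1" "pathstart q = s" "pathfinish q = s'"
    unfolding path_component_def by blast
  obtain B1 where B1: "\<And>w. w \<in> path_image g' \<Longrightarrow> \<bar>fst w\<bar> \<le> B1 \<and> \<bar>snd w\<bar> \<le> B1"
    using path_bounded_coords[OF pg'] by blast
  obtain B2 where B2: "\<And>w. w \<in> path_image q \<Longrightarrow> \<bar>fst w\<bar> \<le> B2 \<and> \<bar>snd w\<bar> \<le> B2"
    using path_bounded_coords[OF q(1)] by blast
  define E where "E = max B1 B2"
  have E1: "\<bar>fst w\<bar> \<le> E" "\<bar>snd w\<bar> \<le> E" if "w \<in> path_image g'" for w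
    using B1[OF that] by (auto simp: E_def)
  have E2: "\<bar>fst w\<bar> \<le> E" "\<bar>snd w\<bar> \<le> E" if "w \<in> path_image q" for w
    using B2[OF that] by (auto simp: E_def)
  have sq: "s \<in> path_image q" "s' \<in> path_image q" using q pathstart_in_path_image pathfinish_in_path_image by metis+
  define a0 where "a0 = pathstart g'" define a1 where "a1 = pathfinish g'"
  have a01: "a0 \<in> path_image g'" "a1 \<in> path_image g'" by (auto simp: a0_def a1_def)
  \<comment> \<open>Both paths are prolonged to the sides of a square. The horizontal pieces lie
    outside the slab containing \<open>G\<close>, the vertical ones outside the strip containing
    \<open>q\<close>, so a crossing can only be a common point of \<open>q\<close> and
    \<open>g'\<close>.\<close>
  define F where "F = linepath (-E, snd s) s +++ q +++ linepath s' (E, snd s')"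
  define G where "G = linepath (fst a0, -E) a0 +++ g' +++ linepath a1 (fst a1, E)"
  have iF: "path_image F = closed_segment (-E, snd s) s \<union> path_image q \<union> closed_segment s' (E, snd s')"
    unfolding F_def by (simp add: path_image_join q Un_assoc)
  have iG: "path_image G = closed_segment (fst a0, -E) a0 \<union> path_image g' \<union> closed_segment a1 (fst a1, E)"
    unfolding G_def by (simp add: path_image_join a0_def a1_def Un_assoc)
  have F1: "snd w = snd s" "fst w \<in> closed_segment (-E) (fst s)" if "w \<in> closed_segment (-E, snd s) s" for w
    using closed_segment_same_snd[of w "-E" "snd s" "fst s"] that by auto
  have F3: "snd w = snd s'" "fst w \<in> closed_segment (fst s') E" if "w \<in> closed_segment s' (E, snd s')" for w
    using closed_segment_same_snd[of w "fst s'" "snd s'" E] that by auto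
  have G1: "fst w = fst a0" "snd w \<in> closed_segment (-E) (snd a0)" if "w \<in> closed_segment (fst a0, -E) a0" for w
    using closed_segment_same_fst[of w "fst a0" "-E" "snd a0"] that by auto
  have G3: "fst w = fst a1" "snd w \<in> closed_segment (snd a1) E" if "w \<in> closed_segment a1 (fst a1, E)" for w
    using closed_segment_same_fst[of w "fst a1" "snd a1" E] that by auto
  have E0: "E \<ge> 0" using E2[OF sq(1)] by linarith
  have segs: "closed_segment (-E) x = {-E..x}" "closed_segment x E = {x..E}" if "\<bar>x\<bar> \<le> E" for x :: real
    using that by (auto simp: closed_segment_eq_real_ivl)
  obtain z where z: "z \<in> path_image F" "z \<in> path_image G"
  proof (rule crossing_paths[of F G "-E" E "-E" E])
    show "path F" "path G" unfolding F_def G_def using q pg'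
      by (auto intro!: path_join_imp simp: a0_def a1_def)
    show "path_image F \<subseteq> {- E..E} \<times> {- E..E}"
    proof
      fix w assume "w \<in> path_image F"
      then consider "w \<in> closed_segment (-E, snd s) s" | "w \<in> path_image q" | "w \<in> closed_segment s' (E, snd s')"
        unfolding iF by blast
      then show "w \<in> {- E..E} \<times> {- E..E}"
      proof cases
        case 1 then show ?thesis using F1[OF 1] E2[OF sq(1)] segs by (auto simp: mem_Times_iff)
      next
        case 2 then show ?thesis using E2[OF 2] by (auto simp: mem_Times_iff abs_le_iff)
      next
        case 3 then show ?thesis using F3[OF 3] E2[OF sq(2)] segs by (auto simp: mem_Times_iff)
      qed
    qed
    show "path_image G \<subseteq> {- E..E} \<times> {- E..E}"
    proof
      fix w assume "w \<in> path_image G"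
      then consider "w \<in> closed_segment (fst a0, -E) a0" | "w \<in> path_image g'" | "w \<in> closed_segment a1 (fst a1, E)"
        unfolding iG by blast
      then show "w \<in> {- E..E} \<times> {- E..E}"
      proof cases
        case 1 then show ?thesis using G1[OF 1] E1[OF a01(1)] segs by (auto simp: mem_Times_iff)
      next
        case 2 then show ?thesis using E1[OF 2] by (auto simp: mem_Times_iff abs_le_iff)
      next
        case 3 then show ?thesis using G3[OF 3] E1[OF a01(2)] segs by (auto simp: mem_Times_iff)
      qed
    qed
  qed (auto simp: F_def G_def)
  have hs: "fst s < fst a0" "fst a0 < fst s'" "fst s < fst a1" "fst a1 < fst s'" using loc a01 by auto
  have Gx: "fst s < fst z \<and> fst z < fst s'"
    using z(2) unfolding iG Un_iff using G1(1)[of z] G3(1)[of z] loc[of z] hs by metis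
  have zq: "z \<in> path_image q"
  proof -
    have "z \<notin> closed_segment (-E, snd s) s"
      using F1(2)[of z] Gx segs(1)[OF E2(1)[OF sq(1)]] by auto
    moreover have "z \<notin> closed_segment s' (E, snd s')"
      using F3(2)[of z] Gx segs(2)[OF E2(1)[OF sq(2)]] by auto
    ultimately show ?thesis using z(1) unfolding iF by simp
  qed
  then have zO: "z \<in> O1" using q by blast
  have "z \<notin> closed_segment (fst a0, -E) a0"
    using G1(2)[of z] zO h(2) segs E1[OF a01(1)] by (auto simp: O1_def a0_def)
  moreover have "z \<notin> closed_segment a1 (fst a1, E)"
    using G3(2)[of z] zO h(3) segs E1[OF a01(2)] by (auto simp: O1_def a1_def)
  moreover have "z \<notin> path_image g'" using zO by (simp add: O1_def)
  ultimately show False using z(2) unfolding iG by simp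
qed

text \<open>The sign \<open>\<tau>\<close> selects rays going up (\<open>\<tau> = 1\<close>) or down (\<open>\<tau> = -1\<close>).\<close>
definition ray :: "real \<Rightarrow> (real \<times> real) set \<Rightarrow> real \<Rightarrow> real \<times> real \<Rightarrow> bool" where
  "ray \<tau> A D p \<longleftrightarrow> (\<exists>l. \<forall>h. \<exists>e. path e \<and> pathstart e = p \<and> path_image e \<subseteq> A \<and>
     (\<forall>w\<in>path_image e. \<bar>fst w - fst p\<bar> \<le> D \<and> l \<le> \<tau> * snd w) \<and> h \<le> \<tau> * snd (pathfinish e))"

lemma ray_mono: "ray \<tau> A D p \<Longrightarrow> D \<le> D' \<Longrightarrow> A \<subseteq> A' \<Longrightarrow> ray \<tau> A' D' p"
  unfolding ray_def by (meson order_trans)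

lemma ray_translate:
  assumes "ray \<tau> A D p" "hperiodic A" shows "ray \<tau> A D (p + (of_int k, 0))"
proof -
  define c :: "real \<times> real" where "c = (of_int k, 0)"
  obtain l where l: "\<And>h. \<exists>e. path e \<and> pathstart e = p \<and> path_image e \<subseteq> A \<and>
     (\<forall>w\<in>path_image e. \<bar>fst w - fst p\<bar> \<le> D \<and> l \<le> \<tau> * snd w) \<and> h \<le> \<tau> * snd (pathfinish e)"
    using assms(1) unfolding ray_def by blast
  have "\<exists>e. path e \<and> pathstart e = p + c \<and> path_image e \<subseteq> A \<and>
     (\<forall>w\<in>path_image e. \<bar>fst w - fst (p + c)\<bar> \<le> D \<and> l \<le> \<tau> * snd w) \<and> h \<le> \<tau> * snd (pathfinish e)" for h
  proof -
    obtain e where e: "path e" "pathstart e = p" "path_image e \<subseteq> A"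
      "\<forall>w\<in>path_image e. \<bar>fst w - fst p\<bar> \<le> D \<and> l \<le> \<tau> * snd w" "h \<le> \<tau> * snd (pathfinish e)"
      using l[of h] by blast
    have im: "path_image (\<lambda>t. e t + c) = (\<lambda>w. w + c) ` path_image e" by (auto simp: path_image_def)
    show ?thesis
    proof (intro exI[of _ "\<lambda>t. e t + c"] conjI)
      show "path (\<lambda>t. e t + c)" using e(1) unfolding path_def by (intro continuous_intros)
      show "path_image (\<lambda>t. e t + c) \<subseteq> A" 
      proof
        fix w assume "w \<in> path_image (\<lambda>t. e t + c)"
        then obtain u where "u \<in> path_image e" "w = u + c" unfolding im by blast
        then show "w \<in> A" using e(3) hperiodicD[OF assms(2)] unfolding c_def by blast
      qed
      show "\<forall>w\<in>path_image (\<lambda>t. e t + c). \<bar>fst w - fst (p + c)\<bar> \<le> D \<and> l \<le> \<tau> * snd w"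
        using e(4) unfolding im by (auto simp: c_def)
    qed (use e in \<open>auto simp: pathstart_def pathfinish_def c_def\<close>)
  qed
  then show ?thesis unfolding ray_def c_def by blast
qed

lemma ray_prepend:
  assumes \<alpha>: "path \<alpha>" "pathstart \<alpha> = p" "pathfinish \<alpha> = c" "path_image \<alpha> \<subseteq> A1"
    and D: "\<And>w. w \<in> path_image \<alpha> \<Longrightarrow> \<bar>fst w - fst p\<bar> \<le> D1"
    and r: "ray \<tau> A2 D2 c"
  shows "ray \<tau> (A1 \<union> A2) (D1 + \<bar>D2\<bar>) p"
proof -
  obtain l where l: "\<And>h. \<exists>e. path e \<and> pathstart e = c \<and> path_image e \<subseteq> A2 \<and>
     (\<forall>w\<in>path_image e. \<bar>fst w - fst c\<bar> \<le> D2 \<and> l \<le> \<tau> * snd w) \<and> h \<le> \<tau> * snd (pathfinish e)"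
    using r unfolding ray_def by blast
  obtain B where B: "\<And>w. w \<in> path_image \<alpha> \<Longrightarrow> \<bar>fst w\<bar> \<le> B \<and> \<bar>snd w\<bar> \<le> B"
    using path_bounded_coords[OF \<alpha>(1)] by blast
  have c: "\<bar>fst c - fst p\<bar> \<le> D1" using D \<alpha> pathfinish_in_path_image by metis
  have "\<exists>e. path e \<and> pathstart e = p \<and> path_image e \<subseteq> A1 \<union> A2 \<and>
     (\<forall>w\<in>path_image e. \<bar>fst w - fst p\<bar> \<le> D1 + \<bar>D2\<bar> \<and> min l (- \<bar>\<tau>\<bar> * B) \<le> \<tau> * snd w) \<and> h \<le> \<tau> * snd (pathfinish e)" for h
  proof -
    obtain e where e: "path e" "pathstart e = c" "path_image e \<subseteq> A2"
      "\<And>w. w\<in>path_image e \<Longrightarrow> \<bar>fst w - fst c\<bar> \<le> D2 \<and> l \<le> \<tau> * snd w" "h \<le> \<tau> * snd (pathfinish e)"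
      using l[of h] by blast
    have im: "path_image (\<alpha> +++ e) = path_image \<alpha> \<union> path_image e"
      using \<alpha> e by (simp add: path_image_join)
    have *: "- \<bar>\<tau>\<bar> * B \<le> \<tau> * snd w" if "w \<in> path_image \<alpha>" for w
    proof -
      have "\<bar>\<tau> * snd w\<bar> \<le> \<bar>\<tau>\<bar> * B" using B[OF that] by (simp add: abs_mult mult_left_mono)
      then show ?thesis by linarith
    qed
    show ?thesis
    proof (intro exI[of _ "\<alpha> +++ e"] conjI ballI)
      fix w assume w: "w \<in> path_image (\<alpha> +++ e)"
      show "\<bar>fst w - fst p\<bar> \<le> D1 + \<bar>D2\<bar>"
        using w unfolding im using D[of w] e(4)[of w] c by fastforce
      show "min l (- \<bar>\<tau>\<bar> * B) \<le> \<tau> * snd w"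
        using w unfolding im using e(4)[of w] *[of w] by fastforce
    qed (use \<alpha> e im in auto)
  qed
  then show ?thesis unfolding ray_def by blast
qed

lemma ray_vertical:
  assumes "\<tau> \<in> {1, -1}" "\<tau> * snd v > M" "{w. \<tau> * snd w > M} \<subseteq> W"
  shows "ray \<tau> W 0 v"
proof -
  have "\<exists>e. path e \<and> pathstart e = v \<and> path_image e \<subseteq> W \<and>
     (\<forall>w\<in>path_image e. \<bar>fst w - fst v\<bar> \<le> 0 \<and> M \<le> \<tau> * snd w) \<and> h \<le> \<tau> * snd (pathfinish e)" for h
  proof -
    define y where "y = \<tau> * max h (\<tau> * snd v)"
    have tt: "\<tau> * \<tau> = 1" using assms(1) by auto
    have ty: "\<tau> * y = max h (\<tau> * snd v)" unfolding y_def using tt by (metis mult.assoc mult_1)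
    have seg: "fst w = fst v \<and> \<tau> * snd w > M" if "w \<in> closed_segment v (fst v, y)" for w
    proof -
      have "fst w = fst v" "snd w \<in> closed_segment (snd v) y"
        using closed_segment_same_fst[of w "fst v" "snd v" y] that by auto
      moreover have "\<tau> * snd w > M"
        using calculation(2) assms(1,2) ty
        by (auto simp: closed_segment_eq_real_ivl split: if_splits)
      ultimately show ?thesis by simp
    qed
    show ?thesis
    proof (intro exI[of _ "linepath v (fst v, y)"] conjI)
      show "path_image (linepath v (fst v, y)) \<subseteq> W"
      proof
        fix w assume "w \<in> path_image (linepath v (fst v, y))"
        then have "\<tau> * snd w > M" using seg[of w] by simp
        then show "w \<in> W" using assms(3) by blast
      qed
      show "\<forall>w\<in>path_image (linepath v (fst v, y)). \<bar>fst w - fst v\<bar> \<le> 0 \<and> M \<le> \<tau> * snd w"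
      proof
        fix w assume "w \<in> path_image (linepath v (fst v, y))"
        then show "\<bar>fst w - fst v\<bar> \<le> 0 \<and> M \<le> \<tau> * snd w" using seg[of w] by simp
      qed
      show "h \<le> \<tau> * snd (pathfinish (linepath v (fst v, y)))" using ty by simp
    qed simp_all
  qed
  then show ?thesis unfolding ray_def by blast
qed

text \<open>A path in \<open>W\<close> leads from a point of \<open>K\<close> to a base point
  \<open>v\<close> beyond the strip, and a vertical line continues from there. Nearby points join
  this path by a short segment, so the width is locally bounded; compactness modulo translation does
  the rest.\<close>

lemma uniform_rays:
  assumes \<tau>: "\<tau> \<in> {1, -1}" and W: "open W" "connected W" "hperiodic W" "{w. \<tau> * snd w > M} \<subseteq> W"
    and K: "closed K" "hperiodic K" "K \<subseteq> W" "K \<subseteq> {w. \<bar>snd w\<bar> \<le> M}"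
  obtains D where "D \<ge> 0" "\<And>k. k \<in> K \<Longrightarrow> ray \<tau> W D k"
proof -
  define K0 where "K0 = K \<inter> {w. 0 \<le> fst w \<and> fst w \<le> 1}"
  have "compact K0" unfolding K0_def using K by (intro compact_strip)
  define v where "v = (0::real, \<tau> * (M + 1))"
  have tv: "\<tau> * snd v > M" using \<tau> by (auto simp: v_def)
  have vW: "v \<in> W" using W(4) tv by auto
  have rv: "ray \<tau> W 0 v" using \<tau> tv W(4) by (rule ray_vertical)
  have pc: "path_connected W" using W(1,2) connected_open_path_connected by blast
  have "\<exists>D. \<forall>k\<in>K0. ray \<tau> W D k"
  proof (rule compact_uniform_bound[OF \<open>compact K0\<close>])
    fix k assume k: "k \<in> K0"
    then have "k \<in> W" using K by (auto simp: K0_def)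
    then obtain r where r: "r > 0" "ball k r \<subseteq> W" using W(1) open_contains_ball by blast
    obtain g where g: "path g" "path_image g \<subseteq> W" "pathstart g = k" "pathfinish g = v"
      using pc \<open>k \<in> W\<close> vW unfolding path_connected_def by blast
    obtain B where B: "\<And>w. w \<in> path_image g \<Longrightarrow> \<bar>fst w\<bar> \<le> B \<and> \<bar>snd w\<bar> \<le> B"
      using path_bounded_coords[OF g(1)] by blast
    have kg: "k \<in> path_image g" using g pathstart_in_path_image by metis
    have "\<bar>fst w - fst k\<bar> \<le> 2 * B" if "w \<in> path_image g" for w
      using B[OF that] B[OF kg] by linarith
    then have rk: "ray \<tau> W (2 * B) k"
      using ray_prepend[OF g(1,3,4,2) _ rv, of "2*B"] by simp
    have "ray \<tau> W (r + \<bar>2 * B\<bar>) k'" if k': "k' \<in> ball k r" for k'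
    proof -
      have seg: "closed_segment k' k \<subseteq> ball k r"
        using k' r by (meson centre_in_ball closed_segment_subset convex_ball)
      have "\<bar>fst w - fst k'\<bar> \<le> r" if "w \<in> closed_segment k' k" for w
      proof -
        have "\<bar>fst w - fst k'\<bar> \<le> norm (w - k')" by (metis fst_diff norm_fst_le prod.collapse real_norm_def)
        also have "\<dots> \<le> norm (k - k')" using that segment_bound by blast
        also have "\<dots> \<le> r" using k' by (simp add: dist_norm)
        finally show ?thesis .
      qed
      moreover have "path_image (linepath k' k) \<subseteq> W" using seg r by auto
      ultimately show ?thesis
        using ray_prepend[of "linepath k' k" k' k W r \<tau> W "2*B"] rk by simp
    qed
    then show "\<exists>r>0. \<exists>D. \<forall>k'\<in>ball k r. ray \<tau> W D k'" using r by blast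
  qed (use ray_mono in blast)
  then obtain D where D: "\<And>k. k \<in> K0 \<Longrightarrow> ray \<tau> W D k" by blast
  have "ray \<tau> W \<bar>D\<bar> k" if k: "k \<in> K" for k
  proof -
    obtain j :: int where j: "0 \<le> fst k + of_int j" "fst k + of_int j \<le> 1" using unit_translate by blast
    have "k + (of_int j, 0) \<in> K0" using j k K(2) hperiodicD by (auto simp: K0_def)
    then have "ray \<tau> W D (k + (of_int j, 0) + (of_int (-j), 0))" using D W(3) ray_translate by blast
    then show ?thesis using ray_mono[of \<tau> W D k "\<bar>D\<bar>" W] by (simp add: plus_prod_def)
  qed
  then show thesis by (intro that[of "\<bar>D\<bar>"]) auto
qed

section \<open>Variation of the argument along an isotopy\<close>

definition cpl :: "real \<times> real \<Rightarrow> complex" where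
  "cpl w = Complex (fst w) (snd w)"

lemma cpl_simps [simp]: "Re (cpl w) = fst w" "Im (cpl w) = snd w" "cpl w = 0 \<longleftrightarrow> w = 0"
  by (auto simp: cpl_def complex_eq_iff prod_eq_iff)

lemma continuous_on_cpl [continuous_intros]:
  "continuous_on S f \<Longrightarrow> continuous_on S (\<lambda>x. cpl (f x))"
  unfolding cpl_def complex_eq by (auto intro!: continuous_intros)

lemma continuous_on_isotopy_compose:
  assumes "continuous_on ({0..1} \<times> UNIV) (\<lambda>(t,w). \<Phi> t w)" "continuous_on S f" "continuous_on S g"
    and "\<And>x. x \<in> S \<Longrightarrow> f x \<in> {0..1::real}"
  shows "continuous_on S (\<lambda>x. \<Phi> (f x) (g x))"
proof -
  have "continuous_on S (\<lambda>x. (\<lambda>(t,w). \<Phi> t w) (f x, g x))"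
    by (rule continuous_on_compose2[OF assms(1) continuous_on_Pair[OF assms(2,3)]]) (use assms(4) in auto)
  then show ?thesis by simp
qed

lemma connected_attains:
  fixes f :: "'a::topological_space \<Rightarrow> real"
  assumes "connected S" "continuous_on S f" "x \<in> S" "y \<in> S" "f x \<le> c" "c \<le> f y"
  shows "\<exists>z\<in>S. f z = c"
proof -
  have "connected (f ` S)" using assms(1,2) connected_continuous_image by blast
  then have "c \<in> f ` S" using assms(3-6) connectedD_interval[of "f ` S" "f x" "f y" c] by blast
  then show ?thesis by blast
qed

text \<open>Half-turn windows are centred at the angles \<open>2 pi m - pi/2\<close> of the downward vertical.\<close>

lemma cos_near_down: "cos (2 * pi * of_int m - pi / 2 + d) = sin d"
  and sin_near_down: "sin (2 * pi * of_int m - pi / 2 + d) = - cos d"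
proof -
  have "2 * pi * of_int m - pi / 2 + d = (2 * pi) * of_int m + (d - pi/2)" by simp
  then show "cos (2 * pi * of_int m - pi / 2 + d) = sin d" "sin (2 * pi * of_int m - pi / 2 + d) = - cos d"
    by (simp_all only: cos_add sin_add cos_int_2pin sin_int_2pin) (simp_all add: cos_diff sin_diff)
qed

text \<open>The cosine vanishes at the downward vertical \<open>c\<close>, so the angle cannot cross
  \<open>c\<close> while the horizontal component keeps its sign. At \<open>x\<close> the window
  turns the sign of the cosine into the sign of \<open>\<theta> x - c\<close>.\<close>

lemma angle_side:
  fixes \<theta> :: "'a::topological_space \<Rightarrow> real"
  assumes S: "connected S" "continuous_on S \<theta>" and \<sigma>: "\<sigma> \<in> {1,-1}" and c: "c = 2 * pi * of_int m - pi / 2"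
    and cos: "\<And>s. s \<in> S \<Longrightarrow> \<sigma> * cos (\<theta> s) > 0" and x: "x \<in> S" "\<bar>\<theta> x - c\<bar> < pi/2" and y: "y \<in> S"
  shows "\<sigma> * (\<theta> y - c) > 0"
proof (rule ccontr)
  assume neg: "\<not> ?thesis"
  define f where "f = (\<lambda>s. \<sigma> * (\<theta> s - c))"
  have cs: "cos (\<theta> s) = sin (\<theta> s - c)" for s using cos_near_down[of m "\<theta> s - c"] by (simp add: c)
  have "\<sigma> * sin (\<theta> x - c) > 0" using cos[OF x(1)] cs by simp
  have "f x > 0"
  proof (rule ccontr)
    assume *: "\<not> 0 < f x"
    consider "\<sigma> = 1" | "\<sigma> = -1" using \<sigma> by blast
    then show False
    proof cases
      case 1
      then have "sin (\<theta> x - c) \<le> 0" using * x(2) sin_ge_zero[of "c - \<theta> x"] pi_gt_zero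
        sin_minus[of "\<theta> x - c"] by (auto simp: f_def abs_if split: if_splits)
      then show False using \<open>\<sigma> * sin (\<theta> x - c) > 0\<close> 1 by simp
    next
      case 2
      then have "sin (\<theta> x - c) \<ge> 0" using * x(2) sin_ge_zero[of "\<theta> x - c"] pi_gt_zero
        by (auto simp: f_def abs_if split: if_splits)
      then show False using \<open>\<sigma> * sin (\<theta> x - c) > 0\<close> 2 by simp
    qed
  qed
  moreover have "f y \<le> 0" using neg by (simp add: f_def)
  moreover have "continuous_on S f" unfolding f_def using S(2) by (intro continuous_intros)
  ultimately obtain z where z: "z \<in> S" "f z = 0"
    using connected_attains[OF S(1), of f y x 0] x y by auto
  then have "\<theta> z = c" using \<sigma> by (auto simp: f_def)
  then show False using cos[OF z(1)] cs[of z] by simp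
qed

text \<open>To leave the window the angle would have to pass a horizontal direction, where the sine
  vanishes.\<close>

lemma angle_low:
  fixes \<theta> :: "'a::topological_space \<Rightarrow> real"
  assumes S: "connected S" "continuous_on S \<theta>" and c: "c = 2 * pi * of_int m - pi / 2"
    and sin: "\<And>s. s \<in> S \<Longrightarrow> sin (\<theta> s) < 0" and x: "x \<in> S" "\<bar>\<theta> x - c\<bar> < pi/2" and y: "y \<in> S"
  shows "\<bar>\<theta> y - c\<bar> < pi/2"
proof (rule ccontr)
  assume neg: "\<not> ?thesis"
  have "continuous_on S (\<lambda>s. \<bar>\<theta> s - c\<bar>)" using S(2) by (intro continuous_intros)
  then obtain z where z: "z \<in> S" "\<bar>\<theta> z - c\<bar> = pi/2"
    using connected_attains[OF S(1), of "\<lambda>s. \<bar>\<theta> s - c\<bar>" x y "pi/2"] x y neg by auto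
  have "cos (\<theta> z - c) = cos \<bar>\<theta> z - c\<bar>" by simp
  then have "cos (\<theta> z - c) = 0" unfolding z(2) by simp
  then show False using sin[OF z(1)] sin_near_down[of m "\<theta> z - c"] by (simp add: c)
qed

lemma sin_neg_window:
  assumes "sin t < 0"
  obtains m :: int where "\<bar>t - (2 * pi * of_int m - pi / 2)\<bar> < pi / 2"
proof
  define m where "m = \<lfloor>(t + 3 * pi / 2) / (2 * pi)\<rfloor>"
  define d where "d = t - (2 * pi * of_int m - pi / 2)"
  have "of_int m \<le> (t + 3 * pi / 2) / (2 * pi)" "(t + 3 * pi / 2) / (2 * pi) < of_int m + 1"
    unfolding m_def by linarith+
  then have "2 * pi * of_int m \<le> t + 3 * pi / 2" "t + 3 * pi / 2 < 2 * pi * of_int m + 2 * pi"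
    by (simp_all add: field_simps)
  then have d: "\<bar>d\<bar> \<le> pi" unfolding d_def by (auto simp: abs_if)
  have "cos d > 0" using assms sin_near_down[of m d] by (simp add: d_def)
  then have "cos \<bar>d\<bar> > cos (pi/2)" by simp
  then show "\<bar>t - (2 * pi * of_int m - pi / 2)\<bar> < pi / 2"
    using cos_monotone_0_pi_le[of "pi/2" "\<bar>d\<bar>"] d unfolding d_def[symmetric] by force
qed

text \<open>The difference of the imaginary parts is continuous with values in the multiples of
  \<open>2 * pi\<close>.\<close>

lemma logs_differ_by_constant:
  fixes \<Lambda> \<Lambda>' :: "'a::topological_space \<Rightarrow> complex"
  assumes "connected S" "continuous_on S \<Lambda>" "continuous_on S \<Lambda>'"
    and eq: "\<And>s. s \<in> S \<Longrightarrow> exp (\<Lambda> s) = exp (\<Lambda>' s)" and xy: "x \<in> S" "y \<in> S"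
  shows "Im (\<Lambda> x) - Im (\<Lambda>' x) = Im (\<Lambda> y) - Im (\<Lambda>' y)"
proof -
  define d where "d = (\<lambda>s. Im (\<Lambda> s) - Im (\<Lambda>' s))"
  have int: "\<exists>n::int. d s = 2 * pi * of_int n" if s: "s \<in> S" for s
  proof -
    obtain n :: int where "\<Lambda> s = \<Lambda>' s + (of_int (2 * n) * pi) * \<i>"
      using eq[OF s] unfolding exp_eq by blast
    then have "d s = 2 * pi * of_int n" by (simp add: d_def)
    then show ?thesis by blast
  qed
  have "d constant_on S"
  proof (rule continuous_discrete_range_constant[OF assms(1)])
    show "continuous_on S d" unfolding d_def using assms(2,3) by (intro continuous_intros)
    fix s assume s: "s \<in> S"
    show "\<exists>e>0. \<forall>t. t \<in> S \<and> d t \<noteq> d s \<longrightarrow> e \<le> norm (d t - d s)"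
    proof (intro exI[of _ "2*pi"] conjI allI impI)
      fix t assume t: "t \<in> S \<and> d t \<noteq> d s"
      obtain n k :: int where nk: "d s = 2 * pi * of_int n" "d t = 2 * pi * of_int k" using int s t by blast
      then have "k \<noteq> n" using t by auto
      then have "1 \<le> \<bar>real_of_int (k - n)\<bar>" by linarith
      moreover have "d t - d s = 2 * pi * of_int (k - n)" using nk by (simp add: algebra_simps)
      then have "norm (d t - d s) = 2 * pi * \<bar>real_of_int (k - n)\<bar>" by (simp add: abs_mult)
      ultimately show "2 * pi \<le> norm (d t - d s)" by simp
    qed simp
  qed
  then show ?thesis using xy unfolding constant_on_def d_def by metis
qed

lemma exp_mult_sign:
  fixes x y a c :: real
  assumes "x - y = exp a * c"
  shows "c < 0 \<longleftrightarrow> x < y" "c > 0 \<longleftrightarrow> x > y"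
proof -
  have "c < 0 \<longleftrightarrow> exp a * c < 0" "c > 0 \<longleftrightarrow> exp a * c > 0" by (simp_all add: mult_less_0_iff zero_less_mult_iff)
  then show "c < 0 \<longleftrightarrow> x < y" "c > 0 \<longleftrightarrow> x > y" using assms by linarith+
qed

text \<open>The reference is the direction from \<open>a\<close> to the end of \<open>g\<close>,
  which by \<open>h5\<close> stays in the lower half-plane during the isotopy. At time 0 the angle
  of \<open>b - a\<close> is on the side \<open>\<sigma>\<close> of it: seen from the top of
  \<open>e\<close> all of \<open>g\<close> is below, and sliding back along \<open>e\<close> to
  \<open>a\<close> keeps \<open>b\<close> on the side \<open>\<sigma>\<close>. At time 1 it is on
  the side \<open>-\<sigma>\<close>, because all of the image of \<open>g\<close> lies on that side
  of \<open>\<Phi> 1 a\<close>. So the angle has moved in the direction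
  \<open>-\<sigma>\<close>.\<close>

lemma arg_variation:
  fixes \<Phi> :: "real \<Rightarrow> real \<times> real \<Rightarrow> real \<times> real" and e g :: "real \<Rightarrow> real \<times> real"
    and \<Lambda> :: "real \<Rightarrow> complex"
  assumes cont: "continuous_on ({0..1} \<times> UNIV) (\<lambda>(t,w). \<Phi> t w)"
    and inj: "\<And>t. t \<in> {0..1} \<Longrightarrow> inj (\<Phi> t)" and id: "\<And>w. \<Phi> 0 w = w"
    and e: "path e" "pathstart e = a" and g: "path g" "pathstart g = b"
    and disj: "path_image e \<inter> path_image g = {}"
    and \<sigma>: "\<sigma> \<in> {1,-1}"
    and h1: "\<And>w. w \<in> path_image e \<Longrightarrow> \<sigma> * (fst b - fst w) > 0"
    and h2: "\<And>w. w \<in> path_image g \<Longrightarrow> \<sigma> * (fst (\<Phi> 1 w) - fst (\<Phi> 1 a)) < 0"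
    and h3: "\<And>w. w \<in> path_image g \<Longrightarrow> snd w < snd (pathfinish e)"
    and h4: "\<And>w. w \<in> path_image e \<Longrightarrow> snd (pathfinish g) < snd w"
    and h5: "\<And>t. t \<in> {0..1} \<Longrightarrow> snd (\<Phi> t (pathfinish g)) < snd (\<Phi> t a)"
    and \<Lambda>: "continuous_on {0..1} \<Lambda>" "\<And>t. t \<in> {0..1} \<Longrightarrow> exp (\<Lambda> t) = cpl (\<Phi> t b - \<Phi> t a)"
  shows "\<sigma> * (Im (\<Lambda> 1) - Im (\<Lambda> 0)) < 0"
proof -
  define Q :: "(real \<times> real) set" where "Q = {0..1} \<times> {0..1}"
  have conv: "convex Q" unfolding Q_def by (intro convex_Times) auto
  have ei: "e s \<in> path_image e" and gi: "g s \<in> path_image g" if "s \<in> {0..1}" for s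
    using that by (auto simp: path_image_def)
  have ce: "continuous_on {0..1} e" and cg: "continuous_on {0..1} g" using e g by (auto simp: path_def)
  have ce': "continuous_on Q (\<lambda>z. e (fst z))" and cg': "continuous_on Q (\<lambda>z. g (snd z))"
    by (auto intro!: continuous_on_compose2[OF ce] continuous_on_compose2[OF cg] continuous_intros simp: Q_def)
  have ends: "e 0 = a" "g 0 = b" "e 1 = pathfinish e" "g 1 = pathfinish g"
    using e g by (auto simp: pathstart_def pathfinish_def)
  have c\<Phi>: "continuous_on Q (\<lambda>z. \<Phi> (fst z) (g (snd z)))"
    by (rule continuous_on_isotopy_compose[OF cont _ cg']) (auto intro!: continuous_intros simp: Q_def)
  have c\<Phi>': "continuous_on Q (\<lambda>z. \<Phi> (fst z) a)"
    by (rule continuous_on_isotopy_compose[OF cont]) (auto intro!: continuous_intros simp: Q_def)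
  \<comment> \<open>In \<open>L1\<close> the coordinates are the parameters of \<open>e\<close> and
    of \<open>g\<close>; in \<open>L2\<close> they are the time and the parameter of
    \<open>g\<close>. On the edge with first coordinate 0 both are logarithms of the same function,
    since \<open>e 0 = a\<close> and \<open>\<Phi> 0\<close> is the identity.\<close>
  obtain L1 where L1: "continuous_on Q L1" "\<And>z. z \<in> Q \<Longrightarrow> cpl (g (snd z) - e (fst z)) = exp (L1 z)"
  proof (rule continuous_logarithm_on_contractible[of Q "\<lambda>z. cpl (g (snd z) - e (fst z))"])
    show "continuous_on Q (\<lambda>z. cpl (g (snd z) - e (fst z)))" using ce' cg' by (intro continuous_intros)
    show "cpl (g (snd z) - e (fst z)) \<noteq> 0" if "z \<in> Q" for z
      using ei[of "fst z"] gi[of "snd z"] disj that by (auto simp: Q_def)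
  qed (use conv convex_imp_contractible in auto)
  obtain L2 where L2: "continuous_on Q L2" "\<And>z. z \<in> Q \<Longrightarrow> cpl (\<Phi> (fst z) (g (snd z)) - \<Phi> (fst z) a) = exp (L2 z)"
  proof (rule continuous_logarithm_on_contractible[of Q "\<lambda>z. cpl (\<Phi> (fst z) (g (snd z)) - \<Phi> (fst z) a)"])
    show "continuous_on Q (\<lambda>z. cpl (\<Phi> (fst z) (g (snd z)) - \<Phi> (fst z) a))" using c\<Phi> c\<Phi>' by (intro continuous_intros)
    show "cpl (\<Phi> (fst z) (g (snd z)) - \<Phi> (fst z) a) \<noteq> 0" if "z \<in> Q" for z
    proof -
      have "g (snd z) \<noteq> a" using ei[of 0] gi[of "snd z"] disj that ends by (auto simp: Q_def)
      moreover have "inj (\<Phi> (fst z))" using inj that by (auto simp: Q_def)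
      ultimately show ?thesis by (auto dest: injD)
    qed
  qed (use conv convex_imp_contractible in auto)
  have ReIm: "Re (exp z) = exp (Re z) * cos (Im z)" "Im (exp z) = exp (Re z) * sin (Im z)" for z
    by (auto simp: Re_exp Im_exp)
  have L1c: "sin (Im (L1 z)) < 0 \<longleftrightarrow> snd (g (snd z)) < snd (e (fst z))"
    "0 < \<sigma> * cos (Im (L1 z)) \<longleftrightarrow> 0 < \<sigma> * (fst (g (snd z)) - fst (e (fst z)))" if "z \<in> Q" for z
  proof -
    have *: "snd (g (snd z)) - snd (e (fst z)) = exp (Re (L1 z)) * sin (Im (L1 z))"
      "fst (g (snd z)) - fst (e (fst z)) = exp (Re (L1 z)) * cos (Im (L1 z))"
      using arg_cong[OF L1(2)[OF that], of Im] arg_cong[OF L1(2)[OF that], of Re] unfolding ReIm by simp_all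
    show "sin (Im (L1 z)) < 0 \<longleftrightarrow> snd (g (snd z)) < snd (e (fst z))" using exp_mult_sign[OF *(1)] by blast
    show "0 < \<sigma> * cos (Im (L1 z)) \<longleftrightarrow> 0 < \<sigma> * (fst (g (snd z)) - fst (e (fst z)))"
      using exp_mult_sign[OF *(2)] \<sigma> by auto
  qed
  have L2c: "sin (Im (L2 z)) < 0 \<longleftrightarrow> snd (\<Phi> (fst z) (g (snd z))) < snd (\<Phi> (fst z) a)"
    "0 < - \<sigma> * cos (Im (L2 z)) \<longleftrightarrow> \<sigma> * (fst (\<Phi> (fst z) (g (snd z))) - fst (\<Phi> (fst z) a)) < 0" if "z \<in> Q" for z
  proof -
    have *: "snd (\<Phi> (fst z) (g (snd z))) - snd (\<Phi> (fst z) a) = exp (Re (L2 z)) * sin (Im (L2 z))"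
      "fst (\<Phi> (fst z) (g (snd z))) - fst (\<Phi> (fst z) a) = exp (Re (L2 z)) * cos (Im (L2 z))"
      using arg_cong[OF L2(2)[OF that], of Im] arg_cong[OF L2(2)[OF that], of Re] unfolding ReIm by simp_all
    show "sin (Im (L2 z)) < 0 \<longleftrightarrow> snd (\<Phi> (fst z) (g (snd z))) < snd (\<Phi> (fst z) a)"
      using exp_mult_sign[OF *(1)] by blast
    show "0 < - \<sigma> * cos (Im (L2 z)) \<longleftrightarrow> \<sigma> * (fst (\<Phi> (fst z) (g (snd z))) - fst (\<Phi> (fst z) a)) < 0"
      using exp_mult_sign[OF *(2)] \<sigma> by auto
  qed
  have edge: "continuous_on {0..1} (\<lambda>s. Im (L (s, c)))" "continuous_on {0..1} (\<lambda>s. Im (L (c, s)))"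
    "continuous_on {0..1} (\<lambda>s. L (s, c))" "continuous_on {0..1} (\<lambda>s. L (c, s))"
    if "c \<in> {0..1}" "continuous_on Q L" for c and L :: "real \<times> real \<Rightarrow> complex"
    by (auto intro!: continuous_intros continuous_on_compose2[OF that(2)] simp: Q_def that(1)[simplified])
  have con: "connected {0..1::real}" by simp
  have Qi: "(s, t) \<in> Q" if "s \<in> {0..1}" "t \<in> {0..1}" for s t using that by (auto simp: Q_def)
  have "sin (Im (L1 (1,1))) < 0" using L1c(1)[of "(1,1)"] h3[OF gi[of 1]] ends by (auto simp: Q_def)
  then obtain m where m: "\<bar>Im (L1 (1,1)) - (2 * pi * of_int m - pi / 2)\<bar> < pi / 2" using sin_neg_window by blast
  define c where "c = 2 * pi * of_int m - pi / 2"
  have a1: "\<bar>Im (L1 (1,0)) - c\<bar> < pi / 2"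
    by (rule angle_low[OF con edge(2)[OF _ L1(1)] c_def, of 1 1 0])
      (use m L1c(1)[OF Qi] h3[OF gi] ends in \<open>auto simp: c_def\<close>)
  have a2: "\<sigma> * (Im (L1 (0,0)) - c) > 0"
    by (rule angle_side[OF con edge(1)[OF _ L1(1)] \<sigma> c_def, of 0 1 0])
      (use a1 L1c(2)[OF Qi] h1[OF ei] ends in auto)
  have a3: "\<bar>Im (L1 (0,1)) - c\<bar> < pi / 2"
    by (rule angle_low[OF con edge(1)[OF _ L1(1)] c_def, of 1 1 0])
      (use m L1c(1)[OF Qi] h4[OF ei] ends in \<open>auto simp: c_def\<close>)
  have sin2: "sin (Im (L2 (t,1))) < 0" if "t \<in> {0..1}" for t
    using L2c(1)[OF Qi[OF that, of 1]] h5[OF that] ends by auto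
  then obtain m' where m': "\<bar>Im (L2 (0,1)) - (2 * pi * of_int m' - pi / 2)\<bar> < pi / 2"
    using sin_neg_window[of "Im (L2 (0,1))"] by auto
  define c' where "c' = 2 * pi * of_int m' - pi / 2"
  have b1: "\<bar>Im (L2 (1,1)) - c'\<bar> < pi / 2"
    by (rule angle_low[OF con edge(1)[OF _ L2(1)] c'_def, of 1 0 1])
      (use m' sin2 in \<open>auto simp: c'_def\<close>)
  have "- \<sigma> \<in> {1,-1}" using \<sigma> by auto
  then have b2: "- \<sigma> * (Im (L2 (1,0)) - c') > 0"
    by (rule angle_side[OF con edge(2)[OF _ L2(1)] _ c'_def, of 1 "- \<sigma>" 1 0, rotated])
      (use b1 L2c(2)[OF Qi] h2[OF gi] in auto)
  have "exp (L1 (0,s)) = exp (L2 (0,s))" if "s \<in> {0..1}" for s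
    using L1(2)[OF Qi[of 0 s]] L2(2)[OF Qi[of 0 s]] that ends id by simp
  then have d1: "Im (L1 (0,0)) - Im (L2 (0,0)) = Im (L1 (0,1)) - Im (L2 (0,1))"
    by (intro logs_differ_by_constant[OF con edge(4)[OF _ L1(1)] edge(4)[OF _ L2(1)], of 0 0]) auto
  have "\<exists>n::int. Im (L1 (0,1)) - Im (L2 (0,1)) = 2 * pi * of_int n"
  proof -
    have "exp (L1 (0,1)) = exp (L2 (0,1))"
      using L1(2)[OF Qi[of 0 1]] L2(2)[OF Qi[of 0 1]] ends id by simp
    then obtain n :: int where "L1 (0,1) = L2 (0,1) + (of_int (2 * n) * pi) * \<i>"
      unfolding exp_eq by blast
    then have "Im (L1 (0,1)) - Im (L2 (0,1)) = 2 * pi * of_int n" by simp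
    then show ?thesis by blast
  qed
  then obtain n :: int where n: "Im (L1 (0,1)) - Im (L2 (0,1)) = 2 * pi * of_int n" by blast
  \<comment> \<open>The angle at \<open>(0,1)\<close> lies in the window of \<open>c\<close> for
    \<open>L1\<close> and in that of \<open>c'\<close> for \<open>L2\<close>. Windows have
    half-width \<open>pi / 2\<close> and centres spaced by \<open>2 * pi\<close>, so the shift by
    \<open>2 * pi * n\<close> must carry one onto the other.\<close>
  have "\<bar>2 * pi * of_int (m - m' - n)\<bar> < pi"
    using a3 m' n unfolding c_def by (simp add: algebra_simps abs_if split: if_splits)
  then have "2 * pi * \<bar>real_of_int (m - m' - n)\<bar> < pi" by (simp add: abs_mult)
  then have "\<bar>real_of_int (m - m' - n)\<bar> < 1" using pi_gt_zero
    by (smt (verit) mult_left_mono mult_cancel_left1)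
  then have "m = m' + n" by linarith
  then have "Im (L2 (0,0)) - c' = Im (L1 (0,0)) - c" using d1 n unfolding c_def c'_def by (simp add: algebra_simps)
  then have a4: "\<sigma> * (Im (L2 (0,0)) - c') > 0" using a2 by simp
  have "exp (\<Lambda> t) = exp (L2 (t,0))" if "t \<in> {0..1}" for t
    using L2(2)[OF Qi[of t 0]] \<Lambda>(2)[of t] that ends by simp
  then have "Im (\<Lambda> 1) - Im (L2 (1,0)) = Im (\<Lambda> 0) - Im (L2 (0,0))"
    by (intro logs_differ_by_constant[OF con \<Lambda>(1) edge(3)[OF _ L2(1)], of 0]) auto
  then have "Im (\<Lambda> 1) - Im (\<Lambda> 0) = (Im (L2 (1,0)) - c') - (Im (L2 (0,0)) - c')" by simp
  then have "\<sigma> * (Im (\<Lambda> 1) - Im (\<Lambda> 0)) = \<sigma> * (Im (L2 (1,0)) - c') - \<sigma> * (Im (L2 (0,0)) - c')"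
    by (simp only: right_diff_distrib)
  then show ?thesis using a4 b2 by simp
qed

text \<open>The last two conjuncts say that the two ends of the annulus are preserved, uniformly in
  the time. Continuity of the inverse is asked at time 1 only, where paths are pulled back.\<close>

definition lift_isotopy :: "(real \<Rightarrow> real \<times> real \<Rightarrow> real \<times> real) \<Rightarrow> bool" where
  "lift_isotopy \<Phi> \<longleftrightarrow>
     continuous_on ({0..1} \<times> UNIV) (\<lambda>(t,w). \<Phi> t w) \<and> (\<forall>w. \<Phi> 0 w = w) \<and>
     (\<forall>t\<in>{0..1}. bij (\<Phi> t)) \<and> continuous_on UNIV (inv (\<Phi> 1)) \<and>
     (\<forall>t\<in>{0..1}. \<forall>w (k::int). \<Phi> t (w + (of_int k, 0)) = \<Phi> t w + (of_int k, 0)) \<and>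
     (\<forall>M. \<exists>M'. \<forall>t\<in>{0..1}. \<forall>w. M' < snd w \<longrightarrow> M < snd (\<Phi> t w)) \<and>
     (\<forall>M. \<exists>M'. \<forall>t\<in>{0..1}. \<forall>w. snd w < M' \<longrightarrow> snd (\<Phi> t w) < M)"

lemma lift_isotopyD:
  assumes "lift_isotopy \<Phi>"
  shows "continuous_on ({0..1} \<times> UNIV) (\<lambda>(t,w). \<Phi> t w)" "\<Phi> 0 w = w"
    "t \<in> {0..1} \<Longrightarrow> bij (\<Phi> t)" "continuous_on UNIV (inv (\<Phi> 1))"
    "t \<in> {0..1} \<Longrightarrow> \<Phi> t (w + (of_int k, 0)) = \<Phi> t w + (of_int k, 0)"
    "\<exists>M'. \<forall>t\<in>{0..1}. \<forall>w. M' < snd w \<longrightarrow> M < snd (\<Phi> t w)"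
    "\<exists>M'. \<forall>t\<in>{0..1}. \<forall>w. snd w < M' \<longrightarrow> snd (\<Phi> t w) < M"
    "continuous_on UNIV (\<Phi> 1)"
proof -
  show c: "continuous_on ({0..1} \<times> UNIV) (\<lambda>(t,w). \<Phi> t w)" using assms by (simp add: lift_isotopy_def)
  show "continuous_on UNIV (\<Phi> 1)"
    using continuous_on_isotopy_compose[OF c, of UNIV "\<lambda>_. 1" "\<lambda>w. w"] by (simp add: continuous_on_id)
qed (use assms in \<open>unfold lift_isotopy_def, blast+\<close>)

lemma lift_isotopy_compose:
  assumes "lift_isotopy \<Phi>" "lift_isotopy \<Psi>"
  shows "lift_isotopy (\<lambda>t. \<Phi> t \<circ> \<Psi> t)"
  unfolding lift_isotopy_def
proof (intro conjI ballI allI)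
  note A = lift_isotopyD[OF assms(1)] and B = lift_isotopyD[OF assms(2)]
  have "continuous_on ({0..1} \<times> UNIV) (\<lambda>z. (\<lambda>(t,w). \<Phi> t w) (fst z, (\<lambda>(t,w). \<Psi> t w) z))"
    by (rule continuous_on_compose2[OF A(1)]) (auto intro!: continuous_intros B(1))
  then show "continuous_on ({0..1} \<times> UNIV) (\<lambda>(t, w). (\<Phi> t \<circ> \<Psi> t) w)" by (simp add: case_prod_unfold)
  show "(\<Phi> 0 \<circ> \<Psi> 0) w = w" for w using A(2) B(2) by simp
  show "bij (\<Phi> t \<circ> \<Psi> t)" if "t \<in> {0..1}" for t using A(3) B(3) that bij_comp by blast
  show "continuous_on UNIV (inv (\<Phi> 1 \<circ> \<Psi> 1))"
    using A(3)[of 1] B(3)[of 1] continuous_on_compose[OF A(4) continuous_on_subset[OF B(4)]]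
    by (simp add: o_inv_distrib)
  show "(\<Phi> t \<circ> \<Psi> t) (w + (of_int k, 0)) = (\<Phi> t \<circ> \<Psi> t) w + (of_int k, 0)" if "t \<in> {0..1}" for t w and k::int
    using A(5) B(5) that by simp
  show "\<exists>M'. \<forall>t\<in>{0..1}. \<forall>w. M' < snd w \<longrightarrow> M < snd ((\<Phi> t \<circ> \<Psi> t) w)" for M
  proof -
    obtain M1 where "\<forall>t\<in>{0..1}. \<forall>w. M1 < snd w \<longrightarrow> M < snd (\<Phi> t w)" using A(6) by blast
    moreover obtain M2 where "\<forall>t\<in>{0..1}. \<forall>w. M2 < snd w \<longrightarrow> M1 < snd (\<Psi> t w)" using B(6) by blast
    ultimately show ?thesis unfolding o_def by blast
  qed
  show "\<exists>M'. \<forall>t\<in>{0..1}. \<forall>w. snd w < M' \<longrightarrow> snd ((\<Phi> t \<circ> \<Psi> t) w) < M" for M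
  proof -
    obtain M1 where "\<forall>t\<in>{0..1}. \<forall>w. snd w < M1 \<longrightarrow> snd (\<Phi> t w) < M" using A(7) by blast
    moreover obtain M2 where "\<forall>t\<in>{0..1}. \<forall>w. snd w < M2 \<longrightarrow> snd (\<Psi> t w) < M1" using B(7) by blast
    ultimately show ?thesis unfolding o_def by blast
  qed
qed

text \<open>Iterating at each time joins the identity to a power of the time-one map. The twist
  argument is applied to such a power, because two points change sides only after many
  iterations.\<close>

lemma lift_isotopy_funpow:
  assumes "lift_isotopy \<Phi>" shows "lift_isotopy (\<lambda>t. \<Phi> t ^^ n)"
proof (induction n)
  case 0
  show ?case unfolding lift_isotopy_def
    by (auto intro!: continuous_intros exI simp: case_prod_unfold inv_id[unfolded id_def])
next
  case (Suc n)
  then show ?case using lift_isotopy_compose[OF assms] by (simp add: comp_def)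
qed

text \<open>Very high points are controlled by \<open>high\<close>, and the remaining ones form a
  compact set modulo translation.\<close>

lemma periodic_snd_lower_bound:
  fixes F :: "real \<times> real \<Rightarrow> real \<times> real"
  assumes cont: "continuous_on UNIV F" and per: "\<And>w (k::int). F (w + (of_int k, 0)) = F w + (of_int k, 0)"
    and high: "\<And>M. \<exists>M'. \<forall>w. M' < snd w \<longrightarrow> M < snd (F w)"
  obtains M' where "\<And>w. M \<le> snd w \<Longrightarrow> M' \<le> snd (F w)"
proof -
  obtain M1 where M1: "\<And>w. M1 < snd w \<Longrightarrow> 0 < snd (F w)" using high by blast
  define K where "K = {0..1::real} \<times> {M..M1}"
  have "compact ((\<lambda>w. snd (F w)) ` K)" unfolding K_def
    by (intro compact_continuous_image continuous_intros compact_Times)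
      (auto intro: continuous_on_subset[OF cont])
  then have "bounded ((\<lambda>w. snd (F w)) ` K)" by (rule compact_imp_bounded)
  then obtain B where B: "\<And>w. w \<in> K \<Longrightarrow> \<bar>snd (F w)\<bar> \<le> B" by (auto simp: bounded_iff)
  have "min 0 (- B) \<le> snd (F w)" if w: "M \<le> snd w" for w
  proof (cases "M1 < snd w")
    case True then show ?thesis using M1 by fastforce
  next
    case False
    obtain k :: int where k: "0 \<le> fst w + of_int k" "fst w + of_int k \<le> 1" using unit_translate by blast
    have "w + (of_int k, 0) \<in> K" using k w False by (auto simp: K_def mem_Times_iff)
    from B[OF this] show ?thesis by (simp add: per)
  qed
  then show thesis using that by blast
qed

text \<open>In \<open>arg_variation\<close>, \<open>e\<close> is a long piece of the upward ray from
  \<open>a\<close>, and \<open>g\<close> is the preimage under \<open>\<Phi> 1\<close> of a long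
  piece of the downward ray from \<open>\<Phi> 1 b\<close>. The gap \<open>D\<close> between the
  points keeps each ray on its side; the conditions on heights are met by taking the pieces long
  enough.\<close>

lemma twist_sign:
  assumes \<Phi>: "lift_isotopy \<Phi>" and \<sigma>: "\<sigma> \<in> {1,-1}"
    and up: "ray 1 A D a" and down: "ray (-1) A' D (\<Phi> 1 b)"
    and disj: "\<And>w. w \<in> A \<Longrightarrow> \<Phi> 1 w \<notin> A'"
    and s1: "\<sigma> * (fst b - fst a) > D" and s2: "\<sigma> * (fst (\<Phi> 1 b) - fst (\<Phi> 1 a)) < - D"
    and \<Lambda>: "continuous_on {0..1} \<Lambda>" "\<And>t. t \<in> {0..1} \<Longrightarrow> exp (\<Lambda> t) = cpl (\<Phi> t b - \<Phi> t a)"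
  shows "\<sigma> * (Im (\<Lambda> 1) - Im (\<Lambda> 0)) < 0"
proof -
  note iso = lift_isotopyD[OF \<Phi>]
  define G where "G = inv (\<Phi> 1)"
  have bij: "bij (\<Phi> 1)" using iso(3)[of 1] by simp
  have FG: "\<Phi> 1 (G w) = w" and GF: "G (\<Phi> 1 w) = w" for w
    unfolding G_def using bij by (auto simp: bij_is_surj surj_f_inv_f bij_is_inj)
  obtain l where l: "\<And>h. \<exists>e. path e \<and> pathstart e = a \<and> path_image e \<subseteq> A \<and>
     (\<forall>w\<in>path_image e. \<bar>fst w - fst a\<bar> \<le> D \<and> l \<le> 1 * snd w) \<and> h \<le> 1 * snd (pathfinish e)"
    using up unfolding ray_def by blast
  obtain l' where l': "\<And>h. \<exists>e. path e \<and> pathstart e = \<Phi> 1 b \<and> path_image e \<subseteq> A' \<and>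
     (\<forall>w\<in>path_image e. \<bar>fst w - fst (\<Phi> 1 b)\<bar> \<le> D \<and> l' \<le> -1 * snd w) \<and> h \<le> -1 * snd (pathfinish e)"
    using down unfolding ray_def by blast
  \<comment> \<open>Points above \<open>u\<close> are mapped above the whole downward ray, so its
    preimage stays at or below the level \<open>u\<close>, and \<open>e\<close> has only to end
    higher.\<close>
  obtain u where u: "\<And>w. u < snd w \<Longrightarrow> - l' < snd (\<Phi> 1 w)" using iso(6)[of "- l'"]
    by (metis atLeastAtMost_iff order_refl zero_le_one)
  have "compact ((\<lambda>t. snd (\<Phi> t a)) ` {0..1})"
    by (intro compact_continuous_image continuous_intros)
      (auto intro!: continuous_on_isotopy_compose[OF iso(1)] continuous_intros)
  then have "bounded ((\<lambda>t. snd (\<Phi> t a)) ` {0..1})" by (rule compact_imp_bounded)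
  then obtain B where B: "\<And>t. t \<in> {0..1} \<Longrightarrow> \<bar>snd (\<Phi> t a)\<bar> \<le> B" unfolding bounded_iff
    by (metis imageI real_norm_def)
  \<comment> \<open>The end of \<open>g\<close> must be below all of \<open>e\<close>, and so low
    that the isotopy never lifts it to the trajectory of \<open>a\<close>. Both hold once it is
    below \<open>min l v - 1\<close>, which is forced by choosing its image below
    \<open>z\<close>.\<close>
  obtain v where v: "\<And>t w. t \<in> {0..1} \<Longrightarrow> snd w < v \<Longrightarrow> snd (\<Phi> t w) < - B" using iso(7)[of "- B"] by blast
  obtain z where z: "\<And>w. min l v - 1 \<le> snd w \<Longrightarrow> z \<le> snd (\<Phi> 1 w)"
  proof (rule periodic_snd_lower_bound[OF iso(8), where M = "min l v - 1"])
    show "\<Phi> 1 (w + (of_int k, 0)) = \<Phi> 1 w + (of_int k, 0)" for w and k :: int using iso(5)[of 1] by simp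
    show "\<exists>M'. \<forall>w. M' < snd w \<longrightarrow> M < snd (\<Phi> 1 w)" for M using iso(6)[of M]
      by (metis atLeastAtMost_iff order_refl zero_le_one)
  qed blast
  obtain e where e: "path e" "pathstart e = a" "path_image e \<subseteq> A"
     "\<And>w. w\<in>path_image e \<Longrightarrow> \<bar>fst w - fst a\<bar> \<le> D \<and> l \<le> snd w" "u + 1 \<le> snd (pathfinish e)"
    using l[of "u + 1"] by auto
  obtain e' where e': "path e'" "pathstart e' = \<Phi> 1 b" "path_image e' \<subseteq> A'"
     "\<And>w. w\<in>path_image e' \<Longrightarrow> \<bar>fst w - fst (\<Phi> 1 b)\<bar> \<le> D \<and> l' \<le> - snd w" "1 - z \<le> - snd (pathfinish e')"
    using l'[of "1 - z"] by auto
  define g where "g = G \<circ> e'"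
  have ig: "path_image g = G ` path_image e'" by (auto simp: g_def path_image_compose)
  have Fg: "\<Phi> 1 w \<in> path_image e'" if "w \<in> path_image g" for w using that ig FG by auto
  have "snd (\<Phi> 1 (pathfinish g)) < z" using e'(5) by (simp add: g_def pathfinish_compose FG)
  then have low: "snd (pathfinish g) < min l v - 1" using z[of "pathfinish g"] by linarith
  show ?thesis
  proof (rule arg_variation[OF iso(1) _ iso(2) e(1,2), of g b])
    show "path g" unfolding g_def using e'(1) iso(4) unfolding G_def
      by (intro path_continuous_image) (auto intro: continuous_on_subset)
    show "pathstart g = b" by (simp add: g_def pathstart_compose e' GF)
    show "path_image e \<inter> path_image g = {}" using Fg disj e(3) e'(3) by blast
    show "\<sigma> * (fst b - fst w) > 0" if "w \<in> path_image e" for w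
      using e(4)[OF that] s1 \<sigma> by (auto simp: abs_if split: if_splits)
    show "\<sigma> * (fst (\<Phi> 1 w) - fst (\<Phi> 1 a)) < 0" if "w \<in> path_image g" for w
      using e'(4)[OF Fg[OF that]] s2 \<sigma> by (auto simp: abs_if split: if_splits)
    show "snd w < snd (pathfinish e)" if "w \<in> path_image g" for w
      using e'(4)[OF Fg[OF that]] u[of w] e(5) by force
    show "snd (pathfinish g) < snd w" if "w \<in> path_image e" for w
      using e(4)[OF that] low by auto
    show "snd (\<Phi> t (pathfinish g)) < snd (\<Phi> t a)" if "t \<in> {0..1}" for t
      using v[OF that, of "pathfinish g"] B[OF that] low by linarith
  qed (use \<sigma> \<Lambda> iso(3) bij_is_inj in auto)
qed

section \<open>Periodic half-planes and drifting components\<close>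

text \<open>The two sides of a lifted essential curve, the curve itself being
  \<open>- L \<inter> - U\<close>. No parametrization of the lift is kept; connectedness of each
  side and of each complement is what survives of the Jordan curve theorem.\<close>

definition halves :: "real \<Rightarrow> (real \<times> real) set \<Rightarrow> (real \<times> real) set \<Rightarrow> bool" where
  "halves M L U \<longleftrightarrow> open L \<and> open U \<and> connected L \<and> connected U \<and> L \<inter> U = {} \<and>
     connected (- L) \<and> connected (- U) \<and> hperiodic L \<and> hperiodic U \<and>
     {w. snd w < - M} \<subseteq> L \<and> {w. snd w > M} \<subseteq> U"

lemma halvesD:
  assumes "halves M L U"
  shows "open L" "open U" "connected L" "connected U" "L \<inter> U = {}" "connected (- L)" "connected (- U)"
    "hperiodic L" "hperiodic U" "snd w < - M \<Longrightarrow> w \<in> L" "snd w > M \<Longrightarrow> w \<in> U"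
    "w \<notin> L \<Longrightarrow> - M \<le> snd w" "w \<notin> U \<Longrightarrow> snd w \<le> M"
  using assms unfolding halves_def by (blast, blast, blast, blast, blast, blast, blast, blast, blast, blast, blast,
      force simp: not_less, force simp: not_less)

text \<open>Unicoherence of the plane: two closed connected sets that cover it have a connected
  intersection.\<close>

lemma connected_middle:
  assumes "halves M L U" shows "connected (- L \<inter> - U)"
proof -
  have "unicoherent (UNIV :: (real \<times> real) set)" by (rule unicoherent_UNIV)
  moreover have "- L \<union> - U = UNIV" using halvesD(5)[OF assms] by auto
  ultimately show ?thesis
    using halvesD(1,2,6,7)[OF assms] unfolding unicoherent_def by (simp add: closed_Compl)
qed

definition reflect :: "real \<times> real \<Rightarrow> real \<times> real" where
  "reflect w = (fst w, - snd w)"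

lemma reflect_simps [simp]: "reflect (reflect w) = w" "fst (reflect w) = fst w" "snd (reflect w) = - snd w"
  by (auto simp: reflect_def)

lemma reflect_translate [simp]: "reflect (w + (c, 0)) = reflect w + (c, 0)"
  by (simp add: reflect_def)

lemma bij_reflect: "bij reflect"
  by (rule o_bij[of reflect]) auto

lemma reflect_vimage_image: "reflect -` S = reflect ` S"
  by (auto simp: image_iff intro: bexI[of _ "reflect _"]) (metis reflect_simps(1))

lemma continuous_on_reflect [continuous_intros]: "continuous_on S f \<Longrightarrow> continuous_on S (\<lambda>x. reflect (f x))"
  unfolding reflect_def by (auto intro!: continuous_intros)

lemma open_reflect_vimage: "open S \<Longrightarrow> open (reflect -` S)"
  by (rule open_vimage) (auto intro: continuous_intros)

lemma connected_reflect_vimage: "connected S \<Longrightarrow> connected (reflect -` S)"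
  unfolding reflect_vimage_image by (intro connected_continuous_image continuous_intros)

lemma hperiodic_reflect_vimage: "hperiodic S \<Longrightarrow> hperiodic (reflect -` S)"
  unfolding hperiodic_def vimage_eq reflect_translate by blast

lemma reflect_conj_funpow: "((\<lambda>w. reflect (F (reflect w))) ^^ n) w = reflect ((F ^^ n) (reflect w))"
  by (induction n) auto

lemma halves_reflect:
  assumes "halves M L U" shows "halves M (reflect -` U) (reflect -` L)"
proof -
  note h = halvesD[OF assms]
  show ?thesis unfolding halves_def vimage_Compl[symmetric]
  proof (intro conjI)
    show "reflect -` U \<inter> reflect -` L = {}" using h(5) by blast
    show "{w. snd w < - M} \<subseteq> reflect -` U"
    proof
      fix w :: "real \<times> real" assume "w \<in> {w. snd w < - M}"
      then show "w \<in> reflect -` U" using h(11)[of "reflect w"] by simp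
    qed
    show "{w. snd w > M} \<subseteq> reflect -` L"
    proof
      fix w :: "real \<times> real" assume "w \<in> {w. snd w > M}"
      then show "w \<in> reflect -` L" using h(10)[of "reflect w"] by simp
    qed
  qed (intro open_reflect_vimage connected_reflect_vimage hperiodic_reflect_vimage h)+
qed

lemma compact_increasing_cover:
  fixes A :: "nat \<Rightarrow> 'a::metric_space set"
  assumes "compact K" "K \<subseteq> (\<Union>n. A n)" "\<And>n. open (A n)" "\<And>n. A n \<subseteq> A (Suc n)"
  obtains n where "K \<subseteq> A n"
proof -
  obtain C where C: "C \<subseteq> UNIV" "finite C" "K \<subseteq> (\<Union>n\<in>C. A n)"
    by (rule compactE_image[OF assms(1), of UNIV A]) (use assms(2,3) in auto)
  have "A n \<subseteq> A (Max (insert 0 C))" if "n \<in> C" for n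
    by (rule lift_Suc_mono_le[of A, OF assms(4)]) (use C that in auto)
  then have "(\<Union>n\<in>C. A n) \<subseteq> A (Max (insert 0 C))" by (rule UN_least)
  then show thesis using C(3) by (intro that[of "Max (insert 0 C)"]) (rule order_trans)
qed

section \<open>Homeomorphisms of the plane commuting with the integer translations\<close>

locale plane_homeo =
  fixes F G :: "real \<times> real \<Rightarrow> real \<times> real"
  assumes contF: "continuous_on UNIV F" and contG: "continuous_on UNIV G"
    and FG [simp]: "F (G w) = w" and GF [simp]: "G (F w) = w"
    and perF: "F (w + (of_int k, 0)) = F w + (of_int k, 0)"
begin

lemma perG: "G (w + (of_int k, 0)) = G w + (of_int k, 0)"
  by (metis FG GF perF)

lemma plane_homeo_inverse: "plane_homeo G F"
  using contF contG perG by unfold_locales auto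

lemma plane_homeo_mirror: "plane_homeo (\<lambda>w. reflect (F (reflect w))) (\<lambda>w. reflect (G (reflect w)))"
proof
  show "continuous_on UNIV (\<lambda>w. reflect (F (reflect w)))"
    by (intro continuous_intros continuous_on_compose2[OF contF]) auto
  show "continuous_on UNIV (\<lambda>w. reflect (G (reflect w)))"
    by (intro continuous_intros continuous_on_compose2[OF contG]) auto
qed (auto simp: perF)

lemma perF_pow: "(F ^^ n) (w + (of_int k, 0)) = (F ^^ n) w + (of_int k, 0)"
  by (induction n) (auto simp: perF)

lemma perG_pow: "(G ^^ n) (w + (of_int k, 0)) = (G ^^ n) w + (of_int k, 0)"
  by (induction n) (auto simp: perG)

lemma FG_pow [simp]: "(F ^^ n) ((G ^^ n) w) = w" "(G ^^ n) ((F ^^ n) w) = w"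
proof -
  show "(F ^^ n) ((G ^^ n) w) = w" for w by (induction n arbitrary: w) (auto simp: funpow_swap1)
  show "(G ^^ n) ((F ^^ n) w) = w" for w by (induction n arbitrary: w) (auto simp: funpow_swap1)
qed

lemma cont_pow: "continuous_on S (F ^^ n)" "continuous_on S (G ^^ n)"
proof -
  have "continuous_on UNIV (F ^^ n)"
    by (induction n) (use continuous_on_compose2[OF contF] in \<open>auto simp: comp_def id_def\<close>)
  moreover have "continuous_on UNIV (G ^^ n)"
    by (induction n) (use continuous_on_compose2[OF contG] in \<open>auto simp: comp_def id_def\<close>)
  ultimately show "continuous_on S (F ^^ n)" "continuous_on S (G ^^ n)" by (auto intro: continuous_on_subset)
qed

lemma vimage_pow: "(G ^^ n) -` S = (F ^^ n) ` S" "(F ^^ n) -` S = (G ^^ n) ` S"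
  by (auto simp: image_iff) (metis FG_pow)+

lemma open_vimage_pow: "open S \<Longrightarrow> open ((F ^^ n) -` S)" "open S \<Longrightarrow> open ((G ^^ n) -` S)"
  by (auto intro: open_vimage cont_pow)

lemma connected_vimage_pow: "connected S \<Longrightarrow> connected ((F ^^ n) -` S)" "connected S \<Longrightarrow> connected ((G ^^ n) -` S)"
  unfolding vimage_pow by (auto intro: connected_continuous_image cont_pow)

lemma hperiodic_vimage_pow: "hperiodic S \<Longrightarrow> hperiodic ((F ^^ n) -` S)" "hperiodic S \<Longrightarrow> hperiodic ((G ^^ n) -` S)"
  unfolding hperiodic_def vimage_eq perF_pow perG_pow by blast+

end

text \<open>Two nested curves that both move up. The pair need not be the outer one: the locale also
  serves for the middle curve together with one outer curve.\<close>

locale drift = plane_homeo +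
  fixes M :: real and L0 U0 L2 U2 :: "(real \<times> real) set"
  assumes halves0: "halves M L0 U0" and halves2: "halves M L2 U2"
    and nest: "- U0 \<subseteq> L2" and up0: "w \<notin> L0 \<Longrightarrow> F w \<in> U0" and up2: "w \<notin> L2 \<Longrightarrow> F w \<in> U2"
begin

lemma down0: "w \<notin> U0 \<Longrightarrow> G w \<in> L0" using up0[of "G w"] by auto

lemma down2: "w \<notin> U2 \<Longrightarrow> G w \<in> L2" using up2[of "G w"] by auto

lemma disj0: "w \<in> L0 \<Longrightarrow> w \<notin> U0" and disj2: "w \<in> L2 \<Longrightarrow> w \<notin> U2"
  using halvesD(5)[OF halves0] halvesD(5)[OF halves2] by auto

lemma L0_L2: "w \<in> L0 \<Longrightarrow> w \<in> L2" and U2_U0: "w \<in> U2 \<Longrightarrow> w \<in> U0"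
  using nest disj0 disj2 by blast+

text \<open>Inverting reverses the motion and reflecting reverses it again, while the two curves
  change places. Every fact about \<open>LL\<close> thereby has a counterpart for
  \<open>RR\<close>.\<close>

lemma mirror: "drift (\<lambda>w. reflect (G (reflect w))) (\<lambda>w. reflect (F (reflect w))) M (reflect -` U2) (reflect -` L2) (reflect -` U0) (reflect -` L0)"
proof -
  interpret gf: plane_homeo G F by (rule plane_homeo_inverse)
  interpret m: plane_homeo "\<lambda>w. reflect (G (reflect w))" "\<lambda>w. reflect (F (reflect w))" by (rule gf.plane_homeo_mirror)
  show ?thesis
    by unfold_locales (use halves0 halves2 nest down0 down2 in \<open>auto simp: halves_reflect\<close>)
qed

text \<open>\<open>LL\<close> is the set of points coming from below the lower curve, \<open>RR\<close> the set of points that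
  end up above the upper curve.\<close>
definition LL :: "(real \<times> real) set" where "LL = (\<Union>n. (G ^^ n) -` L0)"

definition RR :: "(real \<times> real) set" where "RR = (\<Union>n. (F ^^ n) -` U2)"

lemma LL_Suc: "(G ^^ n) -` L0 \<subseteq> (G ^^ Suc n) -` L0"
  using down0 disj0 by auto

lemma open_LL: "open LL"
  unfolding LL_def using open_vimage_pow halvesD(1)[OF halves0] by blast

lemma hperiodic_LL: "hperiodic LL"
  unfolding LL_def by (intro hperiodic_Union hperiodic_vimage_pow halvesD[OF halves0])

lemma L0_LL: "L0 \<subseteq> LL"
proof
  fix w assume "w \<in> L0"
  then have "w \<in> (G ^^ 0) -` L0" by simp
  then show "w \<in> LL" unfolding LL_def by blast
qed

lemma LL_pow_mono: "L0 \<subseteq> (G ^^ n) -` L0"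
  using lift_Suc_mono_le[of "\<lambda>n. (G ^^ n) -` L0", OF LL_Suc, of 0 n] by simp

lemma connected_LL: "connected LL"
  unfolding LL_def
proof (rule connected_Union)
  show "\<And>S. S \<in> range (\<lambda>n. (G ^^ n) -` L0) \<Longrightarrow> connected S"
    using connected_vimage_pow halvesD(3)[OF halves0] by blast
  have "(0, - M - 1) \<in> L0" using halvesD(10)[OF halves0] by simp
  then show "\<Inter> (range (\<lambda>n. (G ^^ n) -` L0)) \<noteq> {}" using LL_pow_mono by blast
qed

lemma G_LL: "G w \<in> LL \<longleftrightarrow> w \<in> LL"
proof
  assume "G w \<in> LL"
  then obtain n where "(G ^^ Suc n) w \<in> L0" unfolding LL_def by (auto simp: funpow_swap1)
  then show "w \<in> LL" unfolding LL_def by blast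
next
  assume "w \<in> LL"
  then obtain n where "(G ^^ n) w \<in> L0" unfolding LL_def by auto
  then have "(G ^^ n) (G w) \<in> L0" using LL_Suc[of n] by (auto simp: funpow_swap1)
  then show "G w \<in> LL" unfolding LL_def by blast
qed

lemma F_LL: "F w \<in> LL \<longleftrightarrow> w \<in> LL" using G_LL[of "F w"] by simp

lemma G_pow_LL: "(G ^^ n) w \<in> LL \<longleftrightarrow> w \<in> LL" by (induction n) (auto simp: G_LL)

lemma F_pow_LL: "(F ^^ n) w \<in> LL \<longleftrightarrow> w \<in> LL" by (induction n) (auto simp: F_LL)

lemma strip_bound: "w \<in> - LL \<inter> - U2 \<Longrightarrow> \<bar>snd w\<bar> \<le> M"
  using halvesD(12)[OF halves0, of w] halvesD(13)[OF halves2, of w] L0_LL by (force simp: abs_le_iff)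

text \<open>An orbit from \<open>LL\<close> into \<open>U2\<close> provides a point \<open>v\<close>
  of \<open>LL \<inter> U2\<close>. Joining \<open>v\<close> to the bottom inside \<open>LL\<close>
  and to the top inside \<open>U2\<close> gives a path all of whose translates miss
  \<open>- LL \<inter> - U2\<close>, so \<open>horizontally_confined\<close> applies with one
  constant for all components.\<close>

lemma components_bounded:
  assumes "LL \<inter> RR \<noteq> {}"
  obtains D where "D \<ge> 0"
    "\<And>S s s'. connected S \<Longrightarrow> S \<subseteq> - LL \<inter> - U2 \<Longrightarrow> s \<in> S \<Longrightarrow> s' \<in> S \<Longrightarrow> \<bar>fst s - fst s'\<bar> \<le> D"
proof -
  obtain z n where z: "z \<in> LL" "(F ^^ n) z \<in> U2" using assms unfolding RR_def by blast
  define v where "v = (F ^^ n) z"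
  have v: "v \<in> LL" "v \<in> U2" using z F_pow_LL by (auto simp: v_def)
  have low: "(0, - M - 1) \<in> LL" using halvesD(10)[OF halves0, of "(0, - M - 1)"] L0_LL by auto
  have "path_connected LL" using open_LL connected_LL connected_open_path_connected by blast
  then obtain g1 where g1: "path g1" "path_image g1 \<subseteq> LL" "pathstart g1 = (0, - M - 1)" "pathfinish g1 = v"
    using low v unfolding path_connected_def by blast
  have high: "(0, M + 1) \<in> U2" using halvesD(11)[OF halves2] by simp
  have "path_connected U2" using halvesD(2,4)[OF halves2] connected_open_path_connected by blast
  then obtain g2 where g2: "path g2" "path_image g2 \<subseteq> U2" "pathstart g2 = v" "pathfinish g2 = (0, M + 1)"
    using high v unfolding path_connected_def by blast
  define g where "g = g1 +++ g2"
  have g: "path g" "path_image g \<subseteq> LL \<union> U2" "pathstart g = (0, - M - 1)" "pathfinish g = (0, M + 1)"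
    using g1 g2 by (auto simp: g_def path_image_join)
  obtain B where B: "\<And>w. w \<in> path_image g \<Longrightarrow> \<bar>fst w\<bar> \<le> B \<and> \<bar>snd w\<bar> \<le> B"
    using path_bounded_coords[OF g(1)] by blast
  have "B \<ge> 0" using B[OF pathstart_in_path_image] by linarith
  have "\<bar>fst s - fst s'\<bar> \<le> 2 * B + 1"
    if S: "connected S" "S \<subseteq> - LL \<inter> - U2" "s \<in> S" "s' \<in> S" for S s s'
  proof -
    have disj: "w + (of_int k, 0) \<notin> S" if "w \<in> path_image g" for w and k :: int
    proof -
      have "w \<in> LL \<or> w \<in> U2" using that g by blast
      then show ?thesis using hperiodicD[OF hperiodic_LL] hperiodicD[OF halvesD(9)[OF halves2]] S(2) by blast
    qed
    have S': "S \<subseteq> {w. \<bar>snd w\<bar> \<le> M}" using S(2) strip_bound by blast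
    have "fst s' - fst s \<le> 2 * B + 1" if "s \<in> S" "s' \<in> S" for s s'
      by (rule horizontally_confined[OF g(1) _ _ _ S(1) S' disj that]) (use g B in auto)
    then show ?thesis using S(3,4) by (smt (verit))
  qed
  then show thesis using that[of "2 * B + 1"] \<open>B \<ge> 0\<close> by simp
qed

lemma component_compact:
  assumes "LL \<inter> RR \<noteq> {}" and p: "p \<in> - LL \<inter> - U2"
  shows "compact (connected_component_set (- LL \<inter> - U2) p)"
proof -
  define Z where "Z = - LL \<inter> - U2"
  define C where "C = connected_component_set Z p"
  have clZ: "closed Z" unfolding Z_def using open_LL halvesD(2)[OF halves2] by auto
  have pC: "p \<in> C" using p by (auto simp: C_def Z_def)
  have CZ: "C \<subseteq> Z" by (simp add: C_def connected_component_subset)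
  obtain D where D: "\<And>S s s'. connected S \<Longrightarrow> S \<subseteq> - LL \<inter> - U2 \<Longrightarrow> s \<in> S \<Longrightarrow> s' \<in> S \<Longrightarrow> \<bar>fst s - fst s'\<bar> \<le> D"
    using components_bounded[OF assms(1)] by metis
  have "closed C" unfolding C_def by (rule closed_connected_component[OF clZ])
  moreover have "C \<subseteq> {w. fst p - D \<le> fst w \<and> fst w \<le> fst p + D}"
  proof
    fix w assume "w \<in> C"
    then have "\<bar>fst w - fst p\<bar> \<le> D" using D[of C w p] CZ pC by (auto simp: C_def Z_def)
    then show "w \<in> {w. fst p - D \<le> fst w \<and> fst w \<le> fst p + D}" by (auto simp: abs_le_iff)
  qed
  ultimately have "compact C"
    using compact_strip[of C M "fst p - D" "fst p + D"] CZ strip_bound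
    unfolding Z_def by (metis (no_types, lifting) Int_absorb2 mem_Collect_eq subset_iff)
  then show ?thesis unfolding C_def Z_def .
qed

text \<open>A component that stayed below the upper curve would sit in a compact piece of
  \<open>- LL\<close> surrounded by a compact set \<open>R\<close> inside \<open>LL\<close>.
  Compactness puts \<open>R\<close> into one stage of the union defining \<open>LL\<close>; the
  complement of that stage is connected, misses \<open>R\<close>, and contains both a point of the
  piece and far translates of it, which is absurd.\<close>

lemma component_reaches_top:
  assumes "LL \<inter> RR \<noteq> {}" and p: "p \<in> - LL \<inter> - U2"
  shows "connected_component_set (- LL \<inter> - U2) p \<inter> - L2 \<noteq> {}"
proof
  define Z where "Z = - LL \<inter> - U2"
  define C where "C = connected_component_set Z p"
  assume "connected_component_set (- LL \<inter> - U2) p \<inter> - L2 = {}"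
  then have CL2: "C \<subseteq> L2" by (auto simp: C_def Z_def)
  have clZ: "closed Z" unfolding Z_def using open_LL halvesD(2)[OF halves2] by auto
  have pC: "p \<in> C" using p by (auto simp: C_def Z_def)
  have CZ: "C \<subseteq> Z" by (simp add: C_def connected_component_subset)
  have "compact C" unfolding C_def Z_def using component_compact assms by blast
  have comp: "C \<in> components Z" using pC CZ by (auto simp: components_def C_def)
  \<comment> \<open>Sura-Bura: a compact component of a locally compact space has arbitrarily small
    compact clopen neighbourhoods, so one of them fits into the open set \<open>L2\<close>.\<close>
  obtain K where K: "openin (top_of_set Z) K" "compact K" "C \<subseteq> K" "K \<subseteq> L2"
    using Sura_Bura_clopen_subset[OF closed_imp_locally_compact[OF clZ] comp \<open>compact C\<close>] halvesD(1)[OF halves2] CL2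
    by metis
  define N where "N = (Z - K) \<union> (- LL \<inter> - L2)"
  have "closedin (top_of_set Z) (Z - K)" using K(1) by auto
  then have "closed (Z - K)" using clZ closedin_closed_trans by blast
  then have "closed N" unfolding N_def using open_LL halvesD(1)[OF halves2] by auto
  have KN: "K \<inter> N = {}" using K(4) by (auto simp: N_def)
  have cover: "- LL \<subseteq> K \<union> N" using disj2 by (auto simp: N_def Z_def)
  obtain d where d: "d > 0" "\<And>x y. x \<in> K \<Longrightarrow> y \<in> N \<Longrightarrow> d \<le> dist x y"
    using separate_compact_closed[OF \<open>compact K\<close> \<open>closed N\<close> KN] by blast
  have Kne: "K \<noteq> {}" and pK: "p \<in> K" using pC K(3) by auto
  \<comment> \<open>\<open>R\<close> runs halfway between \<open>K\<close> and \<open>N\<close>,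
    which together cover \<open>- LL\<close>; hence it lies in \<open>LL\<close>.\<close>
  define R where "R = {x. infdist x K = d / 2}"
  have "compact ({x. infdist x K \<le> d / 2} \<inter> R)"
  proof (rule compact_Int_closed)
    show "compact {x. infdist x K \<le> d / 2}" using compact_infdist_le[OF Kne \<open>compact K\<close>, of "d/2"] d by simp
    show "closed R" unfolding R_def by (intro closed_Collect_eq continuous_intros)
  qed
  moreover have "{x. infdist x K \<le> d / 2} \<inter> R = R" by (auto simp: R_def)
  ultimately have "compact R" by simp
  have "R \<subseteq> LL"
  proof
    fix x assume x: "x \<in> R"
    have "x \<notin> K" using x d by (auto simp: R_def)
    moreover have "x \<notin> N"
    proof
      assume "x \<in> N"
      obtain y where "y \<in> K" "infdist x K = dist x y"
        using infdist_attains_inf[OF compact_imp_closed[OF \<open>compact K\<close>] Kne] by blast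
      then show False using d(2)[of y x] \<open>x \<in> N\<close> x d(1) by (auto simp: R_def dist_commute)
    qed
    ultimately show "x \<in> LL" using cover by blast
  qed
  then have "R \<subseteq> (\<Union>n. (G ^^ n) -` L0)" by (simp add: LL_def)
  then obtain n where n: "R \<subseteq> (G ^^ n) -` L0"
  proof (rule compact_increasing_cover[OF \<open>compact R\<close>])
    show "open ((G ^^ n) -` L0)" for n by (intro open_vimage_pow halvesD(1)[OF halves0])
    show "(G ^^ n) -` L0 \<subseteq> (G ^^ Suc n) -` L0" for n by (rule LL_Suc)
  qed
  define X where "X = (G ^^ n) -` (- L0)"
  have "connected X" unfolding X_def by (intro connected_vimage_pow halvesD(6)[OF halves0])
  have "hperiodic X" unfolding X_def by (intro hperiodic_vimage_pow hperiodic_Compl halvesD(8)[OF halves0])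
  have "p \<in> X" using p unfolding X_def LL_def by auto
  have "bounded K" using \<open>compact K\<close> compact_imp_bounded by blast
  then obtain B where B: "\<And>x. x \<in> K \<Longrightarrow> norm x \<le> B" unfolding bounded_iff by blast
  \<comment> \<open>The shift moves \<open>p\<close> to the right of \<open>K\<close> by more than
    \<open>d\<close>, so the distance to \<open>K\<close> takes the value \<open>d / 2\<close> on
    the connected set \<open>X\<close>.\<close>
  obtain k :: int where k: "of_int k > B + d - fst p" using ex_less_of_int by blast
  define q where "q = p + (of_int k, 0)"
  have qX: "q \<in> X" using \<open>p \<in> X\<close> \<open>hperiodic X\<close> hperiodicD by (auto simp: q_def)
  have "d / 2 \<le> infdist q K"
  proof -
    obtain y where y: "y \<in> K" "infdist q K = dist q y"
      using infdist_attains_inf[OF compact_imp_closed[OF \<open>compact K\<close>] Kne] by blast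
    have "fst y \<le> B" using B[OF y(1)] norm_fst_le[of "fst y" "snd y"] by simp
    then have "d \<le> fst q - fst y" using k by (simp add: q_def)
    also have "\<dots> \<le> dist q y" by (metis abs_ge_self dist_fst_le dist_real_def order_trans)
    finally show ?thesis using y d by simp
  qed
  moreover have "infdist p K \<le> d / 2" using pK d by simp
  moreover have "continuous_on X (\<lambda>x. infdist x K)" by (intro continuous_intros)
  ultimately obtain x where "x \<in> X" "infdist x K = d / 2"
    using connected_attains[OF \<open>connected X\<close>, of "\<lambda>x. infdist x K" p q "d/2"] \<open>p \<in> X\<close> qX by auto
  then show False using n by (auto simp: R_def X_def)
qed

lemma component_G:
  assumes "z \<in> connected_component_set (- LL \<inter> - U2) p"
  shows "G z \<in> connected_component_set (- LL \<inter> - U2) (G p)"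
proof -
  define S where "S = connected_component_set (- LL \<inter> - U2) p"
  have S: "connected S" "S \<subseteq> - LL \<inter> - U2" by (auto simp: S_def dest: connected_component_in)
  have pS: "p \<in> S" using assms by (auto simp: S_def dest: connected_component_in)
  have "connected (G ` S)" using S(1) by (intro connected_continuous_image continuous_on_subset[OF contG]) auto
  moreover have "G ` S \<subseteq> - LL \<inter> - U2" using S(2) G_LL down2 disj2 by blast
  ultimately show ?thesis using pS assms unfolding S_def[symmetric] mem_Collect_eq
    by (meson connected_component_def imageI mem_Collect_eq)
qed

lemma component_G_pow:
  assumes "z \<in> connected_component_set (- LL \<inter> - U2) p"
  shows "(G ^^ n) z \<in> connected_component_set (- LL \<inter> - U2) ((G ^^ n) p)"
  by (induction n) (use assms component_G in auto)

end

lemma ray_mirror: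
  assumes "ray \<tau> A D p" shows "ray (- \<tau>) (reflect -` A) D (reflect p)"
proof -
  obtain l where l: "\<And>h. \<exists>e. path e \<and> pathstart e = p \<and> path_image e \<subseteq> A \<and>
     (\<forall>w\<in>path_image e. \<bar>fst w - fst p\<bar> \<le> D \<and> l \<le> \<tau> * snd w) \<and> h \<le> \<tau> * snd (pathfinish e)"
    using assms unfolding ray_def by blast
  have "\<exists>e. path e \<and> pathstart e = reflect p \<and> path_image e \<subseteq> reflect -` A \<and>
     (\<forall>w\<in>path_image e. \<bar>fst w - fst (reflect p)\<bar> \<le> D \<and> l \<le> - \<tau> * snd w) \<and> h \<le> - \<tau> * snd (pathfinish e)" for h
  proof -
    obtain e where e: "path e" "pathstart e = p" "path_image e \<subseteq> A"
      "\<forall>w\<in>path_image e. \<bar>fst w - fst p\<bar> \<le> D \<and> l \<le> \<tau> * snd w" "h \<le> \<tau> * snd (pathfinish e)"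
      using l[of h] by blast
    have im: "path_image (reflect \<circ> e) = reflect ` path_image e" by (rule path_image_compose)
    show ?thesis
    proof (intro exI[of _ "reflect \<circ> e"] conjI)
      show "path (reflect \<circ> e)" using e(1) by (intro path_continuous_image continuous_intros)
      show "path_image (reflect \<circ> e) \<subseteq> reflect -` A" unfolding im using e(3) by auto
      show "\<forall>w\<in>path_image (reflect \<circ> e). \<bar>fst w - fst (reflect p)\<bar> \<le> D \<and> l \<le> - \<tau> * snd w"
        unfolding im using e(4) by simp
    qed (use e in \<open>auto simp: pathstart_compose pathfinish_compose\<close>)
  qed
  then show ?thesis unfolding ray_def by blast
qed

context drift
begin

lemma U0_forward: "w \<in> U0 \<Longrightarrow> (F ^^ n) w \<in> U0"
proof (induction n)
  case (Suc n)
  then show ?case using disj0[of "(F ^^ n) w"] up0[of "(F ^^ n) w"] by auto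
qed simp

lemma U2_forward: "w \<in> U2 \<Longrightarrow> (F ^^ n) w \<in> U2"
proof (induction n)
  case (Suc n)
  then show ?case using disj2[of "(F ^^ n) w"] up2[of "(F ^^ n) w"] by auto
qed simp

lemma L0_backward: "w \<in> L0 \<Longrightarrow> (G ^^ n) w \<in> L0"
proof (induction n)
  case (Suc n)
  then show ?case using disj0[of "(G ^^ n) w"] down0[of "(G ^^ n) w"] by auto
qed simp

text \<open>The preimage of \<open>w\<close> is not in \<open>LL\<close> either, hence not in
  \<open>L0\<close>, and the lower curve moves up.\<close>

lemma LL_U0: "w \<notin> LL \<Longrightarrow> w \<in> U0"
  using up0[of "G w"] G_LL[of w] L0_LL by auto

lemma closed_curve2: "closed (- L2 \<inter> - U2)"
  using halvesD(1,2)[OF halves2] by auto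

text \<open>The ray follows the component to the upper curve and then stays in the
  \<open>F\<close>-preimage of \<open>U2\<close>, an open connected set containing that curve. The
  first part runs in an open neighbourhood of the component, cut off at the horizontal distance
  \<open>D1 + 1\<close> from \<open>p\<close> so that the width remains uniform.\<close>

lemma component_ray:
  assumes LR: "LL \<inter> RR \<noteq> {}"
  obtains D where "D \<ge> 0"
    "\<And>p W. p \<in> - LL \<inter> - U2 \<Longrightarrow> open W \<Longrightarrow> connected_component_set (- LL \<inter> - U2) p \<subseteq> W \<Longrightarrow>
       ray 1 (W \<inter> U0 \<union> F -` U2) D p"
proof -
  obtain D1 where D1: "D1 \<ge> 0"
    "\<And>S s s'. connected S \<Longrightarrow> S \<subseteq> - LL \<inter> - U2 \<Longrightarrow> s \<in> S \<Longrightarrow> s' \<in> S \<Longrightarrow> \<bar>fst s - fst s'\<bar> \<le> D1"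
    using components_bounded[OF LR] by metis
  obtain D2 where D2: "D2 \<ge> 0" "\<And>c. c \<in> - L2 \<inter> - U2 \<Longrightarrow> ray 1 (F -` U2) D2 c"
  proof (rule uniform_rays[of 1 "F -` U2" M "- L2 \<inter> - U2"])
    show "open (F -` U2)" using open_vimage_pow(1)[of U2 1] halvesD(2)[OF halves2] by simp
    show "connected (F -` U2)" using connected_vimage_pow(1)[of U2 1] halvesD(4)[OF halves2] by simp
    show "hperiodic (F -` U2)" using hperiodic_vimage_pow(1)[of U2 1] halvesD(9)[OF halves2] by simp
    show "{w. M < 1 * snd w} \<subseteq> F -` U2"
    proof
      fix w :: "real \<times> real" assume "w \<in> {w. M < 1 * snd w}"
      then have "w \<in> U2" using halvesD(11)[OF halves2] by simp
      then show "w \<in> F -` U2" using disj2 up2 by blast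
    qed
    show "hperiodic (- L2 \<inter> - U2)" by (intro hperiodic_Int hperiodic_Compl halvesD(8,9)[OF halves2])
    show "- L2 \<inter> - U2 \<subseteq> F -` U2" using up2 by auto
    show "- L2 \<inter> - U2 \<subseteq> {w. \<bar>snd w\<bar> \<le> M}"
    proof
      fix w assume w: "w \<in> - L2 \<inter> - U2"
      show "w \<in> {w. \<bar>snd w\<bar> \<le> M}"
        using w halvesD(12)[OF halves2, of w] halvesD(13)[OF halves2, of w] by (simp add: abs_le_iff)
    qed
  qed (use closed_curve2 in auto)
  have "ray 1 (W \<inter> U0 \<union> F -` U2) (D1 + 1 + D2) p"
    if p: "p \<in> - LL \<inter> - U2" and W: "open W" "connected_component_set (- LL \<inter> - U2) p \<subseteq> W" for p W
  proof -
    define S where "S = connected_component_set (- LL \<inter> - U2) p"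
    have S: "connected S" "S \<subseteq> - LL \<inter> - U2" unfolding S_def by (auto dest: connected_component_in)
    have pS: "p \<in> S" using p by (simp add: S_def)
    obtain c where c: "c \<in> S" "c \<notin> L2" using component_reaches_top[OF LR p] unfolding S_def by blast
    define P where "P = W \<inter> U0 \<inter> ({w. fst p - (D1 + 1) < fst w} \<inter> {w. fst w < fst p + (D1 + 1)})"
    have "open {w::real\<times>real. fst p - (D1 + 1) < fst w}" "open {w::real\<times>real. fst w < fst p + (D1 + 1)}"
      by (auto intro!: open_Collect_less continuous_intros)
    then have oP: "open P" unfolding P_def by (intro open_Int W(1) halvesD(2)[OF halves0])
    have SP: "S \<subseteq> P"
    proof
      fix w assume w: "w \<in> S"
      have "\<bar>fst w - fst p\<bar> \<le> D1" using D1(2)[OF S w pS] .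
      moreover have "w \<in> W" using W(2) w unfolding S_def by blast
      moreover have "w \<in> U0" using S(2) w LL_U0 by blast
      ultimately show "w \<in> P" by (auto simp: P_def abs_le_iff)
    qed
    have "connected_component P p c" unfolding connected_component_def using SP S(1) pS c(1) by blast
    then have "path_component P p c" using open_path_connected_component[OF oP] by metis
    then obtain \<alpha> where \<alpha>: "path \<alpha>" "path_image \<alpha> \<subseteq> P" "pathstart \<alpha> = p" "pathfinish \<alpha> = c"
      unfolding path_component_def by blast
    have "ray 1 (F -` U2) D2 c" using D2(2) c S(2) by blast
    moreover have "path_image \<alpha> \<subseteq> W \<inter> U0" using \<alpha>(2) by (auto simp: P_def)
    moreover have "\<bar>fst w - fst p\<bar> \<le> D1 + 1" if "w \<in> path_image \<alpha>" for w
    proof -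
      have "w \<in> P" using \<alpha>(2) that by blast
      then show ?thesis by (simp add: P_def abs_le_iff)
    qed
    ultimately have "ray 1 (W \<inter> U0 \<union> F -` U2) (D1 + 1 + \<bar>D2\<bar>) p"
      using ray_prepend[OF \<alpha>(1,3,4)] by blast
    then show ?thesis using D2(1) by simp
  qed
  then show thesis using that[of "D1 + 1 + D2"] D1(1) D2(1) by simp
qed

text \<open>The points outside \<open>U2\<close> at time \<open>n\<close> form a connected set that
  contains \<open>q\<close> and also the \<open>n\<close>-th preimage of a low point, which is in
  \<open>L0\<close>; so this set meets the lower curve. The traces decrease with \<open>n\<close>,
  and compactness modulo translation gives a common point.\<close>

lemma curve0_point_staying_below:
  assumes q: "q \<notin> L0" "\<And>n. (F ^^ n) q \<notin> U2"
  obtains w where "w \<notin> L0" "w \<notin> U0" "\<And>n. (F ^^ n) w \<notin> U2"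
proof -
  define K where "K = (\<lambda>n. (- L0 \<inter> - U0 \<inter> (F ^^ n) -` (- U2)) \<inter> {w. 0 \<le> fst w \<and> fst w \<le> 1})"
  have strip: "- L0 \<inter> - U0 \<subseteq> {w. \<bar>snd w\<bar> \<le> M}"
  proof
    fix w assume w: "w \<in> - L0 \<inter> - U0"
    show "w \<in> {w. \<bar>snd w\<bar> \<le> M}"
      using w halvesD(12)[OF halves0, of w] halvesD(13)[OF halves0, of w] by (simp add: abs_le_iff)
  qed
  have "\<Inter> (range K) \<noteq> {}"
  proof (rule compact_nest)
    show "compact (K n)" for n unfolding K_def
    proof (rule compact_strip)
      have "open ((F ^^ n) -` U2)" by (intro open_vimage_pow halvesD(2)[OF halves2])
      then show "closed (- L0 \<inter> - U0 \<inter> (F ^^ n) -` (- U2))"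
        using halvesD(1,2)[OF halves0] by (simp add: vimage_Compl closed_Int closed_Compl)
      show "- L0 \<inter> - U0 \<inter> (F ^^ n) -` (- U2) \<subseteq> {w. \<bar>snd w\<bar> \<le> M}" using strip by blast
    qed
    show "K n \<noteq> {}" for n
    proof -
      define X where "X = (F ^^ n) -` (- U2)"
      have cX: "connected X" unfolding X_def by (intro connected_vimage_pow halvesD(7)[OF halves2])
      have "\<exists>c. c \<in> X \<and> c \<notin> L0 \<and> c \<notin> U0"
      proof (rule ccontr)
        assume no: "\<not> ?thesis"
        define v where "v = (0::real, - M - 1)"
        have v: "v \<in> L0" using halvesD(10)[OF halves0] by (simp add: v_def)
        have "(G ^^ n) v \<in> X" using v L0_L2 disj2 by (auto simp: X_def)
        moreover have "(G ^^ n) v \<in> L0" using v by (rule L0_backward)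
        moreover have "q \<in> X" using q by (simp add: X_def)
        moreover have "q \<in> U0" using no \<open>q \<in> X\<close> q by blast
        ultimately show False
          using connectedD[OF cX halvesD(1,2)[OF halves0]] no halvesD(5)[OF halves0] by blast
      qed
      then obtain c where c: "c \<in> X" "c \<notin> L0" "c \<notin> U0" by blast
      obtain k :: int where k: "0 \<le> fst c + of_int k" "fst c + of_int k \<le> 1" using unit_translate by blast
      have "c + (of_int k, 0) \<in> K n"
        using c k hperiodic_iff[OF halvesD(8)[OF halves0]] hperiodic_iff[OF halvesD(9)[OF halves0]]
          hperiodic_iff[OF halvesD(9)[OF halves2]]
        by (simp add: K_def X_def perF_pow)
      then show ?thesis by blast
    qed
    show "K n \<subseteq> K m" if "m \<le> n" for m n
    proof
      fix w assume w: "w \<in> K n"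
      have "(F ^^ m) w \<notin> U2"
      proof
        assume "(F ^^ m) w \<in> U2"
        then have "(F ^^ (n - m)) ((F ^^ m) w) \<in> U2" by (rule U2_forward)
        then show False using w that by (simp add: K_def flip: comp_apply[of "F ^^ (n - m)" "F ^^ m"] funpow_add)
      qed
      then show "w \<in> K m" using w by (simp add: K_def)
    qed
  qed
  then obtain w where "\<And>n. w \<in> K n" by blast
  then show thesis using that[of w] by (auto simp: K_def)
qed

end

section \<open>Invariant sets in the plane and the configuration of three curves\<close>

definition inv_set :: "('a \<Rightarrow> 'a) \<Rightarrow> ('a \<Rightarrow> 'a) \<Rightarrow> 'a set \<Rightarrow> 'a set" where
  "inv_set F G E = {w. \<forall>n. (F ^^ n) w \<in> E \<and> (G ^^ n) w \<in> E}"

lemma (in plane_homeo) inv_set_G: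
  assumes "w \<in> inv_set F G E" shows "G w \<in> inv_set F G E"
  unfolding inv_set_def mem_Collect_eq
proof (intro allI conjI)
  fix n
  have "(G ^^ Suc n) w \<in> E" using assms unfolding inv_set_def by blast
  then show "(G ^^ n) (G w) \<in> E" by (simp add: funpow_swap1)
  show "(F ^^ n) (G w) \<in> E"
  proof (cases n)
    case 0
    have "(G ^^ 1) w \<in> E" using assms unfolding inv_set_def by blast
    then show ?thesis using 0 by simp
  next
    case (Suc m)
    have "(F ^^ n) (G w) = (F ^^ m) w" by (simp add: Suc funpow_swap1)
    then show ?thesis using assms unfolding inv_set_def by simp
  qed
qed

lemma (in plane_homeo) inv_set_F:
  assumes "w \<in> inv_set F G E" shows "F w \<in> inv_set F G E"
proof -
  interpret gf: plane_homeo G F by (rule plane_homeo_inverse)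
  have "w \<in> inv_set G F E" using assms by (auto simp: inv_set_def)
  then have "F w \<in> inv_set G F E" by (rule gf.inv_set_G)
  then show ?thesis by (auto simp: inv_set_def)
qed

lemma (in plane_homeo) inv_set_pow:
  assumes "w \<in> inv_set F G E" shows "(F ^^ n) w \<in> inv_set F G E" "(G ^^ n) w \<in> inv_set F G E"
  by (induction n) (use assms inv_set_F inv_set_G in auto)

lemma (in plane_homeo) hperiodic_inv_set:
  assumes "hperiodic E" shows "hperiodic (inv_set F G E)"
  using assms unfolding hperiodic_def inv_set_def by (simp add: perF_pow perG_pow del: split_paired_All)

locale three_curves = plane_homeo +
  fixes M :: real and L0 U0 L1 U1 L2 U2 :: "(real \<times> real) set"
  assumes halves0: "halves M L0 U0" and halves1: "halves M L1 U1" and halves2: "halves M L2 U2"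
    and nest01: "- U0 \<subseteq> L1" and nest12: "- U1 \<subseteq> L2"
begin

abbreviation "Th0 \<equiv> inv_set F G (- L0 \<inter> - U1)"
abbreviation "Th1 \<equiv> inv_set F G (- L1 \<inter> - U2)"

lemma L01: "L0 \<subseteq> L1" and L12: "L1 \<subseteq> L2" and U21: "U2 \<subseteq> U1" and U10: "U1 \<subseteq> U0" and nest02: "- U0 \<subseteq> L2"
  using nest01 nest12 halvesD(5)[OF halves0] halvesD(5)[OF halves1] halvesD(5)[OF halves2] by blast+

end

section \<open>Absence of a connecting orbit\<close>

context three_curves
begin

text \<open>The form in which the rotation hypothesis is used: \<open>\<sigma>\<close> is the
  direction of drift in the lower band, and the drift exceeds any \<open>B\<close> after a time
  common to all points.\<close>

definition opposite_rotation :: "real \<Rightarrow> bool" where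
  "opposite_rotation \<sigma> \<longleftrightarrow> \<sigma> \<in> {1,-1} \<and> (\<forall>B. \<exists>N. \<forall>n\<ge>N.
     (\<forall>w\<in>Th0. \<sigma> * (fst ((F ^^ n) w) - fst w) \<ge> B) \<and> (\<forall>w\<in>Th1. \<sigma> * (fst ((F ^^ n) w) - fst w) \<le> - B))"

lemma opposite_rotationD:
  assumes "opposite_rotation \<sigma>"
  obtains n where "n \<ge> m" "\<And>w. w \<in> Th0 \<Longrightarrow> \<sigma> * (fst ((F ^^ n) w) - fst w) \<ge> B"
    "\<And>w. w \<in> Th1 \<Longrightarrow> \<sigma> * (fst ((F ^^ n) w) - fst w) \<le> - B"
proof -
  obtain N where N: "\<forall>n\<ge>N. (\<forall>w\<in>Th0. \<sigma> * (fst ((F ^^ n) w) - fst w) \<ge> B) \<and> (\<forall>w\<in>Th1. \<sigma> * (fst ((F ^^ n) w) - fst w) \<le> - B)"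
    using assms unfolding opposite_rotation_def by blast
  have "max m N \<ge> N" by simp
  with N have "(\<forall>w\<in>Th0. \<sigma> * (fst ((F ^^ max m N) w) - fst w) \<ge> B) \<and> (\<forall>w\<in>Th1. \<sigma> * (fst ((F ^^ max m N) w) - fst w) \<le> - B)"
    by blast
  then show thesis by (intro that[of "max m N"]) auto
qed

text \<open>Staying within \<open>D\<close> allows a change of relative position of at most
  \<open>2 * D\<close>, whereas two opposite drifts of \<open>D + 1\<close> change it by at least
  \<open>2 * D + 2\<close>.\<close>

lemma not_close_forward:
  assumes rot: "opposite_rotation \<sigma>" and pq: "p \<in> Th0" "q \<in> Th1"
    and D: "\<And>n. \<bar>fst ((F ^^ n) p) - fst ((F ^^ n) q)\<bar> \<le> D"
  shows False
proof -
  obtain n where n: "n \<ge> (0::nat)" "\<And>w. w \<in> Th0 \<Longrightarrow> \<sigma> * (fst ((F ^^ n) w) - fst w) \<ge> D + 1"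
    "\<And>w. w \<in> Th1 \<Longrightarrow> \<sigma> * (fst ((F ^^ n) w) - fst w) \<le> - (D + 1)"
    using opposite_rotationD[OF rot] by metis
  have "\<sigma> = 1 \<or> \<sigma> = -1" using rot unfolding opposite_rotation_def by simp
  then show False using n(2)[OF pq(1)] n(3)[OF pq(2)] D[of 0] D[of n] by (auto simp: abs_le_iff)
qed

lemma not_close_backward:
  assumes rot: "opposite_rotation \<sigma>" and pq: "p \<in> Th0" "q \<in> Th1"
    and D: "\<And>n. \<bar>fst ((G ^^ n) p) - fst ((G ^^ n) q)\<bar> \<le> D"
  shows False
proof -
  obtain n where n: "n \<ge> (0::nat)" "\<And>w. w \<in> Th0 \<Longrightarrow> \<sigma> * (fst ((F ^^ n) w) - fst w) \<ge> D + 1"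
    "\<And>w. w \<in> Th1 \<Longrightarrow> \<sigma> * (fst ((F ^^ n) w) - fst w) \<le> - (D + 1)"
    using opposite_rotationD[OF rot] by metis
  have "\<sigma> = 1 \<or> \<sigma> = -1" using rot unfolding opposite_rotation_def by simp
  then show False
    using n(2)[OF inv_set_pow(2)[OF pq(1), of n]] n(3)[OF inv_set_pow(2)[OF pq(2), of n]] D[of 0] D[of n]
    by (auto simp: abs_le_iff)
qed

end

locale three_up = three_curves +
  assumes up0: "w \<notin> L0 \<Longrightarrow> F w \<in> U0" and up1: "w \<notin> L1 \<Longrightarrow> F w \<in> U1" and up2: "w \<notin> L2 \<Longrightarrow> F w \<in> U2"
begin

sublocale d: drift F G M L0 U0 L2 U2
  by unfold_locales (use halves0 halves2 nest02 up0 up2 in auto)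

sublocale m: drift "\<lambda>w. reflect (G (reflect w))" "\<lambda>w. reflect (F (reflect w))" M "reflect -` U2" "reflect -` L2" "reflect -` U0" "reflect -` L0"
  by (rule d.mirror)

lemma m_LL: "m.LL = reflect -` d.RR" and m_RR: "m.RR = reflect -` d.LL"
  unfolding m.LL_def m.RR_def d.LL_def d.RR_def
  by (simp_all add: vimage_def reflect_conj_funpow set_eq_iff del: split_paired_All)

lemma down1: "w \<notin> U1 \<Longrightarrow> G w \<in> L1" using up1[of "G w"] by auto

lemma U1_forward: "w \<in> U1 \<Longrightarrow> (F ^^ n) w \<in> U1"
proof (induction n)
  case (Suc n)
  then show ?case using up1[of "(F ^^ n) w"] halvesD(5)[OF halves1] by auto
qed simp

lemma Th0_disj_LL: "w \<in> Th0 \<Longrightarrow> w \<notin> d.LL"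
  unfolding inv_set_def d.LL_def by blast

lemma Th1_disj_RR: "w \<in> Th1 \<Longrightarrow> w \<notin> d.RR"
  unfolding inv_set_def d.RR_def by blast

text \<open>If no orbit connects the two invariant sets, a component of \<open>- LL\<close> through a point of \<open>Th0\<close> cannot
  meet a component of \<open>- RR\<close> through a point of \<open>Th1\<close>, and this pins the sign of the twist.\<close>
lemma no_crossing_without_connection:
  assumes iso: "lift_isotopy \<Phi>" "\<Phi> 1 = F" and rot: "opposite_rotation \<sigma>"
    and pq: "p \<in> Th0" "q0 \<in> Th1" and LR: "d.LL \<inter> d.RR \<noteq> {}" and sub: "- d.LL \<inter> - d.RR \<subseteq> Th0 \<union> Th1"
  shows False
proof -
  have \<sigma>: "\<sigma> \<in> {1,-1}" using rot unfolding opposite_rotation_def by simp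
  define S where "S = (\<lambda>p. connected_component_set (- d.LL \<inter> - U2) p)"
  \<comment> \<open>Components of the set of points that are neither in \<open>RR\<close> nor in
    \<open>L0\<close>, written in reflected coordinates so that the results on \<open>LL\<close> can
    be quoted for the mirrored system.\<close>
  define T where "T = (\<lambda>q. connected_component_set (- m.LL \<inter> - (reflect -` L0)) (reflect q))"
  have mLR: "m.LL \<inter> m.RR \<noteq> {}"
  proof -
    obtain z where "z \<in> d.LL" "z \<in> d.RR" using LR by blast
    then have "reflect z \<in> m.LL \<inter> m.RR" unfolding m_LL m_RR by simp
    then show ?thesis by blast
  qed
  obtain D1 where D1: "\<And>S s s'. connected S \<Longrightarrow> S \<subseteq> - d.LL \<inter> - U2 \<Longrightarrow> s \<in> S \<Longrightarrow> s' \<in> S \<Longrightarrow> \<bar>fst s - fst s'\<bar> \<le> D1"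
    using d.components_bounded[OF LR] by metis
  obtain D2 where D2: "\<And>S s s'. connected S \<Longrightarrow> S \<subseteq> - m.LL \<inter> - (reflect -` L0) \<Longrightarrow> s \<in> S \<Longrightarrow> s' \<in> S \<Longrightarrow> \<bar>fst s - fst s'\<bar> \<le> D2"
    using m.components_bounded[OF mLR] by metis
  have Sin: "connected (S p)" "S p \<subseteq> - d.LL \<inter> - U2" for p
    unfolding S_def by (auto dest: connected_component_in)
  have Tin: "connected (T q)" "T q \<subseteq> - m.LL \<inter> - (reflect -` L0)" for q
    unfolding T_def by (auto dest: connected_component_in)
  have p0: "p \<in> - d.LL \<inter> - U2" if "p \<in> Th0" for p
  proof -
    have "(F ^^ 0) p \<in> - L0 \<inter> - U1" using that unfolding inv_set_def by blast
    then show ?thesis using Th0_disj_LL[OF that] U21 by auto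
  qed
  have q1: "reflect q \<in> - m.LL \<inter> - (reflect -` L0)" if "q \<in> Th1" for q
  proof -
    have "(F ^^ 0) q \<in> - L1 \<inter> - U2" using that unfolding inv_set_def by blast
    then show ?thesis using Th1_disj_RR[OF that] L01 by (auto simp: m_LL)
  qed
  \<comment> \<open>Otherwise the two points would share a component, of width at most
    \<open>D1\<close>, at all past times. The next fact is the same argument in the future.\<close>
  have S_Th1: "q \<notin> S p" if "p \<in> Th0" "q \<in> Th1" for p q
  proof
    assume "q \<in> S p"
    then have "(G ^^ n) q \<in> S ((G ^^ n) p)" for n unfolding S_def by (rule d.component_G_pow)
    moreover have "(G ^^ n) p \<in> S ((G ^^ n) p)" for n
      unfolding S_def using p0[OF inv_set_pow(2)[OF that(1)]] by simp
    ultimately have "\<bar>fst ((G ^^ n) p) - fst ((G ^^ n) q)\<bar> \<le> D1" for n using D1[OF Sin] by blast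
    then show False by (rule not_close_backward[OF rot that])
  qed
  have T_Th0: "reflect p \<notin> T q" if "p \<in> Th0" "q \<in> Th1" for p q
  proof
    assume "reflect p \<in> T q"
    then have "reflect ((F ^^ n) p) \<in> T ((F ^^ n) q)" for n
      using m.component_G_pow[of "reflect p" "reflect q" n] unfolding T_def by (simp add: reflect_conj_funpow)
    moreover have "reflect ((F ^^ n) q) \<in> T ((F ^^ n) q)" for n
      unfolding T_def using q1[OF inv_set_pow(1)[OF that(2)]] by simp
    ultimately have "\<bar>fst (reflect ((F ^^ n) p)) - fst (reflect ((F ^^ n) q))\<bar> \<le> D2" for n using D2[OF Tin] by blast
    then have "\<bar>fst ((F ^^ n) p) - fst ((F ^^ n) q)\<bar> \<le> D2" for n by simp
    then show False by (rule not_close_forward[OF rot that])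
  qed
  obtain Da where Da: "Da \<ge> 0" "\<And>p W. p \<in> - d.LL \<inter> - U2 \<Longrightarrow> open W \<Longrightarrow> S p \<subseteq> W \<Longrightarrow> ray 1 (W \<inter> U0 \<union> F -` U2) Da p"
    using d.component_ray[OF LR] unfolding S_def by metis
  obtain Db where Db: "Db \<ge> 0" "\<And>q W. reflect q \<in> - m.LL \<inter> - (reflect -` L0) \<Longrightarrow> open W \<Longrightarrow> T q \<subseteq> W \<Longrightarrow>
      ray 1 (W \<inter> reflect -` L2 \<union> (\<lambda>w. reflect (G (reflect w))) -` (reflect -` L0)) Db (reflect q)"
    using m.component_ray[OF mLR] unfolding T_def by metis
  obtain Dc where Dc: "Dc \<ge> 0" "\<And>q. q \<in> Th1 \<Longrightarrow> ray 1 U1 Dc q"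
  proof -
    \<comment> \<open>This set contains \<open>Th1\<close> and is visibly closed and periodic. It
      lies in \<open>U1\<close> because its points are images of points outside
      \<open>L1\<close>.\<close>
    define K where "K = G -` (- L1) \<inter> (- L1 \<inter> - U2)"
    obtain Dc where Dc: "Dc \<ge> 0" "\<And>q. q \<in> K \<Longrightarrow> ray 1 U1 Dc q"
    proof (rule uniform_rays[of 1 U1 M K])
      show "{w. M < 1 * snd w} \<subseteq> U1" using halvesD(11)[OF halves1] by auto
      show "closed K" unfolding K_def using open_vimage_pow(2)[of L1 1] halvesD(1)[OF halves1] halvesD(2)[OF halves2]
        by (auto simp: vimage_Compl)
      show "hperiodic K" unfolding K_def using hperiodic_vimage_pow(2)[of "- L1" 1] halvesD(8)[OF halves1] halvesD(9)[OF halves2]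
        by (auto intro!: hperiodic_Int hperiodic_Compl)
      show "K \<subseteq> U1"
      proof
        fix w assume "w \<in> K"
        then show "w \<in> U1" using up1[of "G w"] by (simp add: K_def)
      qed
      show "K \<subseteq> {w. \<bar>snd w\<bar> \<le> M}"
      proof
        fix w assume "w \<in> K"
        then show "w \<in> {w. \<bar>snd w\<bar> \<le> M}"
          using halvesD(12)[OF halves1, of w] halvesD(13)[OF halves2, of w] by (simp add: K_def abs_le_iff)
      qed
    qed (use halvesD[OF halves1] in auto)
    have "w \<in> K" if "w \<in> Th1" for w
    proof -
      have "(F ^^ 0) w \<in> - L1 \<inter> - U2" "(G ^^ 1) w \<in> - L1 \<inter> - U2" using that unfolding inv_set_def by blast+
      then show ?thesis by (simp add: K_def)
    qed
    then show thesis using that Dc by blast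
  qed
  obtain Dd where Dd: "Dd \<ge> 0" "\<And>p. p \<in> Th0 \<Longrightarrow> ray (-1) L1 Dd p"
  proof -
    define K where "K = F -` (- U1) \<inter> (- L0 \<inter> - U1)"
    obtain Dc where Dc: "Dc \<ge> 0" "\<And>q. q \<in> K \<Longrightarrow> ray (-1) L1 Dc q"
    proof (rule uniform_rays[of "-1" L1 M K])
      show "{w. M < -1 * snd w} \<subseteq> L1" using halvesD(10)[OF halves1] by auto
      show "closed K" unfolding K_def using open_vimage_pow(1)[of U1 1] halvesD(1)[OF halves0] halvesD(2)[OF halves1]
        by (auto simp: vimage_Compl)
      show "hperiodic K" unfolding K_def using hperiodic_vimage_pow(1)[of "- U1" 1] halvesD(8)[OF halves0] halvesD(9)[OF halves1]
        by (auto intro!: hperiodic_Int hperiodic_Compl)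
      show "K \<subseteq> L1"
      proof
        fix w assume "w \<in> K"
        then show "w \<in> L1" using up1[of w] by (auto simp add: K_def)
      qed
      show "K \<subseteq> {w. \<bar>snd w\<bar> \<le> M}"
      proof
        fix w assume "w \<in> K"
        then show "w \<in> {w. \<bar>snd w\<bar> \<le> M}"
          using halvesD(12)[OF halves0, of w] halvesD(13)[OF halves1, of w] by (simp add: K_def abs_le_iff)
      qed
    qed (use halvesD[OF halves1] in auto)
    have "w \<in> K" if "w \<in> Th0" for w
    proof -
      have "(F ^^ 0) w \<in> - L0 \<inter> - U1" "(F ^^ 1) w \<in> - L0 \<inter> - U1" using that unfolding inv_set_def by blast+
      then show ?thesis by (simp add: K_def)
    qed
    then show thesis using that Dc by blast
  qed
  define D where "D = Da + Db + Dc + Dd"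
  have D: "0 \<le> D" "Da \<le> D" "Db \<le> D" "Dc \<le> D" "Dd \<le> D" using Da(1) Db(1) Dc(1) Dd(1) by (auto simp: D_def)
  \<comment> \<open>The translate of \<open>q0\<close> leaves a gap between \<open>D + 1\<close> and
    \<open>D + 2\<close>: wide enough for rays of width \<open>D\<close>, and bounded, so that a
    drift of \<open>2 * D + 4\<close> of each point reverses the order with a gap beyond
    \<open>D\<close>.\<close>
  obtain j :: int where j: "0 \<le> (\<sigma> * (fst q0 - fst p) - (D + 1)) + of_int j" "(\<sigma> * (fst q0 - fst p) - (D + 1)) + of_int j \<le> 1"
    using unit_translate by blast
  define q where "q = q0 + (of_int (if \<sigma> = 1 then j else - j), 0)"
  have hTh1: "hperiodic Th1" by (intro hperiodic_inv_set hperiodic_Int hperiodic_Compl halvesD(8)[OF halves1] halvesD(9)[OF halves2])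
  have q: "q \<in> Th1" unfolding q_def by (rule hperiodicD[OF hTh1 pq(2)])
  have "\<sigma> * (fst q - fst p) = \<sigma> * (fst q0 - fst p) + of_int j"
    using \<sigma> by (auto simp: q_def)
  then have start: "D + 1 \<le> \<sigma> * (fst q - fst p)" "\<sigma> * (fst q - fst p) \<le> D + 2" using j by auto
  obtain N where N: "N \<ge> 2" "\<And>w. w \<in> Th0 \<Longrightarrow> \<sigma> * (fst ((F ^^ N) w) - fst w) \<ge> 2 * D + 4"
    "\<And>w. w \<in> Th1 \<Longrightarrow> \<sigma> * (fst ((F ^^ N) w) - fst w) \<le> - (2 * D + 4)"
    using opposite_rotationD[OF rot] by metis
  have fin: "\<sigma> * (fst ((F ^^ N) q) - fst ((F ^^ N) p)) < - D"
    using N(2)[OF pq(1)] N(3)[OF q] start D(1) \<sigma> by auto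
  define p' where "p' = (F ^^ N) p"
  define q' where "q' = (F ^^ N) q"
  have p': "p' \<in> Th0" and q': "q' \<in> Th1" using inv_set_pow pq(1) q by (auto simp: p'_def q'_def)
  \<comment> \<open>A common point would avoid both \<open>LL\<close> and \<open>RR\<close>, so by
    \<open>sub\<close> it would belong to \<open>Th0\<close> or \<open>Th1\<close>; the two cases
    contradict \<open>T_Th0\<close> and \<open>S_Th1\<close>.\<close>
  have S_T: "reflect ((F ^^ N) z) \<notin> T q'" if "z \<in> S p" for z
  proof
    assume *: "reflect ((F ^^ N) z) \<in> T q'"
    then have "reflect ((F ^^ N) z) \<in> - m.LL" using Tin(2) by blast
    then have "(F ^^ N) z \<notin> d.RR" by (simp add: m_LL)
    then have "z \<notin> d.RR"
    proof (rule contrapos_nn)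
      assume "z \<in> d.RR"
      then have "reflect z \<in> m.LL" by (simp add: m_LL)
      then have "((\<lambda>w. reflect (F (reflect w))) ^^ N) (reflect z) \<in> m.LL" by (simp add: m.G_pow_LL)
      then show "(F ^^ N) z \<in> d.RR" by (simp add: m_LL reflect_conj_funpow)
    qed
    moreover have "z \<notin> d.LL" using Sin(2) that by blast
    ultimately consider "z \<in> Th0" | "z \<in> Th1" using sub by blast
    then show False
    proof cases
      case 1
      then show False using T_Th0[OF inv_set_pow(1)[OF 1] q'] * by blast
    next
      case 2 then show False using S_Th1[OF pq(1)] that by blast
    qed
  qed
  define T' where "T' = (\<lambda>z. (G ^^ N) (reflect z)) ` T q'"
  have "compact (S p)" unfolding S_def using d.component_compact[OF LR p0[OF pq(1)]] .
  moreover have "compact T'"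
    unfolding T'_def
  proof (rule compact_continuous_image)
    show "continuous_on (T q') (\<lambda>z. (G ^^ N) (reflect z))"
      by (rule continuous_on_compose2[OF cont_pow(2)[of UNIV]]) (auto intro: continuous_intros)
    show "compact (T q')" unfolding T_def by (rule m.component_compact[OF mLR q1[OF q']])
  qed
  moreover have "S p \<inter> T' = {}"
  proof -
    have False if z: "z \<in> S p" "z \<in> T'" for z
    proof -
      obtain t where "t \<in> T q'" "z = (G ^^ N) (reflect t)" using z(2) unfolding T'_def by blast
      then have "reflect ((F ^^ N) z) \<in> T q'" by simp
      then show False using S_T[OF z(1)] by blast
    qed
    then show ?thesis by blast
  qed
  \<comment> \<open>The rays follow the components only approximately, so disjoint compact
    components are first fattened to disjoint open sets.\<close>
  ultimately obtain W W' where W: "open W" "open W'" "S p \<subseteq> W" "T' \<subseteq> W'" "W \<inter> W' = {}"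
    using separation_normal[of "S p" T'] compact_imp_closed by metis
  define V where "V = reflect -` ((G ^^ N) -` W')"
  have oV: "open V" unfolding V_def by (intro open_reflect_vimage open_vimage_pow W)
  have TV: "T q' \<subseteq> V" using W(4) by (auto simp: T'_def V_def)
  define A where "A = W \<inter> U0 \<union> F -` U2"
  define B where "B = (G ^^ N) -` W' \<inter> L2 \<union> G -` L0"
  have rayA: "ray 1 A D p"
    using Da(2)[OF p0[OF pq(1)] W(1,3)] D(2) ray_mono unfolding A_def by blast
  have "ray 1 (V \<inter> reflect -` L2 \<union> (\<lambda>w. reflect (G (reflect w))) -` (reflect -` L0)) Db (reflect q')"
    by (rule Db(2)[OF q1[OF q'] oV TV])
  from ray_mirror[OF this] have "ray (-1) (reflect -` (V \<inter> reflect -` L2 \<union> (\<lambda>w. reflect (G (reflect w))) -` (reflect -` L0))) Db q'" by simp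
  moreover have "reflect -` (V \<inter> reflect -` L2 \<union> (\<lambda>w. reflect (G (reflect w))) -` (reflect -` L0)) = B"
    unfolding B_def V_def by (simp add: set_eq_iff vimage_def del: split_paired_All)
  ultimately have rayB: "ray (-1) B D q'" using D(3) ray_mono by blast
  \<comment> \<open>Along the components \<open>W\<close> and \<open>W'\<close> do the separation.
    Elsewhere forward invariance of \<open>U0\<close> and \<open>U2\<close> is used at time
    \<open>N - 1\<close> and at time \<open>N\<close>; from \<open>F w \<in> U2\<close> the former
    needs \<open>N \<ge> 2\<close>.\<close>
  have AB: "(F ^^ N) w \<notin> B" if w: "w \<in> A" for w
  proof
    assume F: "(F ^^ N) w \<in> B"
    obtain k where k: "N = Suc (Suc k)" using N(1) by (metis Suc_le_D numeral_2_eq_2 old.nat.exhaust Suc_le_mono)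
    have e1: "(F ^^ N) w = (F ^^ Suc k) (F w)" unfolding k by (simp add: funpow_swap1)
    have e2: "G ((F ^^ N) w) = (F ^^ Suc k) w" unfolding k by simp
    have e3: "G ((F ^^ N) w) = (F ^^ k) (F w)" unfolding e2 by (simp add: funpow_swap1)
    consider "w \<in> W" "w \<in> U0" | "F w \<in> U2" using w unfolding A_def by blast
    then show False
    proof cases
      case 1
      have "G ((F ^^ N) w) \<in> U0" unfolding e2 by (rule d.U0_forward[OF 1(2)])
      then have "(F ^^ N) w \<notin> G -` L0" using d.disj0 by blast
      moreover have "(F ^^ N) w \<notin> (G ^^ N) -` W'" using 1(1) W(5) by auto
      ultimately show False using F unfolding B_def by blast
    next
      case 2
      have "G ((F ^^ N) w) \<in> U2" unfolding e3 by (rule d.U2_forward[OF 2])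
      then have "(F ^^ N) w \<notin> G -` L0" using d.disj0 d.U2_U0 by blast
      moreover have "(F ^^ N) w \<notin> L2" unfolding e1 using d.U2_forward[OF 2, of "Suc k"] d.disj2 by blast
      ultimately show False using F unfolding B_def by blast
    qed
  qed
  define \<Psi> where "\<Psi> = (\<lambda>t. \<Phi> t ^^ N)"
  have isoN: "lift_isotopy \<Psi>" unfolding \<Psi>_def by (rule lift_isotopy_funpow[OF iso(1)])
  have \<Psi>1: "\<Psi> 1 = F ^^ N" by (simp add: \<Psi>_def iso(2))
  have ne: "q \<noteq> p" using start D(1) by auto
  obtain \<Lambda> where \<Lambda>: "continuous_on {0..1} \<Lambda>" "\<And>t. t \<in> {0..1} \<Longrightarrow> cpl (\<Psi> t q - \<Psi> t p) = exp (\<Lambda> t)"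
  proof (rule continuous_logarithm_on_contractible[of "{0..1::real}" "\<lambda>t. cpl (\<Psi> t q - \<Psi> t p)"])
    show "continuous_on {0..1} (\<lambda>t. cpl (\<Psi> t q - \<Psi> t p))"
      by (intro continuous_intros continuous_on_isotopy_compose[OF lift_isotopyD(1)[OF isoN]]) auto
    show "cpl (\<Psi> t q - \<Psi> t p) \<noteq> 0" if "t \<in> {0..1}" for t
      using lift_isotopyD(3)[OF isoN that] ne by (auto dest: bij_is_inj injD)
  qed (auto intro: convex_imp_contractible)
  have "\<sigma> * (Im (\<Lambda> 1) - Im (\<Lambda> 0)) < 0"
  proof (rule twist_sign[OF isoN \<sigma> rayA, of B q])
    show "ray (-1) B D (\<Psi> 1 q)" using rayB by (simp add: \<Psi>1 q'_def)
    show "\<sigma> * (fst q - fst p) > D" using start by simp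
    show "\<sigma> * (fst (\<Psi> 1 q) - fst (\<Psi> 1 p)) < - D" using fin by (simp add: \<Psi>1)
  qed (use AB \<Lambda> \<Psi>1 in auto)
  \<comment> \<open>Exchanging the two points adds \<open>\<i> * pi\<close> to the logarithm and
    leaves its variation unchanged, but now the side is \<open>- \<sigma>\<close>. The rays are
    separated by the middle curve, since \<open>U1\<close> is mapped into itself.\<close>
  moreover have "- \<sigma> * (Im (\<Lambda> 1 + \<i> * pi) - Im (\<Lambda> 0 + \<i> * pi)) < 0"
  proof (rule twist_sign[OF isoN, of "- \<sigma>" U1 D q L1 p])
    show "- \<sigma> \<in> {1,-1}" using \<sigma> by auto
    show "ray 1 U1 D q" using Dc(2)[OF q] D(4) ray_mono by blast
    show "ray (-1) L1 D (\<Psi> 1 p)" using Dd(2)[OF p'] D(5) ray_mono unfolding \<Psi>1 p'_def by blast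
    show "\<Psi> 1 w \<notin> L1" if "w \<in> U1" for w using U1_forward[OF that, of N] halvesD(5)[OF halves1] by (auto simp: \<Psi>1)
    show "- \<sigma> * (fst p - fst q) > D" using start by (simp add: algebra_simps)
    show "- \<sigma> * (fst (\<Psi> 1 p) - fst (\<Psi> 1 q)) < - D" using fin by (simp add: \<Psi>1 algebra_simps)
    show "continuous_on {0..1} (\<lambda>t. \<Lambda> t + \<i> * pi)" using \<Lambda>(1) by (intro continuous_intros)
    show "exp (\<Lambda> t + \<i> * pi) = cpl (\<Psi> t p - \<Psi> t q)" if "t \<in> {0..1}" for t
      using \<Lambda>(2)[OF that] by (simp add: exp_add exp_pi_i' complex_eq_iff mult.commute flip: \<Lambda>(2)[OF that])
  qed
  ultimately show False by simp
qed

end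

section \<open>Balanced orbit segments\<close>

lemma inv_set_reflect:
  "inv_set (\<lambda>w. reflect (F (reflect w))) (\<lambda>w. reflect (G (reflect w))) (reflect -` E) = reflect -` inv_set F G E"
  unfolding inv_set_def by (simp add: reflect_conj_funpow vimage_def del: split_paired_All)

lemma lift_isotopy_reflect:
  assumes "lift_isotopy \<Phi>" shows "lift_isotopy (\<lambda>t w. reflect (\<Phi> t (reflect w)))"
  unfolding lift_isotopy_def
proof (intro conjI ballI allI)
  note A = lift_isotopyD[OF assms]
  have "continuous_on ({0..1} \<times> UNIV) (\<lambda>z. reflect (\<Phi> (fst z) (reflect (snd z))))"
    by (intro continuous_intros continuous_on_isotopy_compose[OF A(1)]) auto
  then show "continuous_on ({0..1} \<times> UNIV) (\<lambda>(t, w). reflect (\<Phi> t (reflect w)))" by (simp add: case_prod_unfold)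
  show "reflect (\<Phi> 0 (reflect w)) = w" for w using A(2) by simp
  have eq: "(\<lambda>w. reflect (\<Phi> t (reflect w))) = reflect \<circ> \<Phi> t \<circ> reflect" for t by auto
  show "bij (\<lambda>w. reflect (\<Phi> t (reflect w)))" if "t \<in> {0..1}" for t
    unfolding eq using A(3)[OF that] bij_reflect bij_comp by blast
  have "inv (\<lambda>w. reflect (\<Phi> 1 (reflect w))) = (\<lambda>w. reflect (inv (\<Phi> 1) (reflect w)))"
    using A(3)[of 1] by (intro inv_equality) (auto simp: bij_is_surj surj_f_inv_f bij_is_inj)
  moreover have "continuous_on UNIV (\<lambda>w. reflect (inv (\<Phi> 1) (reflect w)))"
    by (intro continuous_intros continuous_on_compose2[OF A(4)]) auto
  ultimately show "continuous_on UNIV (inv (\<lambda>w. reflect (\<Phi> 1 (reflect w))))" by simp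
  show "reflect (\<Phi> t (reflect (w + (of_int k, 0)))) = reflect (\<Phi> t (reflect w)) + (of_int k, 0)" if "t \<in> {0..1}" for t w and k::int
    using A(5)[OF that] by simp
  show "\<exists>M'. \<forall>t\<in>{0..1}. \<forall>w. M' < snd w \<longrightarrow> M < snd (reflect (\<Phi> t (reflect w)))" for M
  proof -
    obtain M' where M': "\<forall>t\<in>{0..1}. \<forall>w. snd w < M' \<longrightarrow> snd (\<Phi> t w) < - M" using A(7) by blast
    have "M < snd (reflect (\<Phi> t (reflect w)))" if "t \<in> {0..1}" "- M' < snd w" for t w
    proof -
      have "snd (reflect w) < M'" using that(2) by simp
      then have "snd (\<Phi> t (reflect w)) < - M" using M' that(1) by blast
      then show ?thesis by simp
    qed
    then show ?thesis by blast
  qed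
  show "\<exists>M'. \<forall>t\<in>{0..1}. \<forall>w. snd w < M' \<longrightarrow> snd (reflect (\<Phi> t (reflect w))) < M" for M
  proof -
    obtain M' where M': "\<forall>t\<in>{0..1}. \<forall>w. M' < snd w \<longrightarrow> - M < snd (\<Phi> t w)" using A(6) by blast
    have "snd (reflect (\<Phi> t (reflect w))) < M" if "t \<in> {0..1}" "snd w < - M'" for t w
    proof -
      have "M' < snd (reflect w)" using that(2) by simp
      then have "- M < snd (\<Phi> t (reflect w))" using M' that(1) by blast
      then show ?thesis by simp
    qed
    then show ?thesis by blast
  qed
qed

context plane_homeo
begin

lemma displacement_bound:
  assumes "closed K" "hperiodic K" "K \<subseteq> {w. \<bar>snd w\<bar> \<le> M}"
  obtains C where "C \<ge> 0" "\<And>v. v \<in> K \<Longrightarrow> \<bar>fst (F v) - fst v\<bar> \<le> C"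
proof -
  define K0 where "K0 = K \<inter> {w. 0 \<le> fst w \<and> fst w \<le> 1}"
  have "compact K0" unfolding K0_def using assms by (intro compact_strip)
  then have "compact ((\<lambda>v. fst (F v) - fst v) ` K0)"
    by (intro compact_continuous_image continuous_intros continuous_on_subset[OF contF]) auto
  then have "bounded ((\<lambda>v. fst (F v) - fst v) ` K0)" by (rule compact_imp_bounded)
  then obtain C where C: "\<And>v. v \<in> K0 \<Longrightarrow> \<bar>fst (F v) - fst v\<bar> \<le> C" unfolding bounded_iff
    by force
  have "\<bar>fst (F v) - fst v\<bar> \<le> \<bar>C\<bar>" if v: "v \<in> K" for v
  proof -
    obtain k :: int where k: "0 \<le> fst v + of_int k" "fst v + of_int k \<le> 1" using unit_translate by blast
    have "v + (of_int k, 0) \<in> K0" using k hperiodicD[OF assms(2) v] by (simp add: K0_def)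
    from C[OF this] show ?thesis by (simp add: perF)
  qed
  then show thesis by (intro that[of "\<bar>C\<bar>"]) auto
qed

lemma orbit_drifts:
  assumes K: "closed K" "hperiodic K" "K \<subseteq> {w. \<bar>snd w\<bar> \<le> M}"
    and w: "\<And>n. (F ^^ n) w \<in> K"
    and m: "\<And>v. v \<in> inv_set F G K \<Longrightarrow> \<sigma> * (fst ((F ^^ m) v) - fst v) \<le> -1"
  shows "\<exists>n. \<sigma> * fst ((F ^^ n) w) \<le> - B"
proof -
  define V where "V = {v. \<sigma> * (fst ((F ^^ m) v) - fst v) < - 1 / 2}"
  have oV: "open V" unfolding V_def
    by (intro open_Collect_less continuous_intros cont_pow)
  have hV: "v + (of_int k, 0) \<in> V \<longleftrightarrow> v \<in> V" for v and k :: int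
    by (simp add: V_def perF_pow)
  have "\<exists>n1. \<forall>n\<ge>n1. (F ^^ n) w \<in> V"
  proof (rule ccontr)
    assume "\<not> ?thesis"
    then obtain r where r: "\<And>i. r i \<ge> (i::nat)" "\<And>i. (F ^^ r i) w \<notin> V" by metis
    have "\<exists>k::int. 0 \<le> fst ((F ^^ r i) w) + of_int k \<and> fst ((F ^^ r i) w) + of_int k \<le> 1" for i
      by (rule unit_translate[of "fst ((F ^^ r i) w)"]) blast
    then obtain k :: "nat \<Rightarrow> int" where k: "\<And>i. 0 \<le> fst ((F ^^ r i) w) + of_int (k i)" "\<And>i. fst ((F ^^ r i) w) + of_int (k i) \<le> 1"
      by metis
    define x where "x = (\<lambda>i. (F ^^ r i) w + (of_int (k i), 0::real))"
    define K0 where "K0 = (K \<inter> - V) \<inter> {w. 0 \<le> fst w \<and> fst w \<le> 1}"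
    have "compact K0" unfolding K0_def using K oV by (intro compact_strip) auto
    moreover have xK: "x i \<in> K0" for i
      using k[of i] hperiodicD[OF K(2) w[of "r i"], of "k i"] r(2)[of i] hV by (simp add: K0_def x_def)
    ultimately obtain u s where u: "u \<in> K0" "strict_mono s" "(x \<circ> s) \<longlonglongrightarrow> u"
      unfolding compact_def by metis
    have "(F ^^ j) u \<in> K" for j
    proof (rule closed_sequentially[OF K(1)])
      have "isCont (F ^^ j) u" using cont_pow(1)[of UNIV j] continuous_on_eq_continuous_at[OF open_UNIV] by blast
      then show "(\<lambda>i. (F ^^ j) ((x \<circ> s) i)) \<longlonglongrightarrow> (F ^^ j) u" using u(3) by (rule isCont_tendsto_compose)
      show "(F ^^ j) ((x \<circ> s) i) \<in> K" for i
      proof -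
        have "(F ^^ j) ((x \<circ> s) i) = (F ^^ (j + r (s i))) w + (of_int (k (s i)), 0)"
          by (simp add: x_def perF_pow funpow_add)
        then show ?thesis using hperiodicD[OF K(2) w] by simp
      qed
    qed
    moreover have "(G ^^ j) u \<in> K" for j
    proof (rule Lim_in_closed_set[OF K(1)])
      have "isCont (G ^^ j) u" using cont_pow(2)[of UNIV j] continuous_on_eq_continuous_at[OF open_UNIV] by blast
      then show "(\<lambda>i. (G ^^ j) ((x \<circ> s) i)) \<longlonglongrightarrow> (G ^^ j) u" using u(3) by (rule isCont_tendsto_compose)
      \<comment> \<open>Going back \<open>j\<close> steps stays on the forward orbit only once the
        index is at least \<open>j\<close>, so here the membership is merely eventual.\<close>
      have "(G ^^ j) ((x \<circ> s) i) \<in> K" if "i \<ge> j" for i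
      proof -
        have "j \<le> r (s i)" using that r(1)[of "s i"] seq_suble[OF u(2), of i] by linarith
        then obtain d where d: "r (s i) = j + d" using le_Suc_ex by blast
        have "(G ^^ j) ((x \<circ> s) i) = (F ^^ d) w + (of_int (k (s i)), 0)"
          by (simp add: x_def perG_pow d funpow_add)
        then show ?thesis using hperiodicD[OF K(2) w] by simp
      qed
      then show "\<forall>\<^sub>F i in sequentially. (G ^^ j) ((x \<circ> s) i) \<in> K" using eventually_sequentially by blast
    qed simp
    ultimately have "u \<in> inv_set F G K" by (simp add: inv_set_def)
    then have "u \<in> V" using m[of u] by (simp add: V_def)
    then show False using u(1) by (simp add: K0_def)
  qed
  then obtain n1 where n1: "\<And>n. n \<ge> n1 \<Longrightarrow> (F ^^ n) w \<in> V" by blast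
  have step: "\<sigma> * fst ((F ^^ (n1 + j * m)) w) \<le> \<sigma> * fst ((F ^^ n1) w) - real j / 2" for j
  proof (induction j)
    case (Suc j)
    have "(F ^^ (n1 + j * m)) w \<in> V" using n1 by simp
    moreover have "(F ^^ m) ((F ^^ (n1 + j * m)) w) = (F ^^ (n1 + Suc j * m)) w"
      by (simp add: add.left_commute flip: comp_apply[of "F ^^ m" "F ^^ (n1 + j * m)" w] funpow_add)
    ultimately show ?case using Suc by (simp add: V_def right_diff_distrib add_divide_distrib)
  qed simp
  obtain j :: nat where j: "real j \<ge> 2 * (B + \<sigma> * fst ((F ^^ n1) w))" using real_arch_simple by blast
  define c where "c = \<sigma> * fst ((F ^^ n1) w)"
  have "\<sigma> * fst ((F ^^ (n1 + j * m)) w) \<le> - B"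
    using j step[of j] unfolding c_def[symmetric] by argo
  then show ?thesis by blast
qed

end

context three_curves
begin

lemma mirror: "three_curves (\<lambda>w. reflect (F (reflect w))) (\<lambda>w. reflect (G (reflect w))) M (reflect -` U2) (reflect -` L2) (reflect -` U1) (reflect -` L1) (reflect -` U0) (reflect -` L0)"
proof -
  interpret m: plane_homeo "\<lambda>w. reflect (F (reflect w))" "\<lambda>w. reflect (G (reflect w))" by (rule plane_homeo_mirror)
  have "- L2 \<subseteq> U1" "- L1 \<subseteq> U0" using nest12 nest01 by blast+
  then show ?thesis
    by unfold_locales (use halves0 halves1 halves2 in \<open>auto simp: halves_reflect\<close>)
qed

lemma closed_band: "closed (- L0 \<inter> - U2)" "closed (- L0 \<inter> - U1)" "closed (- L1 \<inter> - U2)"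
  using halvesD(1,2)[OF halves0] halvesD(1,2)[OF halves1] halvesD(1,2)[OF halves2] by auto

lemma hperiodic_band: "hperiodic (- L0 \<inter> - U2)" "hperiodic (- L0 \<inter> - U1)" "hperiodic (- L1 \<inter> - U2)"
  using halvesD(8,9)[OF halves0] halvesD(8,9)[OF halves1] halvesD(8,9)[OF halves2]
  by (simp_all add: hperiodic_Int hperiodic_Compl)

lemma band_bounded: "- L0 \<inter> - U2 \<subseteq> {w. \<bar>snd w\<bar> \<le> M}" "- L0 \<inter> - U1 \<subseteq> {w. \<bar>snd w\<bar> \<le> M}"
  "- L1 \<inter> - U2 \<subseteq> {w. \<bar>snd w\<bar> \<le> M}"
proof -
  show *: "- L0 \<inter> - U2 \<subseteq> {w. \<bar>snd w\<bar> \<le> M}"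
  proof
    fix w assume w: "w \<in> - L0 \<inter> - U2"
    show "w \<in> {w. \<bar>snd w\<bar> \<le> M}"
      using w halvesD(12)[OF halves0, of w] halvesD(13)[OF halves2, of w] by (simp add: abs_le_iff)
  qed
  show "- L0 \<inter> - U1 \<subseteq> {w. \<bar>snd w\<bar> \<le> M}" "- L1 \<inter> - U2 \<subseteq> {w. \<bar>snd w\<bar> \<le> M}"
    using * L01 U21 by blast+
qed

text \<open>Every point of the middle curve enters \<open>U1\<close> in the future and
  \<open>L1\<close> in the past, so it suffices to find one that never enters \<open>U2\<close> in
  the future and never \<open>L0\<close> in the past. An outer curve moving down bars the exit for
  all points; one moving up bars it for some point of the middle curve. Only if both outer curves
  move up can the two requirements select different points.\<close>

lemma connecting_orbit:
  assumes iso: "lift_isotopy \<Phi>" "\<Phi> 1 = F" and up1: "\<And>w. w \<notin> L1 \<Longrightarrow> F w \<in> U1"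
    and c0: "(\<forall>w. w \<notin> L0 \<longrightarrow> F w \<in> U0) \<or> (\<forall>w. w \<notin> U0 \<longrightarrow> F w \<in> L0)"
    and c2: "(\<forall>w. w \<notin> L2 \<longrightarrow> F w \<in> U2) \<or> (\<forall>w. w \<notin> U2 \<longrightarrow> F w \<in> L2)"
    and rot: "opposite_rotation \<sigma>" and pq: "p \<in> Th0" "q \<in> Th1"
  shows "\<exists>w. w \<in> inv_set F G (- L0 \<inter> - U2) \<and> (\<exists>n. (F ^^ n) w \<in> U1) \<and> (\<exists>n. (G ^^ n) w \<in> L1)"
proof -
  have down1: "G w \<in> L1" if "w \<notin> U1" for w using up1[of "G w"] that by auto
  have F1: "(F ^^ n) w \<notin> L1" if "w \<notin> L1" for w n
  proof (induction n)
    case (Suc n)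
    then show ?case using up1[of "(F ^^ n) w"] halvesD(5)[OF halves1] by auto
  qed (use that in simp)
  have G1: "(G ^^ n) w \<notin> U1" if "w \<notin> U1" for w n
  proof (induction n)
    case (Suc n)
    then show ?case using down1[of "(G ^^ n) w"] halvesD(5)[OF halves1] by auto
  qed (use that in simp)
  have from_curve: ?thesis if w: "w \<notin> L1" "w \<notin> U1" "\<And>n. (F ^^ n) w \<notin> U2" "\<And>n. (G ^^ n) w \<notin> L0" for w
  proof (intro exI[of _ w] conjI)
    show "w \<in> inv_set F G (- L0 \<inter> - U2)"
      unfolding inv_set_def using w(3,4) F1[OF w(1)] G1[OF w(2)] L01 U21 by auto
    show "\<exists>n. (F ^^ n) w \<in> U1" using up1[OF w(1)] by (intro exI[of _ 1]) simp
    show "\<exists>n. (G ^^ n) w \<in> L1" using down1[OF w(2)] by (intro exI[of _ 1]) simp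
  qed
  have q: "q \<notin> L1" "(F ^^ n) q \<notin> U2" for n
    using pq(2) unfolding inv_set_def by (force dest: spec[of _ 0], blast)
  have p: "p \<notin> U1" "(G ^^ n) p \<notin> L0" for n
    using pq(1) unfolding inv_set_def by (force dest: spec[of _ 0], blast)
  have stay_below: "\<exists>w. w \<notin> L1 \<and> w \<notin> U1 \<and> (\<forall>n. (F ^^ n) w \<notin> U2)" if "\<And>w. w \<notin> L2 \<Longrightarrow> F w \<in> U2"
  proof -
    interpret e: drift F G M L1 U1 L2 U2
      by unfold_locales (use halves1 halves2 nest12 up1 that in auto)
    show ?thesis using e.curve0_point_staying_below[OF q] by metis
  qed
  have stay_above: "\<exists>w. w \<notin> L1 \<and> w \<notin> U1 \<and> (\<forall>n. (G ^^ n) w \<notin> L0)" if "\<And>w. w \<notin> L0 \<Longrightarrow> F w \<in> U0"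
  proof -
    interpret e: drift F G M L0 U0 L1 U1
      by unfold_locales (use halves0 halves1 nest01 up1 that in auto)
    interpret em: drift "\<lambda>w. reflect (G (reflect w))" "\<lambda>w. reflect (F (reflect w))" M "reflect -` U1" "reflect -` L1" "reflect -` U0" "reflect -` L0"
      by (rule e.mirror)
    obtain w where "w \<notin> reflect -` U1" "w \<notin> reflect -` L1" "\<And>n. ((\<lambda>w. reflect (G (reflect w))) ^^ n) w \<notin> reflect -` L0"
      by (rule em.curve0_point_staying_below[of "reflect p"]) (use p in \<open>auto simp: reflect_conj_funpow\<close>)
    then show ?thesis by (intro exI[of _ "reflect w"]) (simp add: reflect_conj_funpow)
  qed
  have below: "(F ^^ n) w \<notin> U2" if "\<forall>w. w \<notin> U2 \<longrightarrow> F w \<in> L2" "w \<notin> U2" for w n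
  proof (induction n)
    case (Suc n)
    then have "F ((F ^^ n) w) \<in> L2" using that(1) by blast
    then show ?case using halvesD(5)[OF halves2] by auto
  qed (use that in simp)
  have above: "(G ^^ n) w \<notin> L0" if "\<forall>w. w \<notin> U0 \<longrightarrow> F w \<in> L0" "w \<notin> L0" for w n
  proof (induction n)
    case (Suc n)
    have "G ((G ^^ n) w) \<in> U0" using Suc that(1) by (metis FG)
    then show ?case using halvesD(5)[OF halves0] by auto
  qed (use that in simp)
  show ?thesis
  proof (cases "\<forall>w. w \<notin> L0 \<longrightarrow> F w \<in> U0")
    case False
    then have dn0: "\<forall>w. w \<notin> U0 \<longrightarrow> F w \<in> L0" using c0 by blast
    have "\<exists>w. w \<notin> L1 \<and> w \<notin> U1 \<and> (\<forall>n. (F ^^ n) w \<notin> U2)"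
    proof (cases "\<forall>w. w \<notin> L2 \<longrightarrow> F w \<in> U2")
      case True then show ?thesis using stay_below by blast
    next
      case False
      then have dn2: "\<forall>w. w \<notin> U2 \<longrightarrow> F w \<in> L2" using c2 by blast
      have "\<exists>w. w \<notin> L1 \<and> w \<notin> U1"
      proof (rule ccontr)
        assume no: "\<not> ?thesis"
        have "(0, - M - 1) \<in> L1" "(0, M + 1) \<in> U1" using halvesD(10,11)[OF halves1] by simp_all
        then show False
          using connectedD[OF connected_UNIV halvesD(1,2)[OF halves1]] no halvesD(5)[OF halves1] by blast
      qed
      then show ?thesis using below[OF dn2] U21 by blast
    qed
    then show ?thesis using from_curve above[OF dn0] L01 by blast
  next
    case u0: True
    show ?thesis
    proof (cases "\<forall>w. w \<notin> L2 \<longrightarrow> F w \<in> U2")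
      case False
      then have dn2: "\<forall>w. w \<notin> U2 \<longrightarrow> F w \<in> L2" using c2 by blast
      then show ?thesis using from_curve below[OF dn2] stay_above u0 U21 by blast
    next
      case u2: True
      interpret t: three_up F G M L0 U0 L1 U1 L2 U2
        by unfold_locales (use u0 u2 up1 in auto)
      have RR_inv: "(F ^^ n) w \<in> t.d.RR \<longleftrightarrow> w \<in> t.d.RR" "(G ^^ n) w \<in> t.d.RR \<longleftrightarrow> w \<in> t.d.RR" for n w
        using t.m.G_pow_LL[of n "reflect w"] t.m.F_pow_LL[of n "reflect w"] by (simp_all add: t.m_LL reflect_conj_funpow)
      show ?thesis
      proof (rule ccontr)
        assume no: "\<not> ?thesis"
        \<comment> \<open>Without a connecting orbit the middle curve is covered by the open sets
          \<open>LL\<close> and \<open>RR\<close>. The points \<open>a\<close> and \<open>b\<close>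
          show that it meets both, and it is connected, so the two sets overlap.\<close>
        have cover: "- L1 \<inter> - U1 \<subseteq> t.d.LL \<union> t.d.RR"
        proof
          fix w assume w: "w \<in> - L1 \<inter> - U1"
          show "w \<in> t.d.LL \<union> t.d.RR"
          proof (rule ccontr)
            assume "w \<notin> t.d.LL \<union> t.d.RR"
            then have "(F ^^ n) w \<notin> U2" "(G ^^ n) w \<notin> L0" for n
              unfolding t.d.LL_def t.d.RR_def by auto
            then show False using no from_curve[of w] w by blast
          qed
        qed
        obtain a where "a \<notin> L1" "a \<notin> U1" "a \<notin> t.d.RR"
          using stay_below u2 unfolding t.d.RR_def by auto
        then have a: "a \<in> t.d.LL \<inter> (- L1 \<inter> - U1)" using cover by blast
        obtain b where "b \<notin> L1" "b \<notin> U1" "b \<notin> t.d.LL"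
          using stay_above u0 unfolding t.d.LL_def by auto
        then have b: "b \<in> t.d.RR \<inter> (- L1 \<inter> - U1)" using cover by blast
        have vR: "reflect -` t.m.LL = t.d.RR" unfolding t.m_LL by (simp add: vimage_def)
        then have "open t.d.RR" using open_reflect_vimage[OF t.m.open_LL] by simp
        then have LR: "t.d.LL \<inter> t.d.RR \<noteq> {}"
          using connectedD[OF connected_middle[OF halves1] t.d.open_LL, of t.d.RR] cover a b by blast
        have "- t.d.LL \<inter> - t.d.RR \<subseteq> Th0 \<union> Th1"
        proof
          fix w assume w: "w \<in> - t.d.LL \<inter> - t.d.RR"
          have L: "(F ^^ n) w \<notin> L0" "(G ^^ n) w \<notin> L0" for n
          proof -
            have "(F ^^ n) w \<notin> t.d.LL" "(G ^^ n) w \<notin> t.d.LL"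
              using w t.d.F_pow_LL[of n w] t.d.G_pow_LL[of n w] by blast+
            then show "(F ^^ n) w \<notin> L0" "(G ^^ n) w \<notin> L0" using t.d.L0_LL by blast+
          qed
          have "reflect -` (reflect -` U2) \<subseteq> reflect -` t.m.LL" using t.m.L0_LL by (rule vimage_mono)
          then have "U2 \<subseteq> t.d.RR" unfolding vR by (simp add: vimage_def)
          then have R: "(F ^^ n) w \<notin> U2" "(G ^^ n) w \<notin> U2" for n
            using w RR_inv[of n w] by blast+
          have "w \<in> inv_set F G (- L0 \<inter> - U2)" unfolding inv_set_def using L R by blast
          \<comment> \<open>The complement of \<open>U1\<close> is backward invariant and that of
            \<open>L1\<close> is forward invariant, so one half of the orbit on a given side of the
            middle curve puts the whole orbit there.\<close>
          then have "(\<forall>n. (F ^^ n) w \<notin> U1) \<or> (\<forall>n. (G ^^ n) w \<notin> L1)" using no by blast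
          then show "w \<in> Th0 \<union> Th1"
          proof
            assume *: "\<forall>n. (F ^^ n) w \<notin> U1"
            then have "(F ^^ 0) w \<notin> U1" by blast
            then have "(G ^^ n) w \<notin> U1" for n using G1[of w n] by simp
            then show ?thesis using * L by (simp add: inv_set_def)
          next
            assume *: "\<forall>n. (G ^^ n) w \<notin> L1"
            then have "(G ^^ 0) w \<notin> L1" by blast
            then have "(F ^^ n) w \<notin> L1" for n using F1[of w n] by simp
            then show ?thesis using * R by (simp add: inv_set_def)
          qed
        qed
        then show False using t.no_crossing_without_connection[OF iso rot pq LR] by blast
      qed
    qed
  qed
qed

text \<open>Both in the past and in the future the value of \<open>\<sigma> * fst\<close> becomes
  arbitrarily negative. After a start \<open>n\<close> steps in the past, the first future time
  \<open>j\<close> at which the starting value is reached again overshoots it by at most one step,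
  hence by at most \<open>C\<close>.\<close>

lemma balanced_segments_of_connecting_orbit:
  assumes up1: "\<And>w. w \<notin> L1 \<Longrightarrow> F w \<in> U1" and rot: "opposite_rotation \<sigma>"
    and w: "w \<in> inv_set F G (- L0 \<inter> - U2)" "(F ^^ n0) w \<in> U1" "(G ^^ n1) w \<in> L1"
    and C: "C \<ge> 0" "\<And>v. v \<in> - L0 \<inter> - U2 \<Longrightarrow> \<bar>fst (F v) - fst v\<bar> \<le> C"
  shows "\<exists>n\<ge>m. \<exists>v\<in>inv_set F G (- L0 \<inter> - U2). \<bar>fst ((F ^^ n) v) - fst v\<bar> \<le> C"
proof -
  interpret gf: plane_homeo G F by (rule plane_homeo_inverse)
  have \<sigma>: "\<sigma> \<in> {1,-1}" using rot unfolding opposite_rotation_def by simp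
  obtain m0 where m0: "m0 \<ge> (0::nat)" "\<And>w. w \<in> Th0 \<Longrightarrow> \<sigma> * (fst ((F ^^ m0) w) - fst w) \<ge> 1"
    "\<And>w. w \<in> Th1 \<Longrightarrow> \<sigma> * (fst ((F ^^ m0) w) - fst w) \<le> - 1"
    using opposite_rotationD[OF rot] by metis
  have win: "(F ^^ n) w \<in> - L0 \<inter> - U2" "(G ^^ n) w \<in> - L0 \<inter> - U2" for n
    using w(1) unfolding inv_set_def by blast+
  have F1: "(F ^^ n) ((F ^^ n0) w) \<in> U1" for n
  proof (induction n)
    case (Suc n)
    then show ?case using up1[of "(F ^^ n) ((F ^^ n0) w)"] halvesD(5)[OF halves1] by auto
  qed (use w in simp)
  have G1: "(G ^^ n) ((G ^^ n1) w) \<in> L1" for n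
  proof (induction n)
    case (Suc n)
    then show ?case using up1[of "G ((G ^^ n) ((G ^^ n1) w))"] halvesD(5)[OF halves1] by auto
  qed (use w in simp)
  have fwd: "\<exists>n. \<sigma> * fst ((F ^^ n) ((F ^^ n0) w)) \<le> - B" for B
  proof (rule orbit_drifts[OF closed_band(3) hperiodic_band(3) band_bounded(3) _ m0(3)])
    show "(F ^^ n) ((F ^^ n0) w) \<in> - L1 \<inter> - U2" for n
      using F1[of n] halvesD(5)[OF halves1] win(1)[of "n + n0"] by (auto simp: funpow_add)
  qed
  have bwd: "\<exists>n. \<sigma> * fst ((G ^^ n) ((G ^^ n1) w)) \<le> - B" for B
  proof (rule gf.orbit_drifts[OF closed_band(2) hperiodic_band(2) band_bounded(2)])
    show "(G ^^ n) ((G ^^ n1) w) \<in> - L0 \<inter> - U1" for n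
      using G1[of n] halvesD(5)[OF halves1] win(2)[of "n + n1"] by (auto simp: funpow_add)
    fix v assume "v \<in> inv_set G F (- L0 \<inter> - U1)"
    then have v: "v \<in> Th0" by (auto simp: inv_set_def)
    show "\<sigma> * (fst ((G ^^ m0) v) - fst v) \<le> -1"
      using m0(2)[OF inv_set_pow(2)[OF v, of m0]] by (simp add: algebra_simps)
  qed
  define f where "f = (\<lambda>n. \<sigma> * fst ((G ^^ n) w))"
  \<comment> \<open>A value below the minimum over the first \<open>m\<close> backward steps forces
    \<open>n > m\<close>. Step 0 is among them, so the value is also below the present one, which
    settles the case \<open>j = 0\<close>.\<close>
  obtain n' where n': "\<sigma> * fst ((G ^^ n') ((G ^^ n1) w)) \<le> - (1 - Min (f ` {..m}))" using bwd by blast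
  define n where "n = n' + n1"
  have "f n = \<sigma> * fst ((G ^^ n') ((G ^^ n1) w))" by (simp add: f_def n_def funpow_add)
  then have fn: "f n < Min (f ` {..m})" using n' by linarith
  have "n > m"
  proof (rule ccontr)
    assume "\<not> n > m"
    then have "Min (f ` {..m}) \<le> f n" by (intro Min_le) auto
    then show False using fn by simp
  qed
  have "Min (f ` {..m}) \<le> f 0" by (intro Min_le) auto
  then have f0: "f n \<le> \<sigma> * fst w" using fn unfolding f_def funpow_0 by linarith
  obtain k' where "\<sigma> * fst ((F ^^ k') ((F ^^ n0) w)) \<le> f n" using fwd[of "- f n"] by auto
  then have ex: "\<exists>k. \<sigma> * fst ((F ^^ k) w) \<le> f n" by (intro exI[of _ "k' + n0"]) (simp add: funpow_add)
  define j where "j = (LEAST k. \<sigma> * fst ((F ^^ k) w) \<le> f n)"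
  have j: "\<sigma> * fst ((F ^^ j) w) \<le> f n" unfolding j_def using ex by (rule LeastI_ex)
  have "\<bar>\<sigma> * fst ((F ^^ j) w) - f n\<bar> \<le> C"
  proof (cases j)
    case 0
    then show ?thesis using j f0 C(1) by simp
  next
    case (Suc i)
    have "\<not> \<sigma> * fst ((F ^^ i) w) \<le> f n" 
      using Suc unfolding j_def by (intro not_less_Least) simp
    moreover have "\<bar>fst ((F ^^ j) w) - fst ((F ^^ i) w)\<bar> \<le> C" using C(2)[OF win(1)[of i]] Suc by simp
    ultimately show ?thesis using j \<sigma> by auto
  qed
  moreover have "\<bar>\<sigma> * fst ((F ^^ j) w) - f n\<bar> = \<bar>fst ((F ^^ j) w) - fst ((G ^^ n) w)\<bar>"
    using \<sigma> by (auto simp: f_def)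
  moreover have "(F ^^ (j + n)) ((G ^^ n) w) = (F ^^ j) w" by (simp add: funpow_add)
  ultimately have "\<bar>fst ((F ^^ (j + n)) ((G ^^ n) w)) - fst ((G ^^ n) w)\<bar> \<le> C" by simp
  then show ?thesis using inv_set_pow(2)[OF w(1), of n] \<open>n > m\<close>
    by (intro exI[of _ "j + n"] conjI bexI[of _ "(G ^^ n) w"]) auto
qed

lemma balanced_segments_up:
  assumes iso: "lift_isotopy \<Phi>" "\<Phi> 1 = F" and up1: "\<And>w. w \<notin> L1 \<Longrightarrow> F w \<in> U1"
    and c0: "(\<forall>w. w \<notin> L0 \<longrightarrow> F w \<in> U0) \<or> (\<forall>w. w \<notin> U0 \<longrightarrow> F w \<in> L0)"
    and c2: "(\<forall>w. w \<notin> L2 \<longrightarrow> F w \<in> U2) \<or> (\<forall>w. w \<notin> U2 \<longrightarrow> F w \<in> L2)"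
    and rot: "opposite_rotation \<sigma>" and ne: "Th0 \<noteq> {}" "Th1 \<noteq> {}"
  shows "\<exists>C. \<forall>m. \<exists>n\<ge>m. \<exists>v\<in>inv_set F G (- L0 \<inter> - U2). \<bar>fst ((F ^^ n) v) - fst v\<bar> \<le> C"
proof -
  obtain p q where "p \<in> Th0" "q \<in> Th1" using ne by blast
  then obtain w n0 n1 where w: "w \<in> inv_set F G (- L0 \<inter> - U2)" "(F ^^ n0) w \<in> U1" "(G ^^ n1) w \<in> L1"
    using connecting_orbit[OF iso up1 c0 c2 rot] by blast
  obtain C where "C \<ge> 0" "\<And>v. v \<in> - L0 \<inter> - U2 \<Longrightarrow> \<bar>fst (F v) - fst v\<bar> \<le> C"
    using displacement_bound[OF closed_band(1) hperiodic_band(1) band_bounded(1)] by metis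
  then show ?thesis using balanced_segments_of_connecting_orbit[OF up1 rot w] by blast
qed

theorem balanced_segments:
  assumes iso: "lift_isotopy \<Phi>" "\<Phi> 1 = F"
    and c0: "(\<forall>w. w \<notin> L0 \<longrightarrow> F w \<in> U0) \<or> (\<forall>w. w \<notin> U0 \<longrightarrow> F w \<in> L0)"
    and c1: "(\<forall>w. w \<notin> L1 \<longrightarrow> F w \<in> U1) \<or> (\<forall>w. w \<notin> U1 \<longrightarrow> F w \<in> L1)"
    and c2: "(\<forall>w. w \<notin> L2 \<longrightarrow> F w \<in> U2) \<or> (\<forall>w. w \<notin> U2 \<longrightarrow> F w \<in> L2)"
    and rot: "opposite_rotation \<sigma>" and ne: "Th0 \<noteq> {}" "Th1 \<noteq> {}"
  shows "\<exists>C. \<forall>m. \<exists>n\<ge>m. \<exists>v\<in>inv_set F G (- L0 \<inter> - U2). \<bar>fst ((F ^^ n) v) - fst v\<bar> \<le> C"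
  using c1
proof
  assume "\<forall>w. w \<notin> L1 \<longrightarrow> F w \<in> U1"
  then show ?thesis using balanced_segments_up[OF iso _ c0 c2 rot ne] by blast
next
  assume dn1: "\<forall>w. w \<notin> U1 \<longrightarrow> F w \<in> L1"
  \<comment> \<open>Reflection keeps first coordinates but exchanges the two bands, so the drift
    direction of the lower band becomes \<open>- \<sigma>\<close>.\<close>
  interpret m: three_curves "\<lambda>w. reflect (F (reflect w))" "\<lambda>w. reflect (G (reflect w))" M
    "reflect -` U2" "reflect -` L2" "reflect -` U1" "reflect -` L1" "reflect -` U0" "reflect -` L0"
    by (rule mirror)
  have Th: "m.Th0 = reflect -` Th1" "m.Th1 = reflect -` Th0"
    "inv_set (\<lambda>w. reflect (F (reflect w))) (\<lambda>w. reflect (G (reflect w))) (- (reflect -` U2) \<inter> - (reflect -` L0)) = reflect -` inv_set F G (- L0 \<inter> - U2)"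
    unfolding inv_set_reflect[symmetric] by (simp_all add: vimage_Compl Int_commute)
  have reflect_mem: "(\<forall>w. reflect w \<in> X \<longrightarrow> P w) \<longleftrightarrow> (\<forall>w. w \<in> X \<longrightarrow> P (reflect w))" for X P
    by (metis reflect_simps(1))
  have "\<exists>C. \<forall>m. \<exists>n\<ge>m. \<exists>v\<in>inv_set (\<lambda>w. reflect (F (reflect w))) (\<lambda>w. reflect (G (reflect w))) (- (reflect -` U2) \<inter> - (reflect -` L0)).
      \<bar>fst (((\<lambda>w. reflect (F (reflect w))) ^^ n) v) - fst v\<bar> \<le> C"
  proof (rule m.balanced_segments_up[of "\<lambda>t w. reflect (\<Phi> t (reflect w))" "- \<sigma>"])
    show "lift_isotopy (\<lambda>t w. reflect (\<Phi> t (reflect w)))" by (rule lift_isotopy_reflect[OF iso(1)])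
    show "(\<lambda>w. reflect (\<Phi> 1 (reflect w))) = (\<lambda>w. reflect (F (reflect w)))" by (simp add: iso(2))
    show "reflect (F (reflect w)) \<in> reflect -` L1" if "w \<notin> reflect -` U1" for w
      using dn1 that unfolding vimage_eq reflect_simps by blast
    show "(\<forall>w. w \<notin> reflect -` U2 \<longrightarrow> reflect (F (reflect w)) \<in> reflect -` L2) \<or> (\<forall>w. w \<notin> reflect -` L2 \<longrightarrow> reflect (F (reflect w)) \<in> reflect -` U2)"
      using c2 unfolding vimage_eq reflect_simps by blast
    show "(\<forall>w. w \<notin> reflect -` U0 \<longrightarrow> reflect (F (reflect w)) \<in> reflect -` L0) \<or> (\<forall>w. w \<notin> reflect -` L0 \<longrightarrow> reflect (F (reflect w)) \<in> reflect -` U0)"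
      using c0 unfolding vimage_eq reflect_simps by blast
    show "m.opposite_rotation (- \<sigma>)"
      unfolding m.opposite_rotation_def Th
    proof (intro conjI allI)
      show "- \<sigma> \<in> {1, - 1}" using rot by (auto simp: opposite_rotation_def)
      fix B :: real
      obtain N where N: "\<forall>n\<ge>N. (\<forall>w\<in>Th0. \<sigma> * (fst ((F ^^ n) w) - fst w) \<ge> B) \<and> (\<forall>w\<in>Th1. \<sigma> * (fst ((F ^^ n) w) - fst w) \<le> - B)"
        using rot unfolding opposite_rotation_def by blast
      show "\<exists>N. \<forall>n\<ge>N. (\<forall>w\<in>reflect -` Th1. B \<le> - \<sigma> * (fst (((\<lambda>w. reflect (F (reflect w))) ^^ n) w) - fst w)) \<and>
           (\<forall>w\<in>reflect -` Th0. - \<sigma> * (fst (((\<lambda>w. reflect (F (reflect w))) ^^ n) w) - fst w) \<le> - B)"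
      proof (intro exI[of _ N] allI impI conjI ballI)
        fix n w assume n: "N \<le> n"
        show "B \<le> - \<sigma> * (fst (((\<lambda>w. reflect (F (reflect w))) ^^ n) w) - fst w)" if "w \<in> reflect -` Th1"
        proof -
          have "\<sigma> * (fst ((F ^^ n) (reflect w)) - fst (reflect w)) \<le> - B" using N n that by blast
          then show ?thesis by (simp add: reflect_conj_funpow algebra_simps)
        qed
        show "- \<sigma> * (fst (((\<lambda>w. reflect (F (reflect w))) ^^ n) w) - fst w) \<le> - B" if "w \<in> reflect -` Th0"
        proof -
          have "B \<le> \<sigma> * (fst ((F ^^ n) (reflect w)) - fst (reflect w))" using N n that by blast
          then show ?thesis by (simp add: reflect_conj_funpow algebra_simps)
        qed
      qed
    qed
    obtain p q where "p \<in> Th0" "q \<in> Th1" using ne by blast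
    then have "reflect p \<in> m.Th1" "reflect q \<in> m.Th0" unfolding Th by simp_all
    then show "m.Th0 \<noteq> {}" "m.Th1 \<noteq> {}" by blast+
  qed
  then obtain C where C: "\<And>m. \<exists>n\<ge>m. \<exists>v\<in>reflect -` inv_set F G (- L0 \<inter> - U2).
      \<bar>fst (((\<lambda>w. reflect (F (reflect w))) ^^ n) v) - fst v\<bar> \<le> C" unfolding Th by blast
  have "\<exists>n\<ge>m. \<exists>v\<in>inv_set F G (- L0 \<inter> - U2). \<bar>fst ((F ^^ n) v) - fst v\<bar> \<le> C" for m
  proof -
    obtain n v where "n \<ge> m" "v \<in> reflect -` inv_set F G (- L0 \<inter> - U2)"
      "\<bar>fst (((\<lambda>w. reflect (F (reflect w))) ^^ n) v) - fst v\<bar> \<le> C" using C by blast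
    then show ?thesis
      by (intro exI[of _ n] conjI bexI[of _ "reflect v"]) (simp_all add: reflect_conj_funpow)
  qed
  then show ?thesis by blast
qed

end

section \<open>Lifting isotopies of the annulus\<close>

lemma ann_proj_Ann: "ann_proj w \<in> Ann"
  by (simp add: ann_proj_def Ann_def)

lemma ann_proj_translate [simp]: "ann_proj (w + (of_int k, 0)) = ann_proj w"
proof -
  have "2 * pi * (fst w + of_int k) = 2 * pi * fst w + 2 * pi * of_int k" by (simp add: algebra_simps)
  then have "cis (2 * pi * (fst w + of_int k)) = cis (2 * pi * fst w) * cis (2 * pi * of_int k)"
    by (simp only: cis_mult)
  also have "cis (2 * pi * of_int k) = 1" by (simp add: complex_eq_iff cos_int_2pin sin_int_2pin)
  finally show ?thesis by (simp add: ann_proj_def)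
qed

lemma ann_proj_eqD:
  assumes "ann_proj w = ann_proj w'"
  obtains k :: int where "w' = w + (of_int k, 0)"
proof -
  have "cis (2 * pi * fst w') = cis (2 * pi * fst w)" "snd w' = snd w"
    using assms by (auto simp: ann_proj_def)
  then have "sin (2 * pi * fst w') = sin (2 * pi * fst w) \<and> cos (2 * pi * fst w') = cos (2 * pi * fst w)"
    by (simp add: complex_eq_iff)
  then obtain k :: int where "2 * pi * fst w' = 2 * pi * fst w + 2 * pi * of_int k"
    unfolding sin_cos_eq_iff by blast
  then have "2 * pi * (fst w' - fst w - of_int k) = 0" by (simp add: algebra_simps)
  then have "fst w' = fst w + of_int k" by simp
  then show thesis using that[of k] \<open>snd w' = snd w\<close> by (simp add: prod_eq_iff)
qed

lemma ann_proj_surj: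
  assumes "z \<in> Ann" obtains w where "ann_proj w = z"
proof -
  have "cmod (fst z) = 1" using assms by (auto simp: Ann_def)
  then have "cis (Arg (fst z)) = fst z" by (metis cis_Arg norm_zero sgn_eq div_by_1 of_real_1 zero_neq_one)
  then have "ann_proj (Arg (fst z) / (2 * pi), snd z) = z" by (simp add: ann_proj_def prod_eq_iff)
  then show thesis using that by blast
qed

lemma continuous_on_ann_proj: "continuous_on S ann_proj"
  unfolding ann_proj_def by (intro continuous_intros)

context
  fixes Ht H
  assumes iso: "ann_isotopy H" and lift: "is_isotopy_lift Ht H"
begin

lemma lift_continuous: "continuous_on ({0..1} \<times> UNIV) (\<lambda>(t, w). Ht t w)"
  and lift_zero: "Ht 0 w = w"
  and lift_proj: "t \<in> {0..1} \<Longrightarrow> ann_proj (Ht t w) = H t (ann_proj w)"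
  using lift unfolding is_isotopy_lift_def by blast+

text \<open>At each time the two lifted points have the same projection, so they differ by an
  integer translation; the integer varies continuously and equals \<open>k\<close> at time
  0.\<close>

lemma lift_translate:
  assumes t: "t \<in> {0..1}" shows "Ht t (w + (of_int k, 0)) = Ht t w + (of_int k, 0)"
proof -
  define d where "d = (\<lambda>t. fst (Ht t (w + (of_int k, 0))) - fst (Ht t w))"
  have ex: "\<exists>j::int. Ht t (w + (of_int k, 0)) = Ht t w + (of_int j, 0)" if t: "t \<in> {0..1}" for t
  proof -
    have "ann_proj (Ht t w) = ann_proj (Ht t (w + (of_int k, 0)))" using lift_proj[OF t] by simp
    then show ?thesis by (rule ann_proj_eqD) blast
  qed
  have int: "\<exists>j::int. d t = of_int j" if "t \<in> {0..1}" for t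
    using ex[OF that] by (auto simp: d_def)
  have "d constant_on {0..1}"
  proof (rule continuous_discrete_range_constant)
    show "continuous_on {0..1} d" unfolding d_def
      by (intro continuous_intros continuous_on_isotopy_compose[OF lift_continuous]) auto
    fix s :: real assume s: "s \<in> {0..1}"
    show "\<exists>e>0. \<forall>t. t \<in> {0..1} \<and> d t \<noteq> d s \<longrightarrow> e \<le> norm (d t - d s)"
    proof (intro exI[of _ 1] conjI allI impI)
      fix t assume "t \<in> {0..1} \<and> d t \<noteq> d s"
      moreover obtain i j :: int where "d s = of_int i" "d t = of_int j" using int s calculation by blast
      ultimately have "j \<noteq> i" "d t - d s = of_int (j - i)" by auto
      then have "1 \<le> \<bar>j - i\<bar>" by linarith
      then have "1 \<le> \<bar>real_of_int (j - i)\<bar>" by linarith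
      then show "1 \<le> norm (d t - d s)" using \<open>d t - d s = of_int (j - i)\<close> by simp
    qed simp
  qed simp
  then have "d t = d 0" using t unfolding constant_on_def by (metis atLeastAtMost_iff order_refl zero_le_one)
  moreover have "d 0 = of_int k" by (simp add: d_def lift_zero)
  moreover obtain j :: int where j: "Ht t (w + (of_int k, 0)) = Ht t w + (of_int j, 0)" using ex[OF t] by blast
  ultimately have "real_of_int j = of_int k" by (simp add: d_def)
  then show ?thesis using j by simp
qed

lemma lift_bij: assumes t: "t \<in> {0..1}" shows "bij (Ht t)"
proof -
  obtain g where g: "homeomorphism Ann Ann (H t) g" using iso t unfolding ann_isotopy_def by blast
  have "w = w'" if eq: "Ht t w = Ht t w'" for w w'
  proof -
    have "H t (ann_proj w) = H t (ann_proj w')" using lift_proj[OF t] eq by metis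
    then have "ann_proj w = ann_proj w'" using homeomorphism_apply1[OF g] ann_proj_Ann by metis
    then obtain k :: int where k: "w' = w + (of_int k, 0)" by (rule ann_proj_eqD)
    then have "Ht t w + (of_int k, 0) = Ht t w" using eq lift_translate[OF t] by simp
    then have "real_of_int k = 0" by (simp add: prod_eq_iff)
    then show ?thesis using k by (simp add: prod_eq_iff)
  qed
  then have "inj (Ht t)" by (rule injI)
  moreover have "\<exists>w. v = Ht t w" for v
  proof -
    have "ann_proj v \<in> H t ` Ann" using homeomorphism_image1[OF g] ann_proj_Ann by simp
    then obtain z where z: "z \<in> Ann" "ann_proj v = H t z" by blast
    obtain w where "ann_proj w = z" using ann_proj_surj[OF z(1)] by blast
    then have "ann_proj (Ht t w) = ann_proj v" using lift_proj[OF t] z by simp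
    then obtain k :: int where "v = Ht t w + (of_int k, 0)" by (rule ann_proj_eqD)
    then have "v = Ht t (w + (of_int k, 0))" using lift_translate[OF t] by simp
    then show ?thesis by blast
  qed
  then have "surj (Ht t)" by (auto simp: surj_def)
  ultimately show ?thesis by (simp add: bij_def)
qed

text \<open>Invariance of domain: a continuous bijection of the plane has a continuous
  inverse.\<close>

lemma lift_inv_continuous: "continuous_on UNIV (inv (Ht 1))"
proof -
  have c: "continuous_on UNIV (Ht 1)"
    using continuous_on_isotopy_compose[OF lift_continuous, of UNIV "\<lambda>_. 1" "\<lambda>w. w"] by (simp add: continuous_on_id)
  have b: "bij (Ht 1)" by (rule lift_bij) simp
  obtain g where g: "homeomorphism UNIV (range (Ht 1)) (Ht 1) g"
    by (rule invariance_of_domain_homeomorphism[of UNIV "Ht 1"]) (use c b bij_is_inj in auto)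
  have "inv (Ht 1) = g"
    using g b by (intro inv_equality) (auto simp: homeomorphism_def bij_is_surj)
  then show ?thesis using g b by (simp add: homeomorphism_def bij_is_surj)
qed

text \<open>The time-extended map \<open>(t, w) \<mapsto> (t, Ht t w)\<close> is a homeomorphism by invariance of domain, so the
  points ever visiting the level \<open>M\<close> lie in a bounded strip.\<close>
lemma lift_level_bound:
  obtains B where "\<And>t w. t \<in> {0..1} \<Longrightarrow> snd (Ht t w) = M \<Longrightarrow> \<bar>snd w\<bar> \<le> B"
proof -
  \<comment> \<open>Clamping the time to the unit interval extends the map to all of space, as
    invariance of domain requires an open domain.\<close>
  define c :: "real \<Rightarrow> real" where "c = (\<lambda>t. max 0 (min 1 t))"
  define E where "E = (\<lambda>z::real \<times> (real \<times> real). (fst z, Ht (c (fst z)) (snd z)))"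
  have c01: "c t \<in> {0..1}" for t by (auto simp: c_def)
  have contE: "continuous_on UNIV E" unfolding E_def
    by (intro continuous_intros continuous_on_isotopy_compose[OF lift_continuous])
      (use c01 in \<open>auto simp: c_def intro!: continuous_intros\<close>)
  have injE: "inj E"
  proof (rule injI)
    fix x y assume "E x = E y"
    then have "fst x = fst y" "Ht (c (fst x)) (snd x) = Ht (c (fst x)) (snd y)" by (auto simp: E_def)
    moreover have "inj (Ht (c (fst x)))" using lift_bij[OF c01] by (rule bij_is_inj)
    ultimately show "x = y" by (metis injD prod.expand)
  qed
  have surjE: "range E = UNIV"
  proof -
    have "y \<in> range E" for y
    proof -
      obtain w where "snd y = Ht (c (fst y)) w" using lift_bij[OF c01] by (metis bij_pointE)
      then have "y = E (fst y, w)" by (simp add: E_def prod_eq_iff)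
      then show ?thesis by blast
    qed
    then show ?thesis by blast
  qed
  obtain g where g: "homeomorphism UNIV (range E) E g"
    by (rule invariance_of_domain_homeomorphism[of UNIV E]) (use contE injE in auto)
  define K where "K = {0..1::real} \<times> ({0..1::real} \<times> {M})"
  have "compact K" unfolding K_def by (intro compact_Times) auto
  then have "compact (g ` K)"
    using g surjE by (intro compact_continuous_image) (auto simp: homeomorphism_def intro: continuous_on_subset)
  then have "bounded (g ` K)" by (rule compact_imp_bounded)
  then obtain B where B: "\<And>x. x \<in> g ` K \<Longrightarrow> norm x \<le> B" unfolding bounded_iff by blast
  have "\<bar>snd w\<bar> \<le> B" if t: "t \<in> {0..1}" and M: "snd (Ht t w) = M" for t w
  proof -
    obtain k :: int where k: "0 \<le> fst (Ht t w) + of_int k" "fst (Ht t w) + of_int k \<le> 1" using unit_translate by blast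
    define v where "v = w + (of_int k, 0)"
    have "c t = t" using t by (auto simp: c_def)
    then have "E (t, v) = (t, Ht t w + (of_int k, 0))" by (simp add: E_def v_def lift_translate[OF t])
    then have "E (t, v) \<in> K" using t k M by (simp add: K_def mem_Times_iff)
    moreover have "g (E (t, v)) = (t, v)" using homeomorphism_apply1[OF g UNIV_I] .
    ultimately have "norm (t, v) \<le> B" using B by (metis imageI)
    moreover have "norm v \<le> norm (t, v)" by (rule norm_snd_le)
    moreover have "\<bar>snd v\<bar> \<le> norm v" by (metis norm_snd_le prod.collapse real_norm_def)
    ultimately show ?thesis by (simp add: v_def)
  qed
  then show thesis using that by blast
qed

lemma lift_path_continuous: "t \<in> {0..1} \<Longrightarrow> continuous_on {0..t} (\<lambda>s. snd (Ht s w))"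
  by (intro continuous_intros continuous_on_isotopy_compose[OF lift_continuous]) auto

lemma lift_isotopy_Ht: "lift_isotopy Ht"
  unfolding lift_isotopy_def
proof (intro conjI ballI allI)
  show "\<exists>M'. \<forall>t\<in>{0..1}. \<forall>w. M' < snd w \<longrightarrow> M < snd (Ht t w)" for M
  proof -
    obtain B where B: "\<And>t w. t \<in> {0..1} \<Longrightarrow> snd (Ht t w) = M \<Longrightarrow> \<bar>snd w\<bar> \<le> B" using lift_level_bound[of M] by metis
    \<comment> \<open>A trajectory starting above \<open>M\<close> and found at or below it later
      has crossed the level \<open>M\<close>, which is impossible for starting points higher than
      \<open>B\<close>.\<close>
    have "M < snd (Ht t w)" if t: "t \<in> {0..1}" and w: "max B M < snd w" for t w
    proof (rule ccontr)
      assume "\<not> M < snd (Ht t w)"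
      then obtain s where "s \<in> {0..t}" "snd (Ht s w) = M"
        using connected_attains[OF _ lift_path_continuous[OF t, of w], of t 0 M] t w by (auto simp: lift_zero)
      then show False using B[of s w] t w by auto
    qed
    then show ?thesis by blast
  qed
  show "\<exists>M'. \<forall>t\<in>{0..1}. \<forall>w. snd w < M' \<longrightarrow> snd (Ht t w) < M" for M
  proof -
    obtain B where B: "\<And>t w. t \<in> {0..1} \<Longrightarrow> snd (Ht t w) = M \<Longrightarrow> \<bar>snd w\<bar> \<le> B" using lift_level_bound[of M] by metis
    have "snd (Ht t w) < M" if t: "t \<in> {0..1}" and w: "snd w < min (- B) M" for t w
    proof (rule ccontr)
      assume "\<not> snd (Ht t w) < M"
      then obtain s where "s \<in> {0..t}" "snd (Ht s w) = M"
        using connected_attains[OF _ lift_path_continuous[OF t, of w], of 0 t M] t w by (auto simp: lift_zero)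
      then show False using B[of s w] t w by auto
    qed
    then show ?thesis by blast
  qed
qed (use lift_continuous lift_zero lift_bij lift_inv_continuous lift_translate in auto)

lemma plane_homeo_Ht: "plane_homeo (Ht 1) (inv (Ht 1))"
proof
  note b = lift_bij[of 1, simplified]
  show "continuous_on UNIV (Ht 1)" by (rule lift_isotopyD(8)[OF lift_isotopy_Ht])
  show "continuous_on UNIV (inv (Ht 1))" by (rule lift_inv_continuous)
  show "Ht 1 (inv (Ht 1) w) = w" "inv (Ht 1) (Ht 1 w) = w" for w
    using b by (auto simp: bij_is_surj surj_f_inv_f bij_is_inj)
  show "Ht 1 (w + (of_int k, 0)) = Ht 1 w + (of_int k, 0)" for w and k :: int by (rule lift_translate) simp
qed

lemma funpow_proj: "(H 1 ^^ n) (ann_proj w) = ann_proj ((Ht 1 ^^ n) w)"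
  by (induction n) (auto simp: lift_proj)

text \<open>The image condition in \<open>Theta\<close> turns into a condition on iterates of the
  lifted inverse, because two lifts of a point differ by a translation that commutes with these
  iterates.\<close>

lemma Theta_lift:
  assumes "A \<subseteq> Ann"
  shows "ann_proj w \<in> Theta (H 1) A \<longleftrightarrow> w \<in> inv_set (Ht 1) (inv (Ht 1)) (ann_proj -` A)"
proof -
  interpret plane_homeo "Ht 1" "inv (Ht 1)" by (rule plane_homeo_Ht)
  have "ann_proj w \<in> (H 1 ^^ n) ` A \<longleftrightarrow> ann_proj ((inv (Ht 1) ^^ n) w) \<in> A" for n
  proof
    assume "ann_proj w \<in> (H 1 ^^ n) ` A"
    then obtain a where a: "a \<in> A" "ann_proj w = (H 1 ^^ n) a" by blast
    obtain v where v: "ann_proj v = a" using ann_proj_surj a(1) assms by blast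
    then have "ann_proj ((Ht 1 ^^ n) v) = ann_proj w" using a(2) funpow_proj by metis
    then obtain k :: int where "w = (Ht 1 ^^ n) v + (of_int k, 0)" by (rule ann_proj_eqD)
    then have "(inv (Ht 1) ^^ n) w = v + (of_int k, 0)" by (simp add: perG_pow)
    then show "ann_proj ((inv (Ht 1) ^^ n) w) \<in> A" using v a by simp
  next
    assume "ann_proj ((inv (Ht 1) ^^ n) w) \<in> A"
    moreover have "ann_proj w = (H 1 ^^ n) (ann_proj ((inv (Ht 1) ^^ n) w))" by (simp add: funpow_proj)
    ultimately show "ann_proj w \<in> (H 1 ^^ n) ` A" by blast
  qed
  moreover have "ann_proj w \<in> A" if "\<forall>n. ann_proj ((Ht 1 ^^ n) w) \<in> A"
    using that[rule_format, of 0] by simp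
  ultimately show ?thesis unfolding Theta_def inv_set_def vimage_eq mem_Collect_eq funpow_proj by blast
qed

lemma rho_n_lift: "rho_n Ht n (ann_proj w) = (fst ((Ht 1 ^^ n) w) - fst w) / real n"
proof -
  interpret plane_homeo "Ht 1" "inv (Ht 1)" by (rule plane_homeo_Ht)
  define v where "v = (SOME v. ann_proj v = ann_proj w)"
  have "ann_proj v = ann_proj w" unfolding v_def by (rule someI) simp
  then have "ann_proj w = ann_proj v" by simp
  then obtain k :: int where k: "v = w + (of_int k, 0)" by (rule ann_proj_eqD)
  show ?thesis unfolding rho_n_def Let_def v_def[symmetric] k by (simp add: perF_pow)
qed

end

section \<open>Essential Jordan curves\<close>

text \<open>The annulus is identified with the punctured plane by \<open>(z, r) \<mapsto> exp r * z\<close>, which turns the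
  universal covering into the complex exponential.\<close>

definition ann_emb :: "complex \<times> real \<Rightarrow> complex" where
  "ann_emb z = of_real (exp (snd z)) * fst z"

definition exp_cov :: "real \<times> real \<Rightarrow> complex" where
  "exp_cov w = exp (Complex (snd w) (2 * pi * fst w))"

lemma exp_cov_ann_emb: "exp_cov w = ann_emb (ann_proj w)"
proof -
  have "Complex (snd w) (2 * pi * fst w) = of_real (snd w) + \<i> * of_real (2 * pi * fst w)"
    by (simp add: complex_eq_iff)
  then show ?thesis
    unfolding exp_cov_def ann_emb_def ann_proj_def fst_conv snd_conv
    by (simp only: exp_add exp_of_real cis_conv_exp)
qed

lemma exp_cov_nonzero [simp]: "exp_cov w \<noteq> 0"
  by (simp add: exp_cov_def)

lemma norm_exp_cov: "cmod (exp_cov w) = exp (snd w)"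
  by (simp add: exp_cov_def norm_exp_eq_Re)

lemma continuous_on_exp_cov: "continuous_on S exp_cov"
  unfolding exp_cov_def complex_eq by (auto intro!: continuous_intros)

lemma continuous_on_ann_emb: "continuous_on S ann_emb"
  unfolding ann_emb_def by (intro continuous_intros)

lemma norm_ann_emb: "z \<in> Ann \<Longrightarrow> cmod (ann_emb z) = exp (snd z)"
  by (auto simp: ann_emb_def Ann_def norm_mult)

lemma inj_on_ann_emb: "inj_on ann_emb Ann"
proof (rule inj_onI)
  fix x y assume xy: "x \<in> Ann" "y \<in> Ann" and eq: "ann_emb x = ann_emb y"
  have "exp (snd x) = exp (snd y)" using norm_ann_emb xy eq by metis
  then have "snd x = snd y" by simp
  moreover have "fst x = fst y" using eq calculation by (simp add: ann_emb_def)
  ultimately show "x = y" by (simp add: prod_eq_iff)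
qed

lemma exp_cov_translate: "exp_cov (w + (of_int k, 0)) = exp_cov w"
  by (simp add: exp_cov_ann_emb)

lemma exp_cov_eqD:
  assumes "exp_cov w = exp_cov w'" obtains k :: int where "w' = w + (of_int k, 0)"
proof -
  have "ann_proj w = ann_proj w'"
    using assms inj_on_ann_emb ann_proj_Ann unfolding exp_cov_ann_emb by (metis inj_onD)
  then show thesis using that ann_proj_eqD by metis
qed

lemma exp_cov_log: "exp l = exp_cov (Im l / (2 * pi), Re l)"
  by (simp add: exp_cov_def)

lemma hperiodic_exp_cov_vimage: "hperiodic (exp_cov -` W)"
  unfolding hperiodic_def by (simp add: exp_cov_translate)

lemma open_exp_cov_vimage: "open W \<Longrightarrow> open (exp_cov -` W)"
  by (rule open_vimage[OF _ continuous_on_exp_cov])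

text \<open>A path of \<open>W\<close> lifts through a logarithm and ends at some integer translate
  of \<open>v0\<close>, hence in \<open>V\<close>. Periodicity of the connected set \<open>V\<close>
  is what links the sheets; for a small disc \<open>W\<close> the preimage would be
  disconnected.\<close>

lemma connected_exp_cov_vimage:
  assumes W: "open W" "connected W" "0 \<notin> W" and V: "connected V" "hperiodic V" "v0 \<in> V" "exp_cov ` V \<subseteq> W"
  shows "connected (exp_cov -` W)"
proof -
  have toV: "\<exists>v\<in>V. connected_component (exp_cov -` W) w v" if w: "w \<in> exp_cov -` W" for w
  proof -
    have "path_connected W" using W connected_open_path_connected by blast
    moreover have "exp_cov w \<in> W" "exp_cov v0 \<in> W" using w V(3,4) by auto
    ultimately obtain g where g: "path g" "path_image g \<subseteq> W" "pathstart g = exp_cov w" "pathfinish g = exp_cov v0"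
      unfolding path_connected_def by metis
    obtain l where l: "continuous_on {0..1} l" "\<And>t. t \<in> {0..1} \<Longrightarrow> g t = exp (l t)"
    proof (rule continuous_logarithm_on_contractible[of "{0..1::real}" g])
      show "continuous_on {0..1} g" using g(1) by (simp add: path_def)
      show "g t \<noteq> 0" if "t \<in> {0..1}" for t 
      proof -
        have "g t \<in> W" using g(2) that unfolding path_image_def by blast
        then show ?thesis using W(3) by metis
      qed
    qed (auto intro: convex_imp_contractible)
    have "exp_cov (Im (l 0) / (2 * pi), Re (l 0)) = exp_cov w"
      using l(2)[of 0] g(3) by (simp add: exp_cov_log pathstart_def)
    then obtain k :: int where k: "w = (Im (l 0) / (2 * pi), Re (l 0)) + (of_int k, 0)" by (rule exp_cov_eqD)
    define h where "h = (\<lambda>t. (Im (l t) / (2 * pi), Re (l t)) + (of_int k, 0))"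
    have ch: "continuous_on {0..1} h" unfolding h_def using l(1) by (intro continuous_intros) auto
    have hg: "exp_cov (h t) = g t" if "t \<in> {0..1}" for t
      using l(2)[OF that] by (simp only: h_def exp_cov_translate exp_cov_log)
    have "exp_cov v0 = exp_cov (h 1)" using hg[of 1] g(4) by (simp add: pathfinish_def)
    then obtain j :: int where "h 1 = v0 + (of_int j, 0)" by (rule exp_cov_eqD)
    then have hV: "h 1 \<in> V" using hperiodicD[OF V(2,3)] by simp
    have "connected (h ` {0..1})" by (rule connected_continuous_image[OF ch]) simp
    moreover have "h ` {0..1} \<subseteq> exp_cov -` W" using hg g(2) by (auto simp: path_image_def)
    moreover have "w \<in> h ` {0..1}" using k by (auto simp: h_def intro!: image_eqI[of _ _ 0])
    moreover have "h 1 \<in> h ` {0..1}" by simp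
    ultimately have "connected_component (exp_cov -` W) w (h 1)" unfolding connected_component_def by blast
    then show ?thesis using hV by blast
  qed
  have "V \<subseteq> exp_cov -` W" using V(4) by blast
  then have inV: "connected_component (exp_cov -` W) v v'" if "v \<in> V" "v' \<in> V" for v v'
    using V(1) that unfolding connected_component_def by blast
  show ?thesis unfolding connected_iff_connected_component
    using toV inV by (meson connected_component_sym connected_component_trans)
qed

text \<open>A sequence in \<open>W\<close> converging to \<open>exp_cov w\<close> is lifted near
  \<open>w\<close> by the principal logarithm of the quotients, which tend to 1.\<close>

lemma closure_exp_cov_vimage:
  assumes "exp_cov w \<in> closure W" shows "w \<in> closure (exp_cov -` W)"
proof -
  obtain u where u: "\<And>n. u n \<in> W" "u \<longlonglongrightarrow> exp_cov w" using assms unfolding closure_sequential by blast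
  define l where "l = (\<lambda>n. Ln (u n / exp_cov w))"
  have "(\<lambda>n. u n / exp_cov w) \<longlonglongrightarrow> exp_cov w / exp_cov w" using u(2) by (intro tendsto_intros) auto
  then have "(\<lambda>n. u n / exp_cov w) \<longlonglongrightarrow> 1" by simp
  then have "l \<longlonglongrightarrow> Ln 1" unfolding l_def by (rule tendsto_Ln) auto
  then have l0: "l \<longlonglongrightarrow> 0" by simp
  define v where "v = (\<lambda>n. w + (Im (l n) / (2 * pi), Re (l n)))"
  have "v \<longlonglongrightarrow> w + (Im 0 / (2 * pi), Re 0)"
    unfolding v_def using l0 by (intro tendsto_intros) auto
  then have "v \<longlonglongrightarrow> w" by (simp add: plus_prod_def)
  have "\<forall>\<^sub>F n in sequentially. u n \<noteq> 0" using u(2) by (rule tendsto_imp_eventually_ne) simp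
  then have "\<forall>\<^sub>F n in sequentially. v n \<in> closure (exp_cov -` W)"
  proof eventually_elim
    case (elim n)
    have "Complex (snd (v n)) (2 * pi * fst (v n)) = Complex (snd w) (2 * pi * fst w) + l n"
      by (simp add: v_def complex_eq_iff algebra_simps)
    then have "exp_cov (v n) = exp_cov w * exp (l n)" unfolding exp_cov_def by (simp add: exp_add)
    also have "\<dots> = u n" using elim by (simp add: l_def)
    finally have "v n \<in> exp_cov -` W" using u(1) by simp
    then show ?case by (rule subsetD[OF closure_subset])
  qed
  then show ?thesis using Lim_in_closed_set[OF closed_closure _ _ \<open>v \<longlonglongrightarrow> w\<close>] by simp
qed

lemma bounded_annulus_band: "bounded {z \<in> Ann. \<bar>snd z\<bar> \<le> M}"
proof -
  have "{z \<in> Ann. \<bar>snd z\<bar> \<le> M} \<subseteq> sphere 0 1 \<times> {-M..M}" by (auto simp: Ann_def)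
  moreover have "bounded (sphere (0::complex) 1 \<times> {-M..M})"
    by (intro compact_imp_bounded compact_Times) auto
  ultimately show ?thesis by (rule bounded_subset[rotated])
qed

text \<open>If \<open>0\<close> were outside, the inside would be bounded and away from
  \<open>0\<close>, hence a bounded part of the annulus, while the outside minus \<open>0\<close> is
  connected. The complement of the curve would then have at most one unbounded component.\<close>

lemma inside_contains_zero:
  assumes \<gamma>: "\<gamma> \<subseteq> Ann" and ess: "essential \<gamma>" and c: "simple_path c" "pathfinish c = pathstart c" "path_image c = ann_emb ` \<gamma>"
  shows "0 \<in> inside (path_image c)"
proof -
  define I where "I = inside (path_image c)"
  define Q where "Q = outside (path_image c)"
  note J = Jordan_inside_outside[OF c(1,2), folded I_def Q_def]
  have emb0: "ann_emb z \<noteq> 0" if "z \<in> Ann" for z using norm_ann_emb[OF that] by auto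
  have "0 \<notin> Q"
  proof
    assume 0: "0 \<in> Q"
    then obtain e where e: "e > 0" "ball 0 e \<subseteq> Q" using openE[of Q 0] J by blast
    have "bounded I" using J by blast
    then obtain b where b: "b > 0" "\<And>x. x \<in> I \<Longrightarrow> cmod x \<le> b" unfolding bounded_pos by blast
    define UQ where "UQ = Ann \<inter> ann_emb -` Q"
    have "connected (Q - {0})" using J by (intro connected_open_delete) auto
    moreover have "UQ = (\<lambda>u. (u / of_real (cmod u), ln (cmod u))) ` (Q - {0})"
    proof (intro equalityI subsetI)
      fix z assume z: "z \<in> UQ"
      then have "cmod (fst z) = 1" by (auto simp: UQ_def Ann_def)
      then have "z = (ann_emb z / of_real (cmod (ann_emb z)), ln (cmod (ann_emb z)))"
        by (simp add: ann_emb_def norm_mult prod_eq_iff)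
      moreover have "ann_emb z \<in> Q - {0}" using z emb0 by (auto simp: UQ_def)
      ultimately show "z \<in> (\<lambda>u. (u / of_real (cmod u), ln (cmod u))) ` (Q - {0})" by blast
    next
      fix z assume "z \<in> (\<lambda>u. (u / of_real (cmod u), ln (cmod u))) ` (Q - {0})"
      then obtain u where u: "u \<in> Q" "u \<noteq> 0" "z = (u / of_real (cmod u), ln (cmod u))" by blast
      then show "z \<in> UQ" by (simp add: UQ_def ann_emb_def Ann_def norm_divide)
    qed
    moreover have "continuous_on (Q - {0}) (\<lambda>u. (u / of_real (cmod u), ln (cmod u)))"
      by (intro continuous_intros) auto
    ultimately have cUQ: "connected UQ" using connected_continuous_image by metis
    have sub: "UQ \<subseteq> Ann - \<gamma>"
      using J unfolding UQ_def c(3) by blast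
    have "C = UQ" if C: "C \<in> components (Ann - \<gamma>)" "\<not> bounded C" for C
    proof -
      have conC: "connected C" and CA: "C \<subseteq> Ann - \<gamma>" and "C \<noteq> {}"
        using C(1) in_components_connected in_components_subset in_components_nonempty by metis+
      have IQ: "ann_emb z \<in> I \<union> Q" if "z \<in> C" for z
      proof -
        have "ann_emb z \<notin> ann_emb ` \<gamma>" using that CA \<gamma> inj_on_ann_emb by (auto dest: inj_onD)
        then show ?thesis using J c(3) by auto
      qed
      have "C \<inter> ann_emb -` I = {}"
      proof (rule ccontr)
        assume ne: "C \<inter> ann_emb -` I \<noteq> {}"
        have "open (ann_emb -` I)" "open (ann_emb -` Q)" using J open_vimage continuous_on_ann_emb by blast+
        moreover have "C \<subseteq> ann_emb -` I \<union> ann_emb -` Q" using IQ by blast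
        moreover have "ann_emb -` I \<inter> ann_emb -` Q \<inter> C = {}" using J by blast
        ultimately have "ann_emb -` Q \<inter> C = {}"
          using connectedD[OF conC, of "ann_emb -` I" "ann_emb -` Q"] ne by blast
        then have CI: "ann_emb z \<in> I" if "z \<in> C" for z using IQ that by blast
        have "C \<subseteq> {z \<in> Ann. \<bar>snd z\<bar> \<le> max (ln b) (- ln e)}"
        proof
          fix z assume z: "z \<in> C"
          then have zA: "z \<in> Ann" using CA by blast
          have "exp (snd z) \<le> b" using b(2)[OF CI[OF z]] norm_ann_emb[OF zA] by simp
          then have "snd z \<le> ln b" using b(1) by (simp add: ln_ge_iff)
          moreover have "ann_emb z \<notin> ball 0 e" using e(2) CI[OF z] J by blast
          then have "e \<le> exp (snd z)" using norm_ann_emb[OF zA] by simp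
          then have "exp (ln e) \<le> exp (snd z)" using e(1) by simp
          then have "ln e \<le> snd z" by (simp only: exp_le_cancel_iff)
          ultimately show "z \<in> {z \<in> Ann. \<bar>snd z\<bar> \<le> max (ln b) (- ln e)}" using zA by auto
        qed
        then show False using C(2) bounded_annulus_band bounded_subset by blast
      qed
      then have "C \<subseteq> UQ" using IQ CA unfolding UQ_def by blast
      moreover have "UQ \<subseteq> C" using components_maximal[OF C(1) cUQ sub] \<open>C \<noteq> {}\<close> calculation by blast
      ultimately show ?thesis by blast
    qed
    then have "{C \<in> components (Ann - \<gamma>). \<not> bounded C} \<subseteq> {UQ}" by blast
    then have "card {C \<in> components (Ann - \<gamma>). \<not> bounded C} \<le> 1"
      by (metis card.empty card_insert_le card_mono finite.emptyI finite.insertI is_singletonI is_singleton_altdef)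
    then show False using ess unfolding essential_def by simp
  qed
  moreover have "0 \<notin> path_image c" using emb0 \<gamma> unfolding c(3) by fastforce
  ultimately show ?thesis using J unfolding I_def by blast
qed

text \<open>Records that a half-plane descends to an open set of the annulus; arguments about
  components of the annulus take place there.\<close>

definition saturated_open :: "(real \<times> real) set \<Rightarrow> bool" where
  "saturated_open S \<longleftrightarrow> (\<exists>W. open W \<and> S = ann_proj -` W)"

lemma essential_curve_halves:
  assumes jc: "jordan_curve_in_Ann \<gamma>" and ess: "essential \<gamma>"
  obtains M L U where "halves M L U" "ann_proj -` \<gamma> = - L \<inter> - U" "saturated_open L" "saturated_open U"
proof -
  obtain p where \<gamma>: "\<gamma> \<subseteq> Ann" and p: "simple_path p" "pathfinish p = pathstart p" "path_image p = \<gamma>"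
    using jc unfolding jordan_curve_in_Ann_def by blast
  define c where "c = ann_emb \<circ> p"
  have c: "simple_path c" "pathfinish c = pathstart c" "path_image c = ann_emb ` \<gamma>"
  proof -
    have "inj_on ann_emb (path_image p)" using inj_on_ann_emb \<gamma> unfolding p(3) by (rule inj_on_subset)
    then show "simple_path c" unfolding c_def
      by (intro simple_path_continuous_image p continuous_on_ann_emb)
  qed (simp_all add: c_def pathfinish_compose pathstart_compose p path_image_compose)
  define I where "I = inside (path_image c)"
  define Q where "Q = outside (path_image c)"
  note J = Jordan_inside_outside[OF c(1,2), folded I_def Q_def]
  have 0: "0 \<in> I" unfolding I_def by (rule inside_contains_zero[OF \<gamma> ess c])
  obtain e where e: "e > 0" "ball 0 e \<subseteq> I" using openE[of I 0] J 0 by blast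
  have "bounded (I \<union> path_image c)" using J c(1) by (auto simp: bounded_simple_path_image)
  then obtain b where b: "b > 0" "\<And>x. x \<in> I \<union> path_image c \<Longrightarrow> cmod x \<le> b"
    unfolding bounded_pos by blast
  define M where "M = max (ln b) (- ln e)"
  define L where "L = exp_cov -` (I - {0})"
  define U where "U = exp_cov -` Q"
  have low: "w \<in> L" if "snd w < - M" for w
  proof -
    have "snd w < ln e" using that by (simp add: M_def)
    then have "exp (snd w) < exp (ln e)" by (simp only: exp_less_mono)
    then have "cmod (exp_cov w) < e" using e(1) by (simp add: norm_exp_cov)
    then show ?thesis using e(2) by (auto simp: L_def)
  qed
  have high: "w \<in> U" if "M < snd w" for w
  proof -
    have "ln b < snd w" using that by (simp add: M_def)
    then have "exp (ln b) < exp (snd w)" by (simp only: exp_less_mono)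
    then have "b < cmod (exp_cov w)" using b(1) by (simp add: norm_exp_cov)
    then have "exp_cov w \<notin> I \<union> path_image c" using b(2) by force
    then show ?thesis using J by (auto simp: U_def)
  qed
  have conL: "connected L" unfolding L_def
  proof (rule connected_exp_cov_vimage[of _ "{w. snd w < - M}" "(0, - M - 1)"])
    show "open (I - {0})" using J by (auto intro: open_delete)
    show "connected (I - {0})" using J by (intro connected_open_delete) auto
    have "convex {w::real\<times>real. snd w < - M}" by (auto simp: convex_def intro: convex_bound_lt)
    then show "connected {w::real\<times>real. snd w < - M}" by (rule convex_connected)
    show "hperiodic {w. snd w < - M}" by (simp add: hperiodic_def)
    show "exp_cov ` {w. snd w < - M} \<subseteq> I - {0}"
    proof
      fix x assume "x \<in> exp_cov ` {w. snd w < - M}"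
      then obtain w where "snd w < - M" "x = exp_cov w" by blast
      then show "x \<in> I - {0}" using low[of w] by (simp add: L_def)
    qed
  qed auto
  have nQ: "0 \<notin> Q" using 0 J by blast
  have conU: "connected U" unfolding U_def
  proof (rule connected_exp_cov_vimage[of _ "{w. M < snd w}" "(0, M + 1)"])
    show "open Q" "connected Q" using J by auto
    have "convex {w::real\<times>real. - snd w < - M}"
    proof (rule convexI)
      fix x y :: "real \<times> real" and u v :: real
      assume "x \<in> {w. - snd w < - M}" "y \<in> {w. - snd w < - M}" "0 \<le> u" "0 \<le> v" "u + v = 1"
      then show "u *\<^sub>R x + v *\<^sub>R y \<in> {w. - snd w < - M}"
        using convex_bound_lt[of "- snd x" "- M" "- snd y" u v] by simp
    qed
    then show "connected {w::real\<times>real. M < snd w}" using convex_connected by simp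
    show "hperiodic {w. M < snd w}" by (simp add: hperiodic_def)
    show "exp_cov ` {w. M < snd w} \<subseteq> Q"
    proof
      fix x assume "x \<in> exp_cov ` {w. M < snd w}"
      then obtain w where "M < snd w" "x = exp_cov w" by blast
      then show "x \<in> Q" using high[of w] by (simp add: U_def)
    qed
  qed (use nQ in auto)
  have L': "L = exp_cov -` I" by (auto simp: L_def)
  \<comment> \<open>Both sides of a Jordan curve have the whole curve as frontier. Hence the
    complement of one side lies between the other side and its closure, which makes it
    connected.\<close>
  have compl: "exp_cov w \<in> closure Q" if "w \<notin> L" for w
  proof -
    have "exp_cov w \<in> Q \<or> exp_cov w \<in> frontier Q" using that J unfolding L' by auto
    then show ?thesis using closure_subset by (auto simp: frontier_def)
  qed
  have compl': "exp_cov w \<in> closure I" if "w \<notin> U" for w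
  proof -
    have "exp_cov w \<in> I \<or> exp_cov w \<in> frontier I" using that J unfolding U_def by auto
    then show ?thesis using closure_subset by (auto simp: frontier_def)
  qed
  have disj: "L \<inter> U = {}" using J unfolding L' U_def by blast
  have "halves M L U"
    unfolding halves_def
  proof (intro conjI)
    show "open L" "open U" unfolding L' U_def using J open_exp_cov_vimage by blast+
    show "connected (- L)"
    proof (rule connected_intermediate_closure[OF conU])
      show "U \<subseteq> - L" using disj by blast
      show "- L \<subseteq> closure U" unfolding U_def using compl closure_exp_cov_vimage by blast
    qed
    show "connected (- U)"
    proof (rule connected_intermediate_closure[OF conL])
      show "L \<subseteq> - U" using disj by blast
      show "- U \<subseteq> closure L" unfolding L' using compl' closure_exp_cov_vimage by blast
    qed
    show "hperiodic L" "hperiodic U" unfolding L' U_def by (rule hperiodic_exp_cov_vimage)+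
    show "{w. snd w < - M} \<subseteq> L" "{w. M < snd w} \<subseteq> U" using low high by blast+
  qed (rule conL conU disj)+
  moreover have "ann_proj -` \<gamma> = - L \<inter> - U"
  proof -
    have "ann_proj w \<in> \<gamma> \<longleftrightarrow> exp_cov w \<in> path_image c" for w
      using inj_on_ann_emb \<gamma> ann_proj_Ann[of w] unfolding c(3) exp_cov_ann_emb by (auto dest: inj_onD)
    moreover have "exp_cov w \<in> path_image c \<longleftrightarrow> exp_cov w \<notin> I \<and> exp_cov w \<notin> Q" for w using J by blast
    ultimately show ?thesis unfolding L' U_def by blast
  qed
  moreover have sat: "saturated_open (exp_cov -` W)" if "open W" for W
    unfolding saturated_open_def
    by (intro exI[of _ "ann_emb -` W"] conjI open_vimage[OF that continuous_on_ann_emb])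
      (simp add: exp_cov_ann_emb set_eq_iff)
  have "saturated_open L" "saturated_open U"
    unfolding L' U_def using J by (intro sat; blast)+
  ultimately show thesis using that by blast
qed

section \<open>Rotation sets\<close>

lemma halves_mono:
  assumes "halves M L U" "M \<le> M'" shows "halves M' L U"
proof -
  note h = halvesD[OF assms(1)]
  have "w \<in> L" if "snd w < - M'" for w using h(10)[of w] assms(2) that by linarith
  moreover have "w \<in> U" if "M' < snd w" for w using h(11)[of w] assms(2) that by linarith
  ultimately show ?thesis unfolding halves_def using h(1-9) by blast
qed

lemma connected_in_half:
  assumes "connected S" "open A" "open B" "A \<inter> B = {}" "S \<subseteq> A \<union> B" "S \<inter> A \<noteq> {}"
  shows "S \<subseteq> A"
  using connectedD[OF assms(1-3)] assms(4-6) by blast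

text \<open>Each lifted curve is connected, so it lies on one side of the other. The closed side of
  the second curve not containing the first is then connected off the first curve, and its far end
  tells on which side.\<close>

lemma disjoint_curves_nested:
  assumes a: "halves M L U" and b: "halves M L' U'" and disj: "(- L \<inter> - U) \<inter> (- L' \<inter> - U') = {}"
  shows "- U \<subseteq> L' \<or> - U' \<subseteq> L"
proof -
  have cov: "- L \<inter> - U \<subseteq> L' \<union> U'" "- L' \<inter> - U' \<subseteq> L \<union> U" using disj by blast+
  have ls: "(0, - M - 1) \<in> L" "(0, - M - 1) \<in> L'" using halvesD(10)[OF a] halvesD(10)[OF b] by simp_all
  have us: "(0, M + 1) \<in> U" "(0, M + 1) \<in> U'" using halvesD(11)[OF a] halvesD(11)[OF b] by simp_all
  have "- L \<inter> - U \<subseteq> L' \<or> - L \<inter> - U \<subseteq> U'"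
    using connected_in_half[OF connected_middle[OF a] halvesD(1,2,5)[OF b] cov(1)]
      connected_in_half[OF connected_middle[OF a] halvesD(2,1)[OF b]] cov(1) halvesD(5)[OF b]
    by blast
  then show ?thesis
  proof
    assume C: "- L \<inter> - U \<subseteq> L'"
    have "- L' \<subseteq> U"
    proof (rule connected_in_half[OF halvesD(6)[OF b] halvesD(2,1)[OF a]])
      show "U \<inter> L = {}" using halvesD(5)[OF a] by blast
      show "- L' \<subseteq> U \<union> L" using C by blast
      show "- L' \<inter> U \<noteq> {}" using us halvesD(5)[OF b] by blast
    qed
    then show ?thesis by blast
  next
    assume C: "- L \<inter> - U \<subseteq> U'"
    have "- U' \<subseteq> L"
    proof (rule connected_in_half[OF halvesD(7)[OF b] halvesD(1,2)[OF a]])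
      show "L \<inter> U = {}" by (rule halvesD(5)[OF a])
      show "- U' \<subseteq> L \<union> U" using C by blast
      show "- U' \<inter> L \<noteq> {}" using ls halvesD(5)[OF b] by blast
    qed
    then show ?thesis by blast
  qed
qed

text \<open>The image of the curve is connected and disjoint from the curve, so it lies in one side.
  The other closed side then misses this image, and since \<open>F\<close> does not exchange the
  ends, it lies in the image of the corresponding open side.\<close>

lemma free_curve_up_or_down:
  assumes "plane_homeo F G" and h: "halves M L U"
    and low: "\<exists>M'. \<forall>w. snd w < M' \<longrightarrow> snd (F w) < - M" and high: "\<exists>M'. \<forall>w. M' < snd w \<longrightarrow> M < snd (F w)"
    and free: "\<And>w. w \<notin> L \<Longrightarrow> w \<notin> U \<Longrightarrow> F w \<in> L \<union> U"
  shows "(\<forall>w. w \<notin> L \<longrightarrow> F w \<in> U) \<or> (\<forall>w. w \<notin> U \<longrightarrow> F w \<in> L)"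
proof -
  interpret plane_homeo F G by fact
  have FC: "connected (F ` (- L \<inter> - U))"
    by (intro connected_continuous_image connected_middle[OF h] continuous_on_subset[OF contF]) auto
  have opens: "open (G -` L)" "open (G -` U)"
    using open_vimage_pow(2)[of _ 1] halvesD(1,2)[OF h] by simp_all
  have disj: "G -` L \<inter> G -` U = {}" using halvesD(5)[OF h] by blast
  have cov: "F ` (- L \<inter> - U) \<subseteq> L \<union> U" using free by blast
  have "F ` (- L \<inter> - U) \<subseteq> L \<or> F ` (- L \<inter> - U) \<subseteq> U"
    using connected_in_half[OF FC halvesD(1,2,5)[OF h] cov]
      connected_in_half[OF FC halvesD(2,1)[OF h]] cov halvesD(5)[OF h] by blast
  then show ?thesis
  proof
    assume C: "F ` (- L \<inter> - U) \<subseteq> L"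
    obtain M' where M': "\<And>w. M' < snd w \<Longrightarrow> M < snd (F w)" using high by blast
    define v where "v = (0::real, max M M' + 1)"
    have v: "v \<in> U" "F v \<in> U" using halvesD(11)[OF h, of v] halvesD(11)[OF h, of "F v"] M'[of v] by (simp_all add: v_def)
    have "- L \<subseteq> G -` U"
    proof (rule connected_in_half[OF halvesD(6)[OF h] opens(2,1)])
      show "G -` U \<inter> G -` L = {}" using disj by blast
      show "- L \<subseteq> G -` U \<union> G -` L"
      proof
        fix w assume w: "w \<in> - L"
        show "w \<in> G -` U \<union> G -` L"
        proof (rule ccontr)
          assume "w \<notin> G -` U \<union> G -` L"
          then have "F (G w) \<in> L" using C by blast
          then show False using w by simp
        qed
      qed
      have "F v \<in> - L \<inter> G -` U" using v halvesD(5)[OF h] by auto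
      then show "- L \<inter> G -` U \<noteq> {}" by blast
    qed
    then have "F w \<in> L" if "w \<notin> U" for w
      using that by (metis ComplI GF subsetD vimageE)
    then show ?thesis by blast
  next
    assume C: "F ` (- L \<inter> - U) \<subseteq> U"
    obtain M' where M': "\<And>w. snd w < M' \<Longrightarrow> snd (F w) < - M" using low by blast
    define v where "v = (0::real, min (- M) M' - 1)"
    have v: "v \<in> L" "F v \<in> L" using halvesD(10)[OF h, of v] halvesD(10)[OF h, of "F v"] M'[of v] by (simp_all add: v_def)
    have "- U \<subseteq> G -` L"
    proof (rule connected_in_half[OF halvesD(7)[OF h] opens disj])
      show "- U \<subseteq> G -` L \<union> G -` U"
      proof
        fix w assume w: "w \<in> - U"
        show "w \<in> G -` L \<union> G -` U"
        proof (rule ccontr)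
          assume "w \<notin> G -` L \<union> G -` U"
          then have "F (G w) \<in> U" using C by blast
          then show False using w by simp
        qed
      qed
      have "F v \<in> - U \<inter> G -` L" using v halvesD(5)[OF h] by auto
      then show "- U \<inter> G -` L \<noteq> {}" by blast
    qed
    then have "F w \<in> U" if "w \<notin> L" for w
      using that by (metis ComplI GF subsetD vimageE)
    then show ?thesis by blast
  qed
qed

lemma closed_annulus_between_commute: "closed_annulus_between \<gamma> \<gamma>' = closed_annulus_between \<gamma>' \<gamma>"
  unfolding closed_annulus_between_def by (simp add: Un_commute)

lemma closed_annulus_between_subset:
  assumes "\<gamma> \<subseteq> Ann" "\<gamma>' \<subseteq> Ann" shows "closed_annulus_between \<gamma> \<gamma>' \<subseteq> Ann"
  using assms in_components_subset unfolding closed_annulus_between_def by fastforce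

lemma ann_proj_image_unbounded:
  fixes S :: "(real \<times> real) set"
  assumes "\<And>B. \<exists>w\<in>S. \<bar>snd w\<bar> > B" shows "\<not> bounded (ann_proj ` S)"
proof
  assume "bounded (ann_proj ` S)"
  then obtain B where B: "\<And>x. x \<in> ann_proj ` S \<Longrightarrow> norm x \<le> B" unfolding bounded_iff by blast
  obtain w where w: "w \<in> S" "\<bar>snd w\<bar> > B" using assms by blast
  have "\<bar>snd w\<bar> \<le> norm (ann_proj w)" unfolding ann_proj_def by (metis norm_snd_le real_norm_def)
  then show False using B[of "ann_proj w"] w by auto
qed

text \<open>The preimage of \<open>C\<close> may be disconnected, so the connectedness argument is
  carried out in the annulus with the open sets to which \<open>A\<close> and \<open>B\<close>
  descend.\<close>

lemma lift_in_half:
  assumes C: "connected C" "C \<subseteq> Ann" and A: "saturated_open A" "saturated_open B" "A \<inter> B = {}"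
    and cov: "ann_proj -` C \<subseteq> A \<union> B" and w: "ann_proj w \<in> C" "w \<in> A"
  shows "ann_proj -` C \<subseteq> A"
proof -
  obtain W W' where W: "open W" "A = ann_proj -` W" "open W'" "B = ann_proj -` W'"
    using A(1,2) unfolding saturated_open_def by blast
  have lift: "\<exists>v. ann_proj v = z" if "z \<in> C" for z
    using that C(2) ann_proj_surj by blast
  have "C \<subseteq> W \<union> W'"
  proof
    fix z assume "z \<in> C"
    then obtain v where "ann_proj v = z" using lift by blast
    then have "v \<in> A \<union> B" using cov \<open>z \<in> C\<close> by blast
    then show "z \<in> W \<union> W'" using \<open>ann_proj v = z\<close> W(2,4) by blast
  qed
  moreover have "W \<inter> W' \<inter> C = {}"
  proof (rule ccontr)
    assume "W \<inter> W' \<inter> C \<noteq> {}"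
    then obtain z where z: "z \<in> W" "z \<in> W'" "z \<in> C" by blast
    then obtain v where "ann_proj v = z" using lift by blast
    then show False using z W(2,4) A(3) by blast
  qed
  moreover have "W \<inter> C \<noteq> {}" using w W(2) by blast
  ultimately have "W' \<inter> C = {}" using connectedD[OF C(1) W(1,3)] by blast
  then show ?thesis using cov W(2,4) by blast
qed

lemma connected_ann_proj_image: "connected S \<Longrightarrow> connected (ann_proj ` S)"
  by (rule connected_continuous_image[OF continuous_on_ann_proj])

lemma half_image_unbounded:
  assumes "halves M L U"
  shows "\<not> bounded (ann_proj ` L)" "\<not> bounded (ann_proj ` U)"
proof (rule_tac [!] ann_proj_image_unbounded)
  fix B
  define a where "a = \<bar>M\<bar> + \<bar>B\<bar> + 1"
  have "(0, - a) \<in> L" "(0, a) \<in> U"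
    using halvesD(10)[OF assms, of "(0, - a)"] halvesD(11)[OF assms, of "(0, a)"] by (auto simp: a_def)
  moreover have "B < \<bar>snd (0::real, - a)\<bar>" "B < \<bar>snd (0::real, a)\<bar>" by (auto simp: a_def)
  ultimately show "\<exists>w\<in>L. B < \<bar>snd w\<bar>" "\<exists>w\<in>U. B < \<bar>snd w\<bar>" by blast+
qed

text \<open>The images of \<open>L\<close> and \<open>U'\<close> are connected, unbounded and off
  both curves, so no bounded component meets them. A component through a point of
  \<open>U \<inter> L'\<close> stays in that region, whose heights are bounded by
  \<open>M\<close>.\<close>

lemma closed_annulus_between_lift:
  assumes h: "halves M L U" "halves M L' U'"
    and sat: "saturated_open L" "saturated_open U" "saturated_open L'" "saturated_open U'"
    and \<gamma>: "\<gamma> \<subseteq> Ann" "\<gamma>' \<subseteq> Ann" "ann_proj -` \<gamma> = - L \<inter> - U" "ann_proj -` \<gamma>' = - L' \<inter> - U'"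
    and nest: "- U \<subseteq> L'"
  shows "ann_proj -` closed_annulus_between \<gamma> \<gamma>' = - L \<inter> - U'"
proof -
  have d: "L \<inter> U = {}" "L' \<inter> U' = {}" using h halvesD(5) by blast+
  have in\<gamma>: "ann_proj w \<in> \<gamma> \<longleftrightarrow> w \<notin> L \<and> w \<notin> U" "ann_proj w \<in> \<gamma>' \<longleftrightarrow> w \<notin> L' \<and> w \<notin> U'" for w
    using \<gamma>(3,4) by blast+
  have outer: "\<not> bounded C"
    if C: "C \<in> components (Ann - (\<gamma> \<union> \<gamma>'))" "ann_proj w \<in> C" "w \<in> S" "connected S" "\<not> bounded (ann_proj ` S)"
      "\<And>v. v \<in> S \<Longrightarrow> ann_proj v \<notin> \<gamma> \<union> \<gamma>'" for C w S
  proof -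
    have "ann_proj ` S \<subseteq> C"
      by (rule components_maximal[OF C(1) connected_ann_proj_image[OF C(4)]]) (use C ann_proj_Ann in blast)+
    then show ?thesis using C(5) bounded_subset by blast
  qed
  have L_off: "ann_proj v \<notin> \<gamma> \<union> \<gamma>'" if "v \<in> L" for v using that in\<gamma> nest d by blast
  have U_off: "ann_proj v \<notin> \<gamma> \<union> \<gamma>'" if "v \<in> U'" for v using that in\<gamma> nest d by blast
  show ?thesis
  proof (intro equalityI subsetI)
    fix w assume "w \<in> ann_proj -` closed_annulus_between \<gamma> \<gamma>'"
    then consider "ann_proj w \<in> \<gamma>" | "ann_proj w \<in> \<gamma>'" |
      C where "C \<in> components (Ann - (\<gamma> \<union> \<gamma>'))" "bounded C" "ann_proj w \<in> C"
      unfolding closed_annulus_between_def by blast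
    then show "w \<in> - L \<inter> - U'"
    proof cases
      case 1 then show ?thesis using in\<gamma> nest d by blast
    next
      case 2 then show ?thesis using in\<gamma> nest d by blast
    next
      case 3
      have "w \<notin> L" using outer[OF 3(1,3) _ halvesD(3)[OF h(1)] half_image_unbounded(1)[OF h(1)] L_off] 3(2) by blast
      moreover have "w \<notin> U'" using outer[OF 3(1,3) _ halvesD(4)[OF h(2)] half_image_unbounded(2)[OF h(2)] U_off] 3(2) by blast
      ultimately show ?thesis by blast
    qed
  next
    fix w assume w: "w \<in> - L \<inter> - U'"
    show "w \<in> ann_proj -` closed_annulus_between \<gamma> \<gamma>'"
    proof (cases "ann_proj w \<in> \<gamma> \<union> \<gamma>'")
      case True then show ?thesis unfolding closed_annulus_between_def by blast
    next
      case False
      then have wUL: "w \<in> U" "w \<in> L'" using w in\<gamma> by blast+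
      define C where "C = connected_component_set (Ann - (\<gamma> \<union> \<gamma>')) (ann_proj w)"
      have wC: "ann_proj w \<in> C" using False ann_proj_Ann by (simp add: C_def)
      have C: "C \<in> components (Ann - (\<gamma> \<union> \<gamma>'))" using False ann_proj_Ann by (auto simp: C_def components_def)
      have conC: "connected C" and CA: "C \<subseteq> Ann - (\<gamma> \<union> \<gamma>')"
        using C in_components_connected in_components_subset by blast+
      have "ann_proj -` C \<subseteq> U"
        by (rule lift_in_half[OF conC _ sat(2,1) _ _ wC wUL(1)]) (use CA in\<gamma> d in blast)+
      moreover have "ann_proj -` C \<subseteq> L'"
        by (rule lift_in_half[OF conC _ sat(3,4) _ _ wC wUL(2)]) (use CA in\<gamma> d in blast)+
      ultimately have CUL: "ann_proj -` C \<subseteq> U \<inter> L'" by blast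
      have "C \<subseteq> {z \<in> Ann. \<bar>snd z\<bar> \<le> M}"
      proof
        fix z assume z: "z \<in> C"
        then obtain v where v: "ann_proj v = z" using CA ann_proj_surj by blast
        then have "v \<notin> L" "v \<notin> U'" using CUL z d by blast+
        then have "\<bar>snd v\<bar> \<le> M" using halvesD(12)[OF h(1), of v] halvesD(13)[OF h(2), of v] by (simp add: abs_le_iff)
        moreover have "snd z = snd v" using v by (auto simp: ann_proj_def)
        ultimately show "z \<in> {z \<in> Ann. \<bar>snd z\<bar> \<le> M}" using z CA by auto
      qed
      then have "bounded C" using bounded_annulus_band bounded_subset by blast
      then show ?thesis using C wC unfolding closed_annulus_between_def by blast
    qed
  qed
qed

text \<open>The infima increase and belong to the closed sets, so their supremum lies in the
  intersection and is positive; hence some infimum is already positive. An empty set of the family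
  has to be treated apart.\<close>

lemma decreasing_closed_positive:
  fixes S :: "nat \<Rightarrow> ereal set"
  assumes S: "\<And>m. closed (S m)" "\<And>m n. m \<le> n \<Longrightarrow> S n \<subseteq> S m" and pos: "(\<Inter>m\<in>{1..}. S m) \<subseteq> {0<..}"
  shows "\<exists>m\<ge>1. \<exists>a>0. \<forall>x\<in>S m. ereal a \<le> x"
proof (cases "\<exists>m\<ge>1. S m = {}")
  case True
  then obtain m where "m \<ge> 1" "S m = {}" by blast
  then show ?thesis by (intro exI[of _ m] conjI exI[of _ 1]) auto
next
  case False
  define a where "a = (\<lambda>m. Inf (S (Suc m)))"
  have aS: "a m \<in> S (Suc m)" for m unfolding a_def by (rule closed_contains_Inf_cl) (use S False in auto)
  have "incseq a" unfolding a_def by (intro monoI Inf_superset_mono S) simp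
  then have lim: "a \<longlonglongrightarrow> (SUP m. a m)" by (rule LIMSEQ_SUP)
  have "(SUP m. a m) \<in> S m" if "m \<in> {1..}" for m
  proof (rule Lim_in_closed_set[OF S(1) _ _ lim])
    have "a n \<in> S m" if "m \<le> n" for n using aS[of n] S(2)[of m "Suc n"] that by auto
    then show "\<forall>\<^sub>F n in sequentially. a n \<in> S m" using eventually_sequentially by blast
  qed simp
  then have "0 < (SUP m. a m)" using pos by blast
  then obtain m where "0 < a m" unfolding less_SUP_iff by blast
  then obtain c where c: "0 < ereal c" "ereal c < a m" using ereal_dense2 by blast
  have "ereal c \<le> x" if "x \<in> S (Suc m)" for x
    using Inf_lower[OF that] c(2) unfolding a_def by (meson less_imp_le order_trans)
  then show ?thesis using c(1) by (intro exI[of _ "Suc m"] conjI exI[of _ c]) auto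
qed

definition rho_tail :: "(complex \<times> real \<Rightarrow> complex \<times> real) \<Rightarrow> (real \<Rightarrow> real \<times> real \<Rightarrow> real \<times> real)
     \<Rightarrow> (complex \<times> real) set \<Rightarrow> nat \<Rightarrow> ereal set" where
  "rho_tail f Ht K m = (\<Union>n\<in>{m..}. {ereal (rho_n Ht n z) | z. z \<in> K \<and> (f ^^ n) z \<in> K})"

lemma rho_set_tail: "rho_set f Ht K = (\<Inter>m\<in>{1..}. closure (rho_tail f Ht K m))"
  by (simp add: rho_set_def rho_tail_def)

lemma closure_rho_tail_mono: "m \<le> n \<Longrightarrow> closure (rho_tail f Ht K n) \<subseteq> closure (rho_tail f Ht K m)"
  unfolding rho_tail_def by (intro closure_mono UN_mono) auto

context
  fixes Ht H
  assumes iso: "ann_isotopy H" and lift: "is_isotopy_lift Ht H"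
begin

lemma rho_tail_lift:
  assumes A: "A \<subseteq> Ann" "w \<in> inv_set (Ht 1) (inv (Ht 1)) (ann_proj -` A)" and n: "m \<le> n"
  shows "ereal ((fst ((Ht 1 ^^ n) w) - fst w) / real n) \<in> rho_tail (H 1) Ht (Theta (H 1) A) m"
proof -
  interpret plane_homeo "Ht 1" "inv (Ht 1)" by (rule plane_homeo_Ht[OF iso lift])
  have "ann_proj w \<in> Theta (H 1) A" "ann_proj ((Ht 1 ^^ n) w) \<in> Theta (H 1) A"
    using A(2) inv_set_pow(1)[OF A(2)] by (simp_all add: Theta_lift[OF iso lift A(1)])
  then have "ereal (rho_n Ht n (ann_proj w)) \<in> rho_tail (H 1) Ht (Theta (H 1) A) m"
    unfolding rho_tail_def using n funpow_proj[OF iso lift, of n w]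
    by (intro UN_I[of n]) (simp, metis (mono_tags, lifting) mem_Collect_eq)
  then show ?thesis by (simp add: rho_n_lift[OF iso lift])
qed

lemma linear_drift:
  assumes \<sigma>: "\<sigma> \<in> {1,-1}" and A: "A \<subseteq> Ann"
    and m: "m \<ge> 1" "a > 0" "\<And>x. x \<in> rho_tail (H 1) Ht (Theta (H 1) A) m \<Longrightarrow> ereal a \<le> ereal \<sigma> * x"
  shows "\<exists>N. \<forall>n\<ge>N. \<forall>w\<in>inv_set (Ht 1) (inv (Ht 1)) (ann_proj -` A). B \<le> \<sigma> * (fst ((Ht 1 ^^ n) w) - fst w)"
proof -
  obtain N0 :: nat where N0: "B / a \<le> real N0" using real_arch_simple by blast
  show ?thesis
  proof (intro exI[of _ "max m N0"] allI impI ballI)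
    fix n w assume n: "max m N0 \<le> n" and w: "w \<in> inv_set (Ht 1) (inv (Ht 1)) (ann_proj -` A)"
    have "ereal a \<le> ereal \<sigma> * ereal ((fst ((Ht 1 ^^ n) w) - fst w) / real n)"
      by (rule m(3)[OF rho_tail_lift[OF A w]]) (use n in simp)
    then have "a \<le> \<sigma> * (fst ((Ht 1 ^^ n) w) - fst w) / real n" by simp
    moreover have "0 < real n" using n m(1) by simp
    ultimately have "a * real n \<le> \<sigma> * (fst ((Ht 1 ^^ n) w) - fst w)" by (simp add: pos_le_divide_eq)
    moreover have "B / a \<le> real n" using N0 n by linarith
    then have "B \<le> a * real n" using m(2) by (simp add: pos_divide_le_eq mult.commute)
    ultimately show "B \<le> \<sigma> * (fst ((Ht 1 ^^ n) w) - fst w)" by linarith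
  qed
qed

lemma drift_of_rho_set:
  assumes A: "A \<subseteq> Ann"
    and rot: "\<sigma> = 1 \<and> rho_set (H 1) Ht (Theta (H 1) A) \<subseteq> {0<..<\<infinity>} \<or>
      \<sigma> = -1 \<and> rho_set (H 1) Ht (Theta (H 1) A) \<subseteq> {-\<infinity><..<0}"
  shows "\<exists>N. \<forall>n\<ge>N. \<forall>w\<in>inv_set (Ht 1) (inv (Ht 1)) (ann_proj -` A). B \<le> \<sigma> * (fst ((Ht 1 ^^ n) w) - fst w)"
  using rot
proof
  define T where "T = rho_tail (H 1) Ht (Theta (H 1) A)"
  assume "\<sigma> = 1 \<and> rho_set (H 1) Ht (Theta (H 1) A) \<subseteq> {0<..<\<infinity>}"
  then have \<sigma>: "\<sigma> = 1" and r: "(\<Inter>m\<in>{1..}. closure (T m)) \<subseteq> {0<..}" by (auto simp: rho_set_tail T_def)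
  have "\<exists>m\<ge>1. \<exists>a>0. \<forall>x\<in>closure (T m). ereal a \<le> x"
    by (rule decreasing_closed_positive[OF _ _ r]) (auto simp: T_def intro: closure_rho_tail_mono[THEN subsetD])
  then obtain m a where ma: "m \<ge> 1" "a > 0" "\<And>x. x \<in> closure (T m) \<Longrightarrow> ereal a \<le> x" by blast
  then have "ereal a \<le> ereal \<sigma> * x" if "x \<in> T m" for x
    using that closure_subset[of "T m"] \<sigma> by (auto simp flip: one_ereal_def)
  then show ?thesis using linear_drift[OF _ A ma(1,2)] \<sigma> unfolding T_def by blast
next
  define T where "T = rho_tail (H 1) Ht (Theta (H 1) A)"
  assume "\<sigma> = -1 \<and> rho_set (H 1) Ht (Theta (H 1) A) \<subseteq> {-\<infinity><..<0}"
  then have \<sigma>: "\<sigma> = -1" and r: "(\<Inter>m\<in>{1..}. closure (T m)) \<subseteq> {..<0}" by (auto simp: rho_set_tail T_def)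
  \<comment> \<open>Negation reduces the negative case to the positive one.\<close>
  have "(\<Inter>m\<in>{1..}. uminus ` closure (T m)) \<subseteq> {0<..}"
  proof
    fix x assume x: "x \<in> (\<Inter>m\<in>{1..}. uminus ` closure (T m))"
    have "- x \<in> closure (T m)" if "m \<in> {1..}" for m
    proof -
      have "x \<in> uminus ` closure (T m)" using x that by blast
      then show ?thesis by auto
    qed
    then have "- x < 0" using r by blast
    then show "x \<in> {0<..}" by (simp add: ereal_uminus_less_reorder)
  qed
  then have "\<exists>m\<ge>1. \<exists>a>0. \<forall>x\<in>uminus ` closure (T m). ereal a \<le> x"
    by (rule decreasing_closed_positive[rotated 2])
      (auto simp: T_def intro: ereal_closed_uminus closure_rho_tail_mono[THEN subsetD])
  then obtain m a where ma: "m \<ge> 1" "a > 0" "\<And>x. x \<in> closure (T m) \<Longrightarrow> ereal a \<le> - x" by blast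
  have "ereal a \<le> ereal \<sigma> * x" if "x \<in> T m" for x
  proof -
    have "ereal a \<le> - x" using ma(3) that closure_subset by blast
    then show ?thesis using \<sigma> by (cases x) auto
  qed
  then show ?thesis using linear_drift[OF _ A ma(1,2)] \<sigma> unfolding T_def by blast
qed

text \<open>Total displacement at most \<open>C\<close> over arbitrarily long segments gives
  averages tending to 0, all inside the tail starting at \<open>m\<close>; both ends of a segment
  lie in the invariant set.\<close>

lemma zero_in_rho_set:
  assumes A: "A \<subseteq> Ann"
    and C: "\<And>m. \<exists>n\<ge>m. \<exists>v\<in>inv_set (Ht 1) (inv (Ht 1)) (ann_proj -` A). \<bar>fst ((Ht 1 ^^ n) v) - fst v\<bar> \<le> C"
  shows "0 \<in> rho_set (H 1) Ht (Theta (H 1) A)"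
  unfolding rho_set_tail
proof (rule INT_I)
  fix m :: nat assume "m \<in> {1..}"
  have "\<exists>r. ereal r \<in> rho_tail (H 1) Ht (Theta (H 1) A) m \<and> \<bar>r\<bar> \<le> \<bar>C\<bar> * inverse (real (Suc i))" for i
  proof -
    obtain n v where n: "n \<ge> max m (Suc i)" and v: "v \<in> inv_set (Ht 1) (inv (Ht 1)) (ann_proj -` A)"
      "\<bar>fst ((Ht 1 ^^ n) v) - fst v\<bar> \<le> C" using C by blast
    have "\<bar>(fst ((Ht 1 ^^ n) v) - fst v) / real n\<bar> = \<bar>fst ((Ht 1 ^^ n) v) - fst v\<bar> * inverse (real n)"
      by (simp add: divide_inverse abs_mult)
    also have "\<dots> \<le> \<bar>C\<bar> * inverse (real (Suc i))"
      using v(2) n by (intro mult_mono le_imp_inverse_le) auto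
    finally show ?thesis using rho_tail_lift[OF A v(1), of m n] n by auto
  qed
  then obtain r where r: "\<And>i. ereal (r i) \<in> rho_tail (H 1) Ht (Theta (H 1) A) m"
    "\<And>i. \<bar>r i\<bar> \<le> \<bar>C\<bar> * inverse (real (Suc i))" by metis
  have "(\<lambda>i. \<bar>C\<bar> * inverse (real (Suc i))) \<longlonglongrightarrow> \<bar>C\<bar> * 0"
    by (intro tendsto_intros LIMSEQ_inverse_real_of_nat)
  then have "r \<longlonglongrightarrow> 0" using r(2) by (intro Lim_null_comparison[of r "\<lambda>i. \<bar>C\<bar> * inverse (real (Suc i))"]) auto
  then have "(\<lambda>i. ereal (r i)) \<longlonglongrightarrow> ereal 0" by (rule tendsto_ereal)
  then have lim: "(\<lambda>i. ereal (r i)) \<longlonglongrightarrow> 0" by (simp add: zero_ereal_def)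
  show "0 \<in> closure (rho_tail (H 1) Ht (Theta (H 1) A) m)"
    by (rule Lim_in_closed_set[OF closed_closure _ _ lim])
      (use r(1) closure_subset in \<open>auto intro!: always_eventually\<close>)
qed

lemma free_curve_lift:
  assumes h: "halves M L U" and \<gamma>: "ann_proj -` \<gamma> = - L \<inter> - U" and free: "f_free (H 1) \<gamma>"
  shows "(\<forall>w. w \<notin> L \<longrightarrow> Ht 1 w \<in> U) \<or> (\<forall>w. w \<notin> U \<longrightarrow> Ht 1 w \<in> L)"
proof (rule free_curve_up_or_down[OF plane_homeo_Ht[OF iso lift] h])
  note D = lift_isotopyD[OF lift_isotopy_Ht[OF iso lift]]
  obtain M1 where "\<forall>t\<in>{0..1}. \<forall>w. snd w < M1 \<longrightarrow> snd (Ht t w) < - M" using D(7) by blast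
  moreover have one: "(1::real) \<in> {0..1}" by simp
  ultimately show "\<exists>M'. \<forall>w. snd w < M' \<longrightarrow> snd (Ht 1 w) < - M" by blast
  obtain M2 where "\<forall>t\<in>{0..1}. \<forall>w. M2 < snd w \<longrightarrow> M < snd (Ht t w)" using D(6) by blast
  then show "\<exists>M'. \<forall>w. M' < snd w \<longrightarrow> M < snd (Ht 1 w)" using one by blast
  fix w assume "w \<notin> L" "w \<notin> U"
  then have "ann_proj w \<in> \<gamma>" using \<gamma> by blast
  then have "H 1 (ann_proj w) \<notin> \<gamma>" using free unfolding f_free_def by blast
  then have "ann_proj (Ht 1 w) \<notin> \<gamma>" using lift_proj[OF iso lift one] by simp
  then show "Ht 1 w \<in> L \<union> U" using \<gamma> by blast
qed

lemma zero_rotation_ordered: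
  assumes h: "halves M L0 U0" "halves M L1 U1" "halves M L2 U2"
    and sat: "saturated_open L0" "saturated_open U0" "saturated_open L1" "saturated_open U1" "saturated_open L2" "saturated_open U2"
    and \<gamma>: "\<gamma>0 \<subseteq> Ann" "\<gamma>1 \<subseteq> Ann" "\<gamma>2 \<subseteq> Ann"
      "ann_proj -` \<gamma>0 = - L0 \<inter> - U0" "ann_proj -` \<gamma>1 = - L1 \<inter> - U1" "ann_proj -` \<gamma>2 = - L2 \<inter> - U2"
    and nest: "- U0 \<subseteq> L1" "- U1 \<subseteq> L2"
    and free: "f_free (H 1) \<gamma>0" "f_free (H 1) \<gamma>1" "f_free (H 1) \<gamma>2"
    and ne: "Theta (H 1) (closed_annulus_between \<gamma>0 \<gamma>1) \<noteq> {}" "Theta (H 1) (closed_annulus_between \<gamma>1 \<gamma>2) \<noteq> {}"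
    and rot: "(rho_set (H 1) Ht (Theta (H 1) (closed_annulus_between \<gamma>0 \<gamma>1)) \<subseteq> {0<..<\<infinity>} \<and>
               rho_set (H 1) Ht (Theta (H 1) (closed_annulus_between \<gamma>1 \<gamma>2)) \<subseteq> {-\<infinity><..<0})
            \<or> (rho_set (H 1) Ht (Theta (H 1) (closed_annulus_between \<gamma>0 \<gamma>1)) \<subseteq> {-\<infinity><..<0} \<and>
               rho_set (H 1) Ht (Theta (H 1) (closed_annulus_between \<gamma>1 \<gamma>2)) \<subseteq> {0<..<\<infinity>})"
  shows "0 \<in> rho_set (H 1) Ht (Theta (H 1) (closed_annulus_between \<gamma>0 \<gamma>1 \<union> closed_annulus_between \<gamma>1 \<gamma>2))"
proof -
  interpret plane_homeo "Ht 1" "inv (Ht 1)" by (rule plane_homeo_Ht[OF iso lift])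
  interpret three_curves "Ht 1" "inv (Ht 1)" M L0 U0 L1 U1 L2 U2
    by unfold_locales (use h nest in auto)
  define A0 where "A0 = closed_annulus_between \<gamma>0 \<gamma>1"
  define A1 where "A1 = closed_annulus_between \<gamma>1 \<gamma>2"
  have A: "A0 \<subseteq> Ann" "A1 \<subseteq> Ann" unfolding A0_def A1_def by (intro closed_annulus_between_subset \<gamma>)+
  have l0: "ann_proj -` A0 = - L0 \<inter> - U1"
    unfolding A0_def by (rule closed_annulus_between_lift[OF h(1,2) sat(1-4) \<gamma>(1,2,4,5) nest(1)])
  have l1: "ann_proj -` A1 = - L1 \<inter> - U2"
    unfolding A1_def by (rule closed_annulus_between_lift[OF h(2,3) sat(3-6) \<gamma>(2,3,5,6) nest(2)])
  have l: "ann_proj -` (A0 \<union> A1) = - L0 \<inter> - U2"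
    unfolding vimage_Un l0 l1 using L01 U21 halvesD(5)[OF h(2)] by blast
  have lifted_ne: "inv_set (Ht 1) (inv (Ht 1)) (ann_proj -` A) \<noteq> {}"
    if A: "A \<subseteq> Ann" and ne: "Theta (H 1) A \<noteq> {}" for A
  proof -
    obtain z where z: "z \<in> Theta (H 1) A" using ne by blast
    then have "z \<in> Ann" using A by (auto simp: Theta_def)
    then obtain w where "ann_proj w = z" using ann_proj_surj by blast
    then have "w \<in> inv_set (Ht 1) (inv (Ht 1)) (ann_proj -` A)"
      using z by (simp flip: Theta_lift[OF iso lift A])
    then show ?thesis by blast
  qed
  have ne': "Th0 \<noteq> {}" "Th1 \<noteq> {}"
    using lifted_ne[OF A(1)] lifted_ne[OF A(2)] ne unfolding A0_def[symmetric] A1_def[symmetric] l0 l1 by blast+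
  obtain \<sigma> :: real where \<sigma>: "\<sigma> \<in> {1,-1}"
    "\<sigma> = 1 \<and> rho_set (H 1) Ht (Theta (H 1) A0) \<subseteq> {0<..<\<infinity>} \<or>
      \<sigma> = -1 \<and> rho_set (H 1) Ht (Theta (H 1) A0) \<subseteq> {-\<infinity><..<0}"
    "- \<sigma> = 1 \<and> rho_set (H 1) Ht (Theta (H 1) A1) \<subseteq> {0<..<\<infinity>} \<or>
      - \<sigma> = -1 \<and> rho_set (H 1) Ht (Theta (H 1) A1) \<subseteq> {-\<infinity><..<0}"
    using rot unfolding A0_def[symmetric] A1_def[symmetric] by force
  have "opposite_rotation \<sigma>"
    unfolding opposite_rotation_def
  proof (intro conjI allI)
    fix B
    obtain N0 where N0: "\<And>n w. n \<ge> N0 \<Longrightarrow> w \<in> Th0 \<Longrightarrow> B \<le> \<sigma> * (fst ((Ht 1 ^^ n) w) - fst w)"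
      using drift_of_rho_set[OF A(1) \<sigma>(2), of B] unfolding l0 by blast
    obtain N1 where N1: "\<And>n w. n \<ge> N1 \<Longrightarrow> w \<in> Th1 \<Longrightarrow> B \<le> - \<sigma> * (fst ((Ht 1 ^^ n) w) - fst w)"
      using drift_of_rho_set[OF A(2) \<sigma>(3), of B] unfolding l1 by blast
    show "\<exists>N. \<forall>n\<ge>N. (\<forall>w\<in>Th0. B \<le> \<sigma> * (fst ((Ht 1 ^^ n) w) - fst w)) \<and> (\<forall>w\<in>Th1. \<sigma> * (fst ((Ht 1 ^^ n) w) - fst w) \<le> - B)"
    proof (intro exI[of _ "max N0 N1"] allI impI conjI ballI)
      fix n w assume n: "max N0 N1 \<le> n"
      show "B \<le> \<sigma> * (fst ((Ht 1 ^^ n) w) - fst w)" if "w \<in> Th0" using N0[of n w] n that by simp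
      show "\<sigma> * (fst ((Ht 1 ^^ n) w) - fst w) \<le> - B" if "w \<in> Th1" using N1[of n w] n that by simp
    qed
  qed (rule \<sigma>(1))
  then have "\<exists>C. \<forall>m. \<exists>n\<ge>m. \<exists>v\<in>inv_set (Ht 1) (inv (Ht 1)) (- L0 \<inter> - U2). \<bar>fst ((Ht 1 ^^ n) v) - fst v\<bar> \<le> C"
    by (rule balanced_segments[OF lift_isotopy_Ht[OF iso lift] refl free_curve_lift[OF h(1) \<gamma>(4) free(1)]
          free_curve_lift[OF h(2) \<gamma>(5) free(2)] free_curve_lift[OF h(3) \<gamma>(6) free(3)] _ ne'])
  then obtain C where "\<And>m. \<exists>n\<ge>m. \<exists>v\<in>inv_set (Ht 1) (inv (Ht 1)) (ann_proj -` (A0 \<union> A1)). \<bar>fst ((Ht 1 ^^ n) v) - fst v\<bar> \<le> C"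
    unfolding l by blast
  then show ?thesis unfolding A0_def[symmetric] A1_def[symmetric] using A by (intro zero_in_rho_set) auto
qed

end

theorem theoremC:
  fixes H :: "real \<Rightarrow> complex \<times> real \<Rightarrow> complex \<times> real"
    and Ht :: "real \<Rightarrow> real \<times> real \<Rightarrow> real \<times> real"
    and \<gamma>0 \<gamma>1 \<gamma>2 :: "(complex \<times> real) set"
  assumes iso: "ann_isotopy H"
    and lift: "is_isotopy_lift Ht H"
    and jc: "jordan_curve_in_Ann \<gamma>0" "jordan_curve_in_Ann \<gamma>1" "jordan_curve_in_Ann \<gamma>2"
    and ess: "essential \<gamma>0" "essential \<gamma>1" "essential \<gamma>2"
    and disj: "\<gamma>0 \<inter> \<gamma>1 = {}" "\<gamma>0 \<inter> \<gamma>2 = {}" "\<gamma>1 \<inter> \<gamma>2 = {}"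
    and free: "f_free (H 1) \<gamma>0" "f_free (H 1) \<gamma>1" "f_free (H 1) \<gamma>2"
    and sep: "separates \<gamma>1 \<gamma>0 \<gamma>2"
    and ne: "Theta (H 1) (closed_annulus_between \<gamma>0 \<gamma>1) \<noteq> {}"
            "Theta (H 1) (closed_annulus_between \<gamma>1 \<gamma>2) \<noteq> {}"
    and rot: "(rho_set (H 1) Ht (Theta (H 1) (closed_annulus_between \<gamma>0 \<gamma>1)) \<subseteq> {0<..<\<infinity>} \<and>
               rho_set (H 1) Ht (Theta (H 1) (closed_annulus_between \<gamma>1 \<gamma>2)) \<subseteq> {-\<infinity><..<0})
            \<or> (rho_set (H 1) Ht (Theta (H 1) (closed_annulus_between \<gamma>0 \<gamma>1)) \<subseteq> {-\<infinity><..<0} \<and>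
               rho_set (H 1) Ht (Theta (H 1) (closed_annulus_between \<gamma>1 \<gamma>2)) \<subseteq> {0<..<\<infinity>})"
  shows "0 \<in> rho_set (H 1) Ht
           (Theta (H 1) (closed_annulus_between \<gamma>0 \<gamma>1 \<union> closed_annulus_between \<gamma>1 \<gamma>2))"
proof -
  obtain M0 L0 U0 where h0: "halves M0 L0 U0" and \<gamma>0: "ann_proj -` \<gamma>0 = - L0 \<inter> - U0" and s0: "saturated_open L0" "saturated_open U0"
    by (rule essential_curve_halves[OF jc(1) ess(1)])
  obtain M1 L1 U1 where h1: "halves M1 L1 U1" and \<gamma>1: "ann_proj -` \<gamma>1 = - L1 \<inter> - U1" and s1: "saturated_open L1" "saturated_open U1"
    by (rule essential_curve_halves[OF jc(2) ess(2)])
  obtain M2 L2 U2 where h2: "halves M2 L2 U2" and \<gamma>2: "ann_proj -` \<gamma>2 = - L2 \<inter> - U2" and s2: "saturated_open L2" "saturated_open U2"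
    by (rule essential_curve_halves[OF jc(3) ess(3)])
  define M where "M = max M0 (max M1 M2)"
  have h: "halves M L0 U0" "halves M L1 U1" "halves M L2 U2"
    using halves_mono[OF h0] halves_mono[OF h1] halves_mono[OF h2] by (simp_all add: M_def)
  have Ann: "\<gamma>0 \<subseteq> Ann" "\<gamma>1 \<subseteq> Ann" "\<gamma>2 \<subseteq> Ann" using jc by (simp_all add: jordan_curve_in_Ann_def)
  have d1: "L1 \<inter> U1 = {}" by (rule halvesD(5)[OF h1])
  \<comment> \<open>A connected set containing both outer lifts and missing the middle one projects
    into a single component of the complement of \<open>\<gamma>1\<close>, against the separation
    hypothesis.\<close>
  have same_side: False
    if S: "connected S" "S \<inter> ann_proj -` \<gamma>1 = {}" "ann_proj -` \<gamma>0 \<subseteq> S" "ann_proj -` \<gamma>2 \<subseteq> S" for S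
  proof -
    have sub: "ann_proj ` S \<subseteq> Ann - \<gamma>1" using S(2) ann_proj_Ann by blast
    have cover: "\<gamma> \<subseteq> ann_proj ` S" if \<gamma>: "\<gamma> \<subseteq> Ann" "ann_proj -` \<gamma> \<subseteq> S" for \<gamma>
    proof
      fix z assume z: "z \<in> \<gamma>"
      then obtain w where "ann_proj w = z" using ann_proj_surj \<gamma>(1) by blast
      then show "z \<in> ann_proj ` S" using \<gamma>(2) z by blast
    qed
    have "Ann - \<gamma>1 \<noteq> {}"
    proof
      assume "Ann - \<gamma>1 = {}"
      then have "ann_proj w \<in> \<gamma>1" for w using ann_proj_Ann by blast
      then have "(0, M1 + 1) \<notin> U1" using \<gamma>1 by blast
      then show False using halvesD(11)[OF h1, of "(0, M1 + 1)"] by simp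
    qed
    then obtain C where C: "C \<in> components (Ann - \<gamma>1)" "ann_proj ` S \<subseteq> C"
      using exists_component_superset[OF sub _ connected_ann_proj_image[OF S(1)]] by metis
    have "\<gamma>0 \<subseteq> C" "\<gamma>2 \<subseteq> C"
      using cover[OF Ann(1) S(3)] cover[OF Ann(3) S(4)] C(2) by (meson order_trans)+
    then show False using sep C(1) unfolding separates_def by metis
  qed
  have disj': "(- L0 \<inter> - U0) \<inter> (- L1 \<inter> - U1) = {}" "(- L1 \<inter> - U1) \<inter> (- L2 \<inter> - U2) = {}"
    unfolding \<gamma>0[symmetric] \<gamma>1[symmetric] \<gamma>2[symmetric] using disj by blast+
  have notL: "\<not> (- L0 \<inter> - U0 \<subseteq> L1 \<and> - L2 \<inter> - U2 \<subseteq> L1)"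
    using same_side[OF halvesD(3)[OF h1]] unfolding \<gamma>0 \<gamma>1 \<gamma>2 by blast
  have notU: "\<not> (- L0 \<inter> - U0 \<subseteq> U1 \<and> - L2 \<inter> - U2 \<subseteq> U1)"
    using same_side[OF halvesD(4)[OF h1]] unfolding \<gamma>0 \<gamma>1 \<gamma>2 by blast
  have n01: "- U0 \<subseteq> L1 \<or> - U1 \<subseteq> L0" by (rule disjoint_curves_nested[OF h(1,2) disj'(1)])
  have n12: "- U1 \<subseteq> L2 \<or> - U2 \<subseteq> L1" by (rule disjoint_curves_nested[OF h(2,3) disj'(2)])
  \<comment> \<open>Disjointness alone allows four relative positions; the two with both outer
    curves on the same side of \<open>\<gamma>1\<close> are excluded.\<close>
  consider "- U0 \<subseteq> L1" "- U1 \<subseteq> L2" | "- U1 \<subseteq> L0" "- U2 \<subseteq> L1"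
  proof -
    have *: "- U1 \<subseteq> L0 \<Longrightarrow> - L0 \<inter> - U0 \<subseteq> U1" "- U1 \<subseteq> L2 \<Longrightarrow> - L2 \<inter> - U2 \<subseteq> U1"
      "- U0 \<subseteq> L1 \<Longrightarrow> - L0 \<inter> - U0 \<subseteq> L1" "- U2 \<subseteq> L1 \<Longrightarrow> - L2 \<inter> - U2 \<subseteq> L1" by blast+
    show thesis using n01 n12 notL notU * that by metis
  qed
  then show ?thesis
  proof cases
    case 1
    show ?thesis
      by (rule zero_rotation_ordered[OF iso lift h s0 s1 s2 Ann \<gamma>0 \<gamma>1 \<gamma>2 1 free ne rot])
  next
    case 2
    \<comment> \<open>The curves are stacked in the reverse order. The hypotheses are symmetric
      under exchanging the indices 0 and 2, since the signs of the rotation sets come as an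
      alternative.\<close>
    note comm = closed_annulus_between_commute[of \<gamma>2 \<gamma>1] closed_annulus_between_commute[of \<gamma>1 \<gamma>0]
    have "0 \<in> rho_set (H 1) Ht
           (Theta (H 1) (closed_annulus_between \<gamma>2 \<gamma>1 \<union> closed_annulus_between \<gamma>1 \<gamma>0))"
    proof (rule zero_rotation_ordered[OF iso lift h(3,2,1) s2 s1 s0 Ann(3,2,1) \<gamma>2 \<gamma>1 \<gamma>0 2(2,1) free(3,2,1)])
      show "Theta (H 1) (closed_annulus_between \<gamma>2 \<gamma>1) \<noteq> {}" "Theta (H 1) (closed_annulus_between \<gamma>1 \<gamma>0) \<noteq> {}"
        using ne unfolding comm by blast+
    qed (use rot comm in auto)
    then show ?thesis unfolding comm by (simp add: Un_commute)
  qed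
qed

end
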